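(* There exists a function $\kappa:(0,\infty)\to(0,\infty)$ with $\kappa(\rho)\sim C\rho^{-1}$ as $\rho\to\infty$ for some constant $C>0$, such that the following holds. Let $f$ be an entire function of finite positive order $\rho$. Then there exist arbitrarily large $r$ such that for every sector $S$ of opening $\alpha$ (the same $r$ serving all sectors simultaneously), we have \[ A(r,S,f)\ \ge\ \frac{\alpha\cdot\kappa(\rho)}{2\pi}. \]
   Context: A sector is a set $S=\{w\in\mathbb{C}: 0<|w|<\infty,\ \theta_1<\arg w<\theta_2\}$ with vertex at the origin; its opening is $\alpha=\theta_2-\theta_1\in(0,2\pi]$. For an entire function $f$, write $r\mathbb{D}=\{z\in\mathbb{C}:|z|<r\}$ and define the relative area of the preimage \[ A(r,S,f)=\frac{\operatorname{Area}(f^{-1}S\cap r\mathbb{D})}{\operatorname{Area}(r\mathbb{D})}. \] Entire functions are assumed non-constant. The order of an entire function $f$ is $\rho=\limsup_{r\to\infty}\frac{\log\log M(r,f)}{\log r}$, where $M(r,f)=\max_{|z|\le r}|f(z)|$. *)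

theory Defs
  imports "HOL-Complex_Analysis.Complex_Analysis" "HOL-Library.Landau_Symbols"
begin

text \<open>The argument is multi-valued: a point lies in the sector if some value of its argument
  lies in the open interval. Thus the endpoints range over all reals, and the opening
  \<open>\<theta>2 - \<theta>1\<close> is to be constrained to \<open>(0, 2\<pi>]\<close> where sectors are used.\<close>

definition sector :: "real \<Rightarrow> real \<Rightarrow> complex set" where
  "sector \<theta>1 \<theta>2 = {w. 0 < norm w \<and> (\<exists>t. is_Arg w t \<and> \<theta>1 < t \<and> t < \<theta>2)}"

definition relative_area :: "real \<Rightarrow> complex set \<Rightarrow> (complex \<Rightarrow> complex) \<Rightarrow> real" where
  "relative_area r S f = measure lebesgue (f -` S \<inter> ball 0 r) / measure lebesgue (ball (0::complex) r)"

definition max_modulus :: "real \<Rightarrow> (complex \<Rightarrow> complex) \<Rightarrow> real" where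
  "max_modulus r f = (SUP z\<in>cball 0 r. norm (f z))"

text \<open>For non-constant entire \<open>f\<close> the maximum modulus tends to infinity, so the values of \<^term>\<open>ln\<close>
  at non-positive arguments do not affect the upper limit.\<close>

definition entire_order :: "(complex \<Rightarrow> complex) \<Rightarrow> ereal" where
  "entire_order f = Limsup at_top (\<lambda>r::real. ereal (ln (ln (max_modulus r f)) / ln r))"

end

theory Submission
  imports Defs
begin

text \<open>The argument of \<open>f\<close> is uniformly spread over an area wherever the gradient of \<open>ln |f|\<close>,
  i.e. \<open>|f'/f|\<close>, is large compared with its relative variation. Rescale to a disc around a point \<open>z\<close>
  with \<open>|f z| = M(|z|)\<close>, such that on this disc \<open>ln |f / f z|\<close> is at most \<open>L\<close>, while
  slightly closer to the origin it is at most \<open>- c L\<close>. There \<open>f'/f\<close> is a sum of \<open>O(L)\<close> simple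
  poles and a function bounded by \<open>O(L)\<close>. Comparing mean values of \<open>ln |f|\<close> shows that
  \<open>|f'/f|\<close> is of order \<open>L\<close> on a fixed proportion of the disc, and outside a small set it is nearly
  constant at the scale \<open>1/L\<close>; so for large \<open>L\<close> a fixed proportion (times \<open>\<alpha>\<close>) of the disc is
  mapped to any sector of opening \<open>\<alpha>\<close>.

  By Hadamard's three circles theorem and finite order, such discs of radius comparable to
  \<open>|z| / (\<rho> + 1)\<close> exist in at least half of the annuli of relative width comparable to
  \<open>1 / (\<rho> + 1)\<close> in suitable arbitrarily large ranges \<open>r / 3 < |z| < r\<close>. There are of order \<open>\<rho> + 1\<close>
  such annuli, each contributing a relative area of order \<open>\<alpha> / (\<rho> + 1)\<^sup>2\<close>.\<close>

section \<open>Lebesgue measure on the plane\<close>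

text \<open>Zeros are the obstacle: the logarithmic derivative is unbounded near them, and the
  variation of a pole is of size 1 / |z - a|^2, which is not integrable in the plane. The exponent
  -3/2 in \<open>W\<close> is a compromise. It lies above -2, so \<open>W\<close> has integral O(L);
  a small multiple of it plus a constant dominates 1 / |z - a|; and where \<open>W z\<close> is at
  most \<open>K * L\<close>, every zero is at distance at least (K L) powr (-2/3) from
  \<open>z\<close>, far beyond the scale 1 / L, so that there the logarithmic derivative, of size at
  least \<gamma> L, varies only by O(L powr (1/3)). The order enters twice: finiteness limits how
  fast the slopes of ln M against ln r can grow, and positivity makes these slopes unbounded, which
  supplies the large L. The discs and \<open>r\<close> are found from the growth of M alone, and the
  local constants depend only on \<open>c\<close>; this is why one \<open>r\<close> serves all
  sectors.\<close>

lemma nn_integral_lborel_translate: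
  fixes f :: "'a::euclidean_space \<Rightarrow> ennreal"
  assumes [measurable]: "f \<in> borel_measurable borel"
  shows "(\<integral>\<^sup>+z. f (z + a) \<partial>lborel) = (\<integral>\<^sup>+z. f z \<partial>lborel)"
proof -
  have "(\<integral>\<^sup>+z. f z \<partial>lborel) = (\<integral>\<^sup>+z. f z \<partial>distr lborel borel ((+) a))"
    by (simp add: lborel_distr_plus)
  also have "\<dots> = (\<integral>\<^sup>+z. f (z + a) \<partial>lborel)"
    by (subst nn_integral_distr) (auto simp: add.commute)
  finally show ?thesis by simp
qed

lemma nn_integral_lborel_reflect:
  fixes f :: "'a::euclidean_space \<Rightarrow> ennreal"
  assumes [measurable]: "f \<in> borel_measurable borel"
  shows "(\<integral>\<^sup>+z. f (a - z) \<partial>lborel) = (\<integral>\<^sup>+z. f z \<partial>lborel)"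
proof -
  have "(\<integral>\<^sup>+z. f z \<partial>lborel) =
      (\<integral>\<^sup>+z. f z \<partial>density (distr lborel borel (\<lambda>x. a + (-1) *\<^sub>R x)) (\<lambda>_. \<bar>-1::real\<bar>^DIM('a)))"
    by (subst lborel_affine[of "-1" a]) auto
  also have "\<dots> = (\<integral>\<^sup>+z. f (a - z) \<partial>lborel)"
    by (simp add: nn_integral_density nn_integral_distr)
  finally show ?thesis by simp
qed

text \<open>Uniqueness of Haar measure in disguise: integrating \<open>f (u z) g (y + u z)\<close> in both
  orders identifies the two measures up to a factor, which the unit disc shows to be 1.\<close>

lemma nn_integral_lborel_rotate:
  fixes f :: "complex \<Rightarrow> ennreal" and u :: complex
  assumes [measurable]: "f \<in> borel_measurable borel" and u: "norm u = 1"
  shows "(\<integral>\<^sup>+z. f (u * z) \<partial>lborel) = (\<integral>\<^sup>+z. f z \<partial>lborel)"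
proof -
  define I where "I h = (\<integral>\<^sup>+z. h (u * z) \<partial>lborel)" for h :: "complex \<Rightarrow> ennreal"
  define J where "J h = (\<integral>\<^sup>+z. h z \<partial>lborel)" for h :: "complex \<Rightarrow> ennreal"
  have u0: "u \<noteq> 0" using u by auto
  \<comment> \<open>Translation invariance of \<open>I\<close>: adding \<open>a\<close> to
    \<open>u * z\<close> is adding \<open>a / u\<close> to \<open>z\<close>.\<close>
  have translate: "(\<integral>\<^sup>+z. h (u * z) \<partial>lborel) = (\<integral>\<^sup>+z. h (u * z + a) \<partial>lborel)"
    if [measurable]: "h \<in> borel_measurable borel" for h :: "complex \<Rightarrow> ennreal" and a
  proof -
    have "(\<integral>\<^sup>+z. h (u * z) \<partial>lborel) = (\<integral>\<^sup>+z. h (u * (z + a / u)) \<partial>lborel)"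
      by (subst nn_integral_lborel_translate[where f="\<lambda>z. h (u * z)"]) auto
    then show ?thesis using u0 by (simp add: algebra_simps)
  qed
  define g :: "complex \<Rightarrow> ennreal" where "g = indicator (ball 0 1)"
  have [measurable]: "g \<in> borel_measurable borel" unfolding g_def by (intro borel_measurable_indicator) auto
  have "I f * J g = (\<integral>\<^sup>+z. f (u * z) * (\<integral>\<^sup>+y. g (y + u * z) \<partial>lborel) \<partial>lborel)"
    by (simp add: I_def J_def nn_integral_lborel_translate nn_integral_multc)
  also have "\<dots> = (\<integral>\<^sup>+z. (\<integral>\<^sup>+y. f (u * z) * g (y + u * z) \<partial>lborel) \<partial>lborel)"
    by (simp add: nn_integral_cmult)
  also have "\<dots> = (\<integral>\<^sup>+y. (\<integral>\<^sup>+z. f (u * z) * g (y + u * z) \<partial>lborel) \<partial>lborel)"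
    by (rule lborel_pair.Fubini') measurable
  also have "\<dots> = (\<integral>\<^sup>+y. (\<integral>\<^sup>+z. f (u * z - y) * g (u * z) \<partial>lborel) \<partial>lborel)"
  proof (rule nn_integral_cong)
    fix y :: complex
    show "(\<integral>\<^sup>+z. f (u * z) * g (y + u * z) \<partial>lborel) = (\<integral>\<^sup>+z. f (u * z - y) * g (u * z) \<partial>lborel)"
      using translate[where h="\<lambda>z. f (z - y) * g z" and a=y] by (simp add: add.commute)
  qed
  also have "\<dots> = (\<integral>\<^sup>+z. (\<integral>\<^sup>+y. f (u * z - y) * g (u * z) \<partial>lborel) \<partial>lborel)"
    by (rule lborel_pair.Fubini') measurable
  also have "\<dots> = J f * I g"
    by (simp add: nn_integral_multc nn_integral_lborel_reflect I_def J_def nn_integral_cmult)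
  finally have eq: "I f * J g = J f * I g" .
  have "I g = J g"
  proof -
    have "g (u * z) = g z" for z
      using u by (simp add: g_def indicator_def norm_mult)
    then show ?thesis by (simp add: I_def J_def)
  qed
  moreover have "J g = ennreal (unit_ball_vol 2)"
    unfolding J_def g_def by (simp add: emeasure_ball)
  moreover have "unit_ball_vol 2 > (0::real)" by simp
  ultimately have "I f * ennreal (unit_ball_vol 2) = J f * ennreal (unit_ball_vol 2)"
    using eq by simp
  then have "I f * ennreal (unit_ball_vol 2) * ennreal (inverse (unit_ball_vol 2)) =
      J f * ennreal (unit_ball_vol 2) * ennreal (inverse (unit_ball_vol 2))" by simp
  then have "I f = J f"
    using \<open>unit_ball_vol 2 > (0::real)\<close> by (simp add: mult.assoc flip: ennreal_mult')
  then show ?thesis by (simp add: I_def J_def)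
qed

section \<open>Integrability of |z - a| powr (-3/2) in the plane\<close>

lemma nn_integral_abs_powr_Icc:
  assumes "R > 0"
  shows "(\<integral>\<^sup>+x. ennreal (\<bar>x\<bar> powr (-3/4)) * indicator {-R..R} x \<partial>lborel) = ennreal (8 * R powr (1/4))"
proof -
  have *: "((\<lambda>x. x powr (-3/4)) has_integral (4 * R powr (1/4))) {0..R}"
    using has_integral_powr_from_0[of "-3/4" R] assms by (simp add: field_simps)
  have nn: "(\<integral>\<^sup>+x. ennreal (\<bar>x\<bar> powr (-3/4)) * indicator {0..R} x \<partial>lborel) = ennreal (4 * R powr (1/4))"
    using nn_integral_has_integral_lebesgue'[OF _ *]
    by (subst nn_integral_cong[where v="\<lambda>x. ennreal (x powr (-3/4)) * indicator {0..R} x"])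
       (auto simp: indicator_def)
  have nn': "(\<integral>\<^sup>+x. ennreal (\<bar>x\<bar> powr (-3/4)) * indicator {-R..0} x \<partial>lborel) = ennreal (4 * R powr (1/4))"
  proof -
    have "(\<integral>\<^sup>+x. ennreal (\<bar>x\<bar> powr (-3/4)) * indicator {-R..0} x \<partial>lborel) =
        (\<integral>\<^sup>+x. ennreal (\<bar>0 - x\<bar> powr (-3/4)) * indicator {-R..0} (0 - x) \<partial>lborel)"
      by (subst nn_integral_lborel_reflect) auto
    also have "\<dots> = (\<integral>\<^sup>+x. ennreal (\<bar>x\<bar> powr (-3/4)) * indicator {0..R} x \<partial>lborel)"
      by (intro nn_integral_cong) (auto simp: indicator_def)
    finally show ?thesis using nn by simp
  qed
  have "(\<integral>\<^sup>+x. ennreal (\<bar>x\<bar> powr (-3/4)) * indicator {-R..R} x \<partial>lborel) =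
     (\<integral>\<^sup>+x. ennreal (\<bar>x\<bar> powr (-3/4)) * indicator {-R..0} x + ennreal (\<bar>x\<bar> powr (-3/4)) * indicator {0..R} x \<partial>lborel)"
    using assms by (intro nn_integral_cong) (auto simp: indicator_def)
  also have "\<dots> = ennreal (4 * R powr (1/4)) + ennreal (4 * R powr (1/4))"
    by (subst nn_integral_add) (use nn nn' in auto)
  finally show ?thesis by (simp flip: ennreal_plus)
qed

text \<open>From |Re z| |Im z| \<le> |z|^2. The bound separates the variables, so that the planar
  integral splits into two integrals over lines. The axes are excluded because
  \<open>0 powr (-3/4)\<close> is 0, which makes the right-hand side vanish there.\<close>

lemma norm_powr_le_Re_Im:
  fixes z :: complex
  shows "norm z powr (-3/2) \<le> \<bar>Re z\<bar> powr (-3/4) * \<bar>Im z\<bar> powr (-3/4) \<or> Re z = 0 \<or> Im z = 0"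
proof -
  { assume nz: "Re z \<noteq> 0" "Im z \<noteq> 0"
    have "\<bar>Re z\<bar> * \<bar>Im z\<bar> \<le> norm z ^ 2"
    proof -
      have "\<bar>Re z\<bar> * \<bar>Im z\<bar> \<le> norm z * norm z"
        by (intro mult_mono abs_Re_le_cmod abs_Im_le_cmod) auto
      then show ?thesis by (simp add: power2_eq_square)
    qed
    then have "(norm z ^ 2) powr (-3/4) \<le> (\<bar>Re z\<bar> * \<bar>Im z\<bar>) powr (-3/4)"
      by (intro powr_mono2') (use nz in auto)
    moreover have "(norm z ^ 2) powr (-3/4) = norm z powr (-3/2)"
      using nz by (simp add: powr_powr flip: powr_numeral)
    ultimately have "norm z powr (-3/2) \<le> \<bar>Re z\<bar> powr (-3/4) * \<bar>Im z\<bar> powr (-3/4)"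
      by (simp add: powr_mult)
  }
  then show ?thesis by blast
qed

text \<open>Finite since -3/2 > -2. The disc is enlarged to a square, on which the separated bound
  yields the product of two integrals \<open>8 * R powr (1/4)\<close>; the axes are a null
  set.\<close>

lemma nn_integral_norm_powr_le:
  fixes a :: complex
  assumes "R > 0"
  shows "(\<integral>\<^sup>+z. ennreal (norm (z - a) powr (-3/2)) * indicator (ball a R) z \<partial>lborel) \<le> ennreal (64 * sqrt R)"
proof -
  have "(\<integral>\<^sup>+z. ennreal (norm (z - a) powr (-3/2)) * indicator (ball a R) z \<partial>lborel) =
     (\<integral>\<^sup>+z. ennreal (norm (z::complex) powr (-3/2)) * indicator (ball 0 R) z \<partial>lborel)"
    using nn_integral_lborel_translate[where a=a and f="\<lambda>z. ennreal (norm (z - a) powr (-3/2)) * indicator (ball a R) z"]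
    by (simp add: indicator_def dist_norm norm_minus_commute)
  also have "\<dots> \<le> (\<integral>\<^sup>+z. (\<Prod>b\<in>(Basis::complex set). ennreal (\<bar>z \<bullet> b\<bar> powr (-3/4) * indicator {-R..R} (z \<bullet> b))) \<partial>lborel)"
  proof (rule nn_integral_mono_AE)
    have "negligible {z::complex. z \<bullet> 1 = 0}" "negligible {z::complex. z \<bullet> \<i> = 0}"
      by (intro negligible_standard_hyperplane; simp add: Basis_complex_def)+
    then have "{z::complex. z \<bullet> 1 = 0} \<in> null_sets lebesgue" "{z::complex. z \<bullet> \<i> = 0} \<in> null_sets lebesgue"
      by (simp_all add: negligible_iff_null_sets)
    then have *: "AE z in lebesgue. (z::complex) \<bullet> 1 \<noteq> 0 \<and> z \<bullet> \<i> \<noteq> 0"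
      by (auto dest!: AE_not_in elim!: eventually_elim2)
    then have "AE z in lborel. (z::complex) \<bullet> 1 \<noteq> 0 \<and> z \<bullet> \<i> \<noteq> 0"
      by (simp add: AE_completion_iff)
    then show "AE z in lborel. ennreal (norm z powr (-3/2)) * indicator (ball (0::complex) R) z \<le>
        (\<Prod>b\<in>Basis. ennreal (\<bar>z \<bullet> b\<bar> powr (-3/4) * indicator {-R..R} (z \<bullet> b)))"
    proof eventually_elim
      case (elim z)
      then have le: "norm z powr (-3/2) \<le> \<bar>Re z\<bar> powr (-3/4) * \<bar>Im z\<bar> powr (-3/4)"
        using norm_powr_le_Re_Im[of z] by (simp add: inner_complex_def)
      show ?case
      proof (cases "z \<in> ball 0 R")
        case True
        then have "\<bar>Re z\<bar> \<le> R" "\<bar>Im z\<bar> \<le> R"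
          using abs_Re_le_cmod[of z] abs_Im_le_cmod[of z] by auto
        then show ?thesis using le True
          by (simp add: Basis_complex_def inner_complex_def indicator_def abs_le_iff minus_le_iff flip: ennreal_mult')
      qed auto
    qed
  qed
  also have "\<dots> = (\<Prod>b\<in>(Basis::complex set). (\<integral>\<^sup>+x. ennreal (\<bar>x\<bar> powr (-3/4) * indicator {-R..R} x) \<partial>lborel))"
    by (rule nn_integral_lborel_prod) auto
  also have "\<dots> = ennreal (8 * R powr (1/4)) * ennreal (8 * R powr (1/4))"
  proof -
    have "(\<integral>\<^sup>+x. ennreal (\<bar>x\<bar> powr (-3/4) * indicator {-R..R} x) \<partial>lborel) = ennreal (8 * R powr (1/4))"
      using nn_integral_abs_powr_Icc[OF assms] by (simp add: ennreal_mult' ennreal_indicator)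
    then show ?thesis by (simp add: Basis_complex_def)
  qed
  also have "\<dots> = ennreal (64 * sqrt R)"
    using assms by (simp add: powr_half_sqrt flip: ennreal_mult' powr_add)
  finally show ?thesis .
qed

section \<open>Circle means and the Borel-Caratheodory inequality\<close>

lemma lborel_distr_rotate:
  fixes u :: complex
  assumes "norm u = 1"
  shows "distr lborel borel (\<lambda>z. u * z) = lborel"
proof (rule measure_eqI)
  fix A assume "A \<in> sets (distr lborel borel (\<lambda>z. u * z))"
  then have [measurable]: "A \<in> sets borel" by simp
  have "emeasure (distr lborel borel (\<lambda>z. u * z)) A = (\<integral>\<^sup>+z. indicator A z \<partial>distr lborel borel (\<lambda>z. u * z))"
    by simp
  also have "\<dots> = (\<integral>\<^sup>+z. indicator A (u * z) \<partial>lborel)"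
    by (rule nn_integral_distr) auto
  also have "\<dots> = emeasure lborel A"
    by (subst nn_integral_lborel_rotate) (use assms in auto)
  finally show "emeasure (distr lborel borel (\<lambda>z. u * z)) A = emeasure lborel A" .
qed simp

lemma holomorphic_circle_mean:
  assumes H: "H holomorphic_on ball 0 R" and R: "R > 1"
  shows "((\<lambda>t. H (cis (2 * pi * t))) has_integral H 0) {0..1}"
proof -
  have "H holomorphic_on cball 0 1"
    using H by (rule holomorphic_on_subset) (use R in auto)
  then have "((\<lambda>u. H u / (u - 0)) has_contour_integral (2 * of_real pi * \<i> * H 0)) (circlepath 0 1)"
    by (intro Cauchy_integral_circlepath_simple) auto
  then have "((\<lambda>x. (2 * of_real pi * \<i>) * H (cis (2 * pi * x))) has_integral (2 * of_real pi * \<i>) * H 0) {0..1}"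
    unfolding has_contour_integral_def
  proof (rule has_integral_eq[rotated])
    fix x :: real assume "x \<in> {0..1}"
    then have vd: "vector_derivative (circlepath 0 1) (at x within {0..1}) =
        2 * of_real pi * \<i> * exp (2 * of_real pi * \<i> * x)"
      using vector_derivative_circlepath01[of x 0 1] by simp
    show "H (circlepath 0 1 x) / (circlepath 0 1 x - 0) * vector_derivative (circlepath 0 1) (at x within {0..1}) =
        2 * of_real pi * \<i> * H (cis (2 * pi * x))"
      unfolding vd by (simp add: circlepath cis_conv_exp mult_ac)
  qed
  from has_integral_mult_right[OF this, of "inverse (2 * of_real pi * \<i>)"]
  show ?thesis by (simp add: field_simps)
qed

lemma harmonic_circle_mean:
  assumes "H holomorphic_on ball 0 R" "R > 1"
  shows "((\<lambda>t. Re (H (cis (2 * pi * t)))) has_integral Re (H 0)) {0..1}"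
  using has_integral_linear[OF holomorphic_circle_mean[OF assms] bounded_linear_Re] by (simp add: o_def)

text \<open>\<open>Re (Ln (1 - w * b))\<close> vanishes at 0 and is harmonic on a disc of some
  radius \<open>R > 1\<close>, because \<open>R * norm b < 1\<close> keeps \<open>1 - w * b\<close>
  in the right half-plane.\<close>

lemma ln_norm_circle_mean_aux:
  fixes b :: complex
  assumes "norm b < 1"
  shows "((\<lambda>t. ln (norm (1 - cis (2 * pi * t) * b))) has_integral 0) {0..1}"
proof -
  obtain R where R: "R > 1" "R * norm b < 1"
  proof (cases "b = 0")
    case False
    then have "1 < inverse (norm b)" using assms by (simp add: one_less_inverse_iff)
    then obtain R where "1 < R" "R < inverse (norm b)" using dense by blast
    then show ?thesis using that[of R] False by (simp add: field_simps)
  qed (use that[of 2] in auto)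
  have small: "norm (w * b) < 1" if "w \<in> ball 0 R" for w
  proof -
    have "norm (w * b) \<le> R * norm b" using that by (simp add: norm_mult mult_right_mono)
    then show ?thesis using R by simp
  qed
  have ns: "1 - w * b \<notin> \<real>\<^sub>\<le>\<^sub>0" if "w \<in> ball 0 R" for w
  proof
    assume "1 - w * b \<in> \<real>\<^sub>\<le>\<^sub>0"
    then have "Re (1 - w * b) \<le> 0" by (auto simp: complex_nonpos_Reals_iff)
    moreover have "Re (w * b) < 1" using complex_Re_le_cmod[of "w * b"] small[OF that] by linarith
    ultimately show False by simp
  qed
  have "(\<lambda>w. Ln (1 - w * b)) holomorphic_on ball 0 R"
    by (intro holomorphic_intros) (use ns in auto)
  from harmonic_circle_mean[OF this R(1)]
  have "((\<lambda>t. Re (Ln (1 - cis (2 * pi * t) * b))) has_integral 0) {0..1}" by simp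
  then show ?thesis
  proof (rule has_integral_eq[rotated])
    fix t :: real
    have "1 - cis (2 * pi * t) * b \<noteq> 0" using ns[of "cis (2 * pi * t)"] R by fastforce
    then show "Re (Ln (1 - cis (2 * pi * t) * b)) = ln (norm (1 - cis (2 * pi * t) * b))" by simp
  qed
qed

text \<open>Jensen's formula for a single zero. Unequal moduli keep the circle away from
  \<open>a\<close>, so that the logarithm is bounded on it.\<close>

lemma ln_norm_circle_mean:
  fixes a z :: complex
  assumes "norm z \<noteq> norm a"
  shows "((\<lambda>t. ln (norm (cis (2 * pi * t) * z - a))) has_integral ln (max (norm z) (norm a))) {0..1}"
proof -
  define m where "m = max (norm z) (norm a)"
  \<comment> \<open>The larger of the two moduli is factored out. For |a| < |z|, conjugation and
    multiplication by the unit number \<open>cis (2 * pi * t)\<close> turn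
    \<open>1 - cis (2 * pi * t) * b\<close> into \<open>cis (2 * pi * t) - a / z\<close> without
    changing the modulus.\<close>
  define b where "b = (if norm z < norm a then z / a else cnj (a / z))"
  have m: "m > 0" using assms by (auto simp: m_def max_def)
  have b: "norm b < 1"
    using assms by (auto simp: b_def norm_divide divide_simps)
  have eq: "norm (cis (2 * pi * t) * z - a) = m * norm (1 - cis (2 * pi * t) * b)" for t
  proof (cases "norm z < norm a")
    case True
    then have "a \<noteq> 0" by auto
    then have "cis (2 * pi * t) * z - a = - (a * (1 - cis (2 * pi * t) * b))"
      using True by (simp add: b_def field_simps)
    then show ?thesis using True by (simp add: m_def norm_mult)
  next
    case False
    then have za: "norm a < norm z" "z \<noteq> 0" using assms by auto
    have "norm (1 - cis (2 * pi * t) * b) = norm (cnj (1 - cis (2 * pi * t) * b))"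
      by (rule complex_mod_cnj[symmetric])
    also have "\<dots> = norm (cis (2 * pi * t) * cnj (1 - cis (2 * pi * t) * b))"
      by (simp add: norm_mult)
    also have "cis (2 * pi * t) * cnj (1 - cis (2 * pi * t) * b) = cis (2 * pi * t) - a / z"
      using False by (simp add: b_def algebra_simps cis_cnj cis_mult flip: mult.assoc)
    finally have "m * norm (1 - cis (2 * pi * t) * b) = norm (z * (cis (2 * pi * t) - a / z))"
      using za by (simp add: m_def norm_mult)
    then show ?thesis using za by (simp add: algebra_simps)
  qed
  have ne: "norm (1 - cis (2 * pi * t) * b) > 0" for t
  proof -
    have "norm (cis (2 * pi * t) * b) < 1" using b by (simp add: norm_mult)
    then show ?thesis by auto
  qed
  have "((\<lambda>t. ln m + ln (norm (1 - cis (2 * pi * t) * b))) has_integral ln m + 0) {0..1}"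
    by (intro has_integral_add ln_norm_circle_mean_aux b)
       (use has_integral_const_real[of "ln m" 0 1] in simp)
  then show ?thesis
    unfolding m_def[symmetric] eq using ne m by (simp add: ln_mult)
qed

text \<open>Replaces polar coordinates: rotating \<open>z\<close> leaves the area integral
  unchanged, so averaging over all rotations and interchanging the integrals expresses it through
  the means over circles.\<close>

lemma integral_ball_nonneg_of_circle_mean:
  fixes q :: "complex \<Rightarrow> real"
  assumes [measurable]: "q \<in> borel_measurable borel"
    and int: "integrable lborel (\<lambda>z. indicator (ball 0 R) z * q z)"
    and mean: "AE z in lborel. z \<in> ball 0 R \<longrightarrow>
      continuous_on {0..1} (\<lambda>t. q (cis (2 * pi * t) * z)) \<and> integral {0..1} (\<lambda>t. q (cis (2 * pi * t) * z)) \<ge> 0"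
  shows "(\<integral>z. indicator (ball 0 R) z * q z \<partial>lborel) \<ge> 0"
proof -
  define Q where "Q z = indicator (ball 0 R) z * q z" for z
  have [measurable]: "ball (0::complex) R \<in> sets borel" by simp
  have [measurable]: "Q \<in> borel_measurable borel" unfolding Q_def[abs_def] by measurable
  have [measurable]: "cis \<in> borel_measurable borel"
    by (intro borel_measurable_continuous_onI continuous_on_cis continuous_on_id)
  have intQ: "integrable lborel Q" using int by (simp add: Q_def[abs_def])
  have rot: "integrable lborel (\<lambda>z. Q (cis s * z))" "(\<integral>z. Q (cis s * z) \<partial>lborel) = (\<integral>z. Q z \<partial>lborel)"
    "(\<integral>z. \<bar>Q (cis s * z)\<bar> \<partial>lborel) = (\<integral>z. \<bar>Q z\<bar> \<partial>lborel)" for s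
  proof -
    have d: "distr lborel borel (\<lambda>z. cis s * z) = lborel" by (rule lborel_distr_rotate) simp
    show "integrable lborel (\<lambda>z. Q (cis s * z))"
      by (rule integrable_distr[of _ _ borel]) (use d intQ in auto)
    show "(\<integral>z. Q (cis s * z) \<partial>lborel) = (\<integral>z. Q z \<partial>lborel)"
      by (subst (2) d[symmetric], subst integral_distr) auto
    show "(\<integral>z. \<bar>Q (cis s * z)\<bar> \<partial>lborel) = (\<integral>z. \<bar>Q z\<bar> \<partial>lborel)"
      by (subst (2) d[symmetric], subst integral_distr) auto
  qed
  define F where "F = (\<lambda>(t, z). indicator {0..1::real} t * Q (cis (2 * pi * t) * z))"
  have Fint: "integrable (lborel \<Otimes>\<^sub>M lborel) F"
  proof (rule lborel_pair.Fubini_integrable)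
    show "F \<in> borel_measurable (lborel \<Otimes>\<^sub>M lborel)" unfolding F_def by measurable
    have "(\<lambda>t. \<integral>z. norm (F (t, z)) \<partial>lborel) = (\<lambda>t. indicator {0..1} t * (\<integral>z. \<bar>Q z\<bar> \<partial>lborel))"
      by (simp add: F_def abs_mult rot)
    then show "integrable lborel (\<lambda>t. \<integral>z. norm (F (t, z)) \<partial>lborel)"
      by simp
    show "AE t in lborel. integrable lborel (\<lambda>z. F (t, z))"
      by (simp add: F_def rot)
  qed
  have "(\<integral>z. Q z \<partial>lborel) = (\<integral>t. (\<integral>z. F (t, z) \<partial>lborel) \<partial>lborel)"
    by (simp add: F_def rot)
  also have "\<dots> = (\<integral>z. (\<integral>t. F (t, z) \<partial>lborel) \<partial>lborel)"
    using lborel_pair.Fubini_integral[of "\<lambda>t z. F (t, z)"] Fint by simp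
  also have "\<dots> \<ge> 0"
  proof (rule integral_nonneg_AE)
    show "AE z in lborel. 0 \<le> (\<integral>t. F (t, z) \<partial>lborel)"
      using mean
    proof eventually_elim
      case (elim z)
      show ?case
      proof (cases "z \<in> ball 0 R")
        case True
        then have c: "continuous_on {0..1} (\<lambda>t. q (cis (2 * pi * t) * z))"
          and i: "integral {0..1} (\<lambda>t. q (cis (2 * pi * t) * z)) \<ge> 0" using elim by auto
        have "(\<integral>t. F (t, z) \<partial>lborel) = (LINT t:{0..1}|lborel. q (cis (2 * pi * t) * z))"
          using True by (simp add: F_def Q_def set_lebesgue_integral_def norm_mult)
        also have "\<dots> = integral {0..1} (\<lambda>t. q (cis (2 * pi * t) * z))"
          by (intro set_borel_integral_eq_integral(2) borel_integrable_atLeastAtMost'[OF c])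
        finally show ?thesis using i by simp
      next
        case False
        then show ?thesis by (simp add: F_def Q_def norm_mult)
      qed
    qed
  qed
  finally show ?thesis by (simp add: Q_def)
qed

text \<open>Schwarz's lemma for \<open>H\<close> followed by the map w / (2 L - w), which sends the
  half-plane Re w < L into the unit disc and fixes 0.\<close>

lemma Borel_Caratheodory_zero:
  assumes H: "H holomorphic_on ball 0 R" and H0: "H 0 = 0" and L: "L > 0" and z: "norm z < R"
    and Re: "\<And>w. w \<in> ball 0 R \<Longrightarrow> Re (H w) < L"
  shows "norm (H z) \<le> 2 * L * norm z / (R - norm z)"
proof -
  have R: "R > 0" using z norm_ge_zero[of z] by linarith
  define w where "w \<zeta> = H (of_real R * \<zeta>) / (2 * of_real L - H (of_real R * \<zeta>))" for \<zeta>
  have sc: "of_real R * \<zeta> \<in> ball 0 R" if "norm \<zeta> < 1" for \<zeta> :: complex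
    using that R by (simp add: norm_mult)
  have ne: "2 * of_real L - H x \<noteq> 0" if "x \<in> ball 0 R" for x
    using Re[OF that] L by (auto simp: complex_eq_iff)
  have hol: "w holomorphic_on ball 0 1"
    unfolding w_def
    by (intro holomorphic_intros holomorphic_on_compose_gen[OF _ H, unfolded o_def] ne) (use sc in auto)
  have lt: "norm (H x) < norm (2 * of_real L - H x)" if "x \<in> ball 0 R" for x
  proof -
    have "norm (H x) ^ 2 < norm (2 * of_real L - H x) ^ 2"
      using mult_strict_left_mono[OF Re[OF that] L] unfolding cmod_power2
      by (simp add: power2_eq_square algebra_simps)
    then show ?thesis by (simp add: power2_less_imp_less)
  qed
  define \<zeta> where "\<zeta> = z / of_real R"
  have \<zeta>: "norm \<zeta> < 1" "of_real R * \<zeta> = z" using z R by (auto simp: \<zeta>_def norm_divide)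
  have "norm (w \<zeta>) \<le> norm \<zeta>"
  proof (rule Schwarz_Lemma(1)[OF hol])
    show "norm (w x) < 1" if "norm x < 1" for x
      using lt[OF sc[OF that]] ne[OF sc[OF that]] by (simp add: w_def norm_divide divide_simps)
  qed (use \<zeta> H0 in \<open>auto simp: w_def\<close>)
  then have "norm (H z) \<le> norm \<zeta> * norm (2 * of_real L - H z)"
    using \<zeta>(2) ne[of z] z by (simp add: w_def norm_divide divide_simps)
  also have "\<dots> \<le> norm \<zeta> * (2 * L + norm (H z))"
    using norm_triangle_ineq4[of "2 * of_real L" "H z"] L by (intro mult_left_mono) (auto simp: norm_mult)
  finally have "norm (H z) \<le> norm z / R * (2 * L + norm (H z))"
    using R by (simp add: \<zeta>_def norm_divide)
  then have "norm (H z) * (R - norm z) \<le> 2 * L * norm z"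
    using R by (simp add: field_simps)
  then show ?thesis using z by (simp add: pos_le_divide_eq)
qed

section \<open>Dividing out zeros\<close>

lemma norm_prod_diff_ge:
  fixes a :: "nat \<Rightarrow> complex"
  assumes "\<And>j. j < n \<Longrightarrow> norm (a j) \<le> r" "norm z \<ge> r + s" "s \<ge> 0"
  shows "s ^ n \<le> norm (\<Prod>j<n. z - a j)"
proof -
  have "(\<Prod>j<n. s) \<le> (\<Prod>j<n. norm (z - a j))"
  proof (rule prod_mono)
    fix j assume "j \<in> {..<n}"
    then show "0 \<le> s \<and> s \<le> norm (z - a j)"
      using assms(1)[of j] assms(2,3) norm_triangle_ineq2[of z "a j"] by force
  qed
  then show ?thesis by (simp add: prod_norm)
qed

text \<open>Zeros in \<open>ball 0 8\<close> can be divided out one at a time; comparing the circle of radius 24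
  with the origin, each division costs a factor 2, so the process stops.\<close>

lemma divide_out_zeros:
  fixes \<phi> :: "complex \<Rightarrow> complex"
  assumes hol: "\<phi> holomorphic_on UNIV" and norm0: "norm (\<phi> 0) = 1"
    and bound: "\<And>z. norm z \<le> 24 \<Longrightarrow> norm (\<phi> z) \<le> exp L"
  obtains n :: nat and a :: "nat \<Rightarrow> complex" and F :: "complex \<Rightarrow> complex"
  where "real n \<le> 2 * L" "\<And>j. j < n \<Longrightarrow> norm (a j) < 8" "F holomorphic_on UNIV"
    "\<And>z. \<phi> z = (\<Prod>j<n. z - a j) * F z" "\<And>z. norm z < 8 \<Longrightarrow> F z \<noteq> 0"
    "\<And>z. norm z \<le> 24 \<Longrightarrow> norm (F z) \<le> exp L * norm (F 0)"
proof -
  define Q where "Q n a F \<longleftrightarrow> F holomorphic_on UNIV \<and> (\<forall>z. \<phi> z = (\<Prod>j<n. z - a j) * F z) \<and>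
      (\<forall>j<n. norm (a j) < 8)" for n and a :: "nat \<Rightarrow> complex" and F
  have bd: "2 ^ n * norm (F z) \<le> exp L * norm (F 0)" if Q: "Q n a F" and z: "norm z \<le> 24" for n a F z
  proof -
    have a: "\<And>j. j < n \<Longrightarrow> norm (a j) \<le> 8" using Q by (auto simp: Q_def less_imp_le)
    have F: "F holomorphic_on UNIV" using Q by (simp add: Q_def)
    \<comment> \<open>The factors have modulus at least 24 - 8 = 16 here and at most 8 at the
      origin; the quotient is the gain of 2 per division.\<close>
    have sph: "norm (F w) \<le> exp L / 16 ^ n" if "norm w = 24" for w
    proof -
      have "16 ^ n * norm (F w) \<le> norm (\<Prod>j<n. w - a j) * norm (F w)"
        by (intro mult_right_mono norm_prod_diff_ge[where r=8]) (use a that in auto)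
      also have "\<dots> = norm (\<phi> w)" using Q by (simp add: Q_def norm_mult)
      also have "\<dots> \<le> exp L" using bound that by simp
      finally show ?thesis by (simp add: field_simps)
    qed
    have 1: "norm (F z) \<le> exp L / 16 ^ n"
    proof (rule maximum_modulus_frontier[where f=F and S="cball 0 24"])
      show "F holomorphic_on interior (cball 0 24)" using F by (rule holomorphic_on_subset) auto
      show "continuous_on (closure (cball 0 24)) F"
        using F by (meson holomorphic_on_imp_continuous_on holomorphic_on_subset subset_UNIV)
    qed (use sph z in auto)
    have "1 = norm (\<Prod>j<n. 0 - a j) * norm (F 0)" using Q norm0 by (auto simp: Q_def norm_mult)
    also have "\<dots> \<le> 8 ^ n * norm (F 0)"
    proof (rule mult_right_mono)
      have "(\<Prod>j<n. norm (0 - a j)) \<le> (\<Prod>j<n. 8)" by (rule prod_mono) (use a in auto)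
      then show "norm (\<Prod>j<n. 0 - a j) \<le> 8 ^ n" by (simp only: prod_norm prod_constant card_lessThan)
    qed auto
    finally have 2: "1 \<le> 8 ^ n * norm (F 0)" .
    have "2 ^ n * norm (F z) \<le> 2 ^ n * (exp L / 16 ^ n)" using 1 by (intro mult_left_mono) auto
    also have "\<dots> = exp L / 8 ^ n * 1"
      by (simp add: field_simps flip: power_mult_distrib)
    also have "\<dots> \<le> exp L / 8 ^ n * (8 ^ n * norm (F 0))" using 2 by (intro mult_left_mono) auto
    also have "\<dots> = exp L * norm (F 0)" by simp
    finally show ?thesis .
  qed
  have F0: "norm (F 0) > 0" if "Q n a F" for n a F
    using that norm0 by (auto simp: Q_def)
  have nL: "real n \<le> 2 * L" if Q: "Q n a F" for n a F
  proof -
    have "2 ^ n \<le> exp L" using bd[OF Q, of 0] F0[OF Q] by simp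
    then have "ln (2 ^ n) \<le> ln (exp L)" by (subst ln_le_cancel_iff) auto
    then have "real n * ln 2 \<le> L" by (simp add: ln_realpow)
    moreover have "real n * (1 / 2) \<le> real n * ln 2"
      using ln2_ge_two_thirds by (intro mult_left_mono) auto
    ultimately show ?thesis by simp
  qed
  define P where "P n \<longleftrightarrow> (\<exists>a F. Q n a F)" for n
  have "P 0" unfolding P_def Q_def using hol by (intro exI[of _ "\<lambda>_. 0"] exI[of _ \<phi>]) auto
  moreover have "\<forall>n. P n \<longrightarrow> n \<le> nat \<lfloor>2 * L\<rfloor>" unfolding P_def using nL by (metis le_nat_floor)
  ultimately obtain n where n: "P n" "\<And>m. P m \<Longrightarrow> m \<le> n"
    using GreatestI_nat[of P 0] Greatest_le_nat[of P] by blast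
  then obtain a F where Q: "Q n a F" by (auto simp: P_def)
  \<comment> \<open>\<open>n\<close> is maximal, so another zero \<open>b\<close> in the disc would
    allow one more division; \<open>G\<close> is the quotient with its removable singularity filled
    in.\<close>
  have nz: "F b \<noteq> 0" if b: "norm b < 8" for b
  proof
    assume Fb: "F b = 0"
    define G where "G z = (if z = b then deriv F b else (F z - F b) / (z - b))" for z
    have "G holomorphic_on UNIV"
      unfolding G_def[abs_def] using pole_lemma[of F UNIV b] Q by (simp add: Q_def)
    moreover have "F z = (z - b) * G z" for z by (simp add: G_def Fb)
    moreover have "(\<Prod>j<Suc n. z - (a(n := b)) j) = (\<Prod>j<n. z - a j) * (z - b)" for z by simp
    ultimately have "Q (Suc n) (a(n := b)) G"
      using Q b unfolding Q_def by (simp add: less_Suc_eq mult.assoc)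
    then have "P (Suc n)" unfolding P_def by blast
    then show False using n(2)[of "Suc n"] by simp
  qed
  show thesis
  proof (rule that[of n a F])
    show "norm (F z) \<le> exp L * norm (F 0)" if "norm z \<le> 24" for z
    proof -
      have "1 * norm (F z) \<le> 2 ^ n * norm (F z)" by (intro mult_right_mono) auto
      then show ?thesis using bd[OF Q that] by simp
    qed
  qed (use Q nL[OF Q] nz in \<open>auto simp: Q_def\<close>)
qed

text \<open>The zero-free cofactor has a logarithm \<open>h\<close> on the disc of radius 8, and its
  growth bound is a bound for the real part of \<open>h\<close>. Borel-Caratheodory turns this into
  a bound for |h| on radius 6, and Cauchy's estimates on unit discs bound the derivatives on radius
  5.\<close>

lemma zero_factorization:
  fixes \<phi> :: "complex \<Rightarrow> complex"
  assumes hol: "\<phi> holomorphic_on UNIV" and norm0: "norm (\<phi> 0) = 1" and L: "L > 0"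
    and bound: "\<And>z. norm z \<le> 24 \<Longrightarrow> norm (\<phi> z) \<le> exp L"
  obtains n :: nat and a :: "nat \<Rightarrow> complex" and h :: "complex \<Rightarrow> complex" and C :: complex
  where "real n \<le> 2 * L" "\<And>j. j < n \<Longrightarrow> norm (a j) < 8" "C \<noteq> 0"
    "h holomorphic_on ball 0 8" "h 0 = 0"
    "\<And>z. z \<in> ball 0 8 \<Longrightarrow> \<phi> z = C * (\<Prod>j<n. z - a j) * exp (h z)"
    "\<And>z. z \<in> ball 0 6 \<Longrightarrow> norm (h z) \<le> 12 * L"
    "\<And>z. z \<in> ball 0 5 \<Longrightarrow> norm (deriv h z) \<le> 13 * L"
    "\<And>z. z \<in> ball 0 5 \<Longrightarrow> norm (deriv (deriv h) z) \<le> 26 * L"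
proof -
  obtain n a F where n: "real n \<le> 2 * L" and a: "\<And>j. j < n \<Longrightarrow> norm (a j) < 8"
    and F: "F holomorphic_on UNIV" and \<phi>: "\<And>z. \<phi> z = (\<Prod>j<n. z - a j) * F z"
    and nz: "\<And>z. norm z < 8 \<Longrightarrow> F z \<noteq> 0"
    and Fb: "\<And>z. norm z \<le> 24 \<Longrightarrow> norm (F z) \<le> exp L * norm (F 0)"
    using divide_out_zeros[OF hol norm0 bound] by metis
  have F8: "F holomorphic_on ball 0 8" using F by (rule holomorphic_on_subset) auto
  obtain g where g: "g holomorphic_on ball 0 8" "\<And>z. z \<in> ball 0 8 \<Longrightarrow> exp (g z) = F z"
    using holomorphic_logarithm_exists[of "ball (0::complex) 8" F 0] F8 nz by (auto simp: convex_ball)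
  define h where "h z = g z - g 0" for z
  have h: "h holomorphic_on ball 0 8" unfolding h_def[abs_def] by (intro holomorphic_intros g)
  have exph: "exp (h z) = F z / F 0" if "z \<in> ball 0 8" for z
    using g(2)[OF that] g(2)[of 0] by (simp add: h_def exp_diff)
  \<comment> \<open>The actual bound is \<open>L\<close>; doubling it supplies the strict inequality
    for Borel-Caratheodory, which on radius 6 gives 2 (2 L) 6 / (8 - 6) = 12 L.\<close>
  have Reh: "Re (h z) < 2 * L" if "z \<in> ball 0 8" for z
  proof -
    have "exp (Re (h z)) = norm (F z) / norm (F 0)"
      using exph[OF that] by (metis norm_divide norm_exp_eq_Re)
    also have "\<dots> \<le> exp L" using Fb[of z] that nz[of 0] by (simp add: field_simps)
    finally show ?thesis using L by simp
  qed
  have hb: "norm (h z) \<le> 12 * L" if "z \<in> ball 0 6" for z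
  proof -
    have "norm (h z) \<le> 2 * (2 * L) * norm z / (8 - norm z)"
      by (rule Borel_Caratheodory_zero[OF h]) (use L Reh that in \<open>auto simp: h_def\<close>)
    also have "\<dots> \<le> 12 * L"
    proof -
      have "4 * L * norm z \<le> 4 * L * 6" "12 * L * 2 \<le> 12 * L * (8 - norm z)"
        using that L by (auto intro!: mult_left_mono)
      then show ?thesis using that by (simp add: pos_divide_le_eq)
    qed
    finally show ?thesis .
  qed
  \<comment> \<open>13 instead of 12 because the Cauchy estimate asks for an open disc containing
    the values of \<open>h\<close>.\<close>
  have db: "norm ((deriv ^^ k) h z) \<le> fact k * (13 * L)" if "z \<in> ball 0 5" "0 < k" for z k
  proof -
    have sub: "cball z 1 \<subseteq> ball 0 6"
    proof
      fix x assume "x \<in> cball z 1"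
      then show "x \<in> ball 0 6" using that norm_triangle_ineq2[of x z] by (simp add: dist_norm norm_minus_commute)
    qed
    then have sub8: "cball z 1 \<subseteq> ball 0 8" by force
    then have sub8': "ball z 1 \<subseteq> ball 0 8" using ball_subset_cball by blast
    have "norm ((deriv ^^ k) h z) \<le> fact k * (13 * L) / 1 ^ k"
    proof (rule Cauchy_higher_deriv_bound[where y=0])
      show "h holomorphic_on ball z 1" using h sub8' by (rule holomorphic_on_subset)
      show "continuous_on (cball z 1) h"
        using holomorphic_on_subset[OF h sub8] by (rule holomorphic_on_imp_continuous_on)
      show "h w \<in> ball 0 (13 * L)" if "w \<in> ball z 1" for w
      proof -
        have "w \<in> ball 0 6" using sub that by (meson ball_subset_cball subset_iff)
        from hb[OF this] show ?thesis using L by simp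
      qed
    qed (use that in auto)
    then show ?thesis by simp
  qed
  show thesis
  proof (rule that[of n a "F 0" h])
    show "\<phi> z = F 0 * (\<Prod>j<n. z - a j) * exp (h z)" if "z \<in> ball 0 8" for z
      using exph[OF that] nz[of 0] by (simp add: \<phi>)
    show "norm (deriv h z) \<le> 13 * L" if "z \<in> ball 0 5" for z using db[OF that, of 1] by simp
    show "norm (deriv (deriv h) z) \<le> 26 * L" if "z \<in> ball 0 5" for z
      using db[OF that, of 2] by (simp add: numeral_2_eq_2)
  qed (use n a nz[of 0] h hb in \<open>auto simp: h_def\<close>)
qed

section \<open>The logarithmic derivative\<close>

lemma has_real_derivative_ln_norm:
  fixes \<gamma> :: "real \<Rightarrow> complex"
  assumes \<gamma>: "(\<gamma> has_vector_derivative \<gamma>') (at x within S)" and nz: "\<gamma> x \<noteq> 0"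
  shows "((\<lambda>x. ln (norm (\<gamma> x))) has_real_derivative Re (\<gamma>' / \<gamma> x)) (at x within S)"
proof -
  have "((\<lambda>x. ln (norm (\<gamma> x))) has_derivative
      (\<lambda>t. (sgn (\<gamma> x) \<bullet> (t *\<^sub>R \<gamma>')) / norm (\<gamma> x))) (at x within S)"
  proof -
    have "((\<lambda>x. norm (\<gamma> x)) has_derivative (\<lambda>t. sgn (\<gamma> x) \<bullet> (t *\<^sub>R \<gamma>'))) (at x within S)"
      using has_derivative_compose[OF \<gamma>[unfolded has_vector_derivative_def] has_derivative_norm[OF nz]]
      by (simp add: inner_commute)
    then show ?thesis using nz by (auto intro!: derivative_eq_intros simp: field_simps)
  qed
  moreover have "(sgn (\<gamma> x) \<bullet> (t *\<^sub>R \<gamma>')) / norm (\<gamma> x) = Re (\<gamma>' / \<gamma> x) * t" for t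
  proof -
    have "Re (\<gamma>' / \<gamma> x) = (\<gamma> x \<bullet> \<gamma>') / (norm (\<gamma> x))\<^sup>2"
      unfolding cmod_power2 by (simp add: Re_divide inner_complex_def algebra_simps)
    then show ?thesis by (simp add: sgn_div_norm power2_eq_square divide_inverse mult_ac)
  qed
  ultimately show ?thesis by (simp add: has_field_derivative_def)
qed

text \<open>Below \<tau>, 1 / x = x powr (1/2) * x powr (-3/2) and the first factor is less than
  \<open>sqrt \<tau>\<close>; above \<tau>, the constant suffices. The point is the small
  coefficient of the singular term, which lets the contribution of \<open>W\<close> be absorbed
  later.\<close>

lemma inverse_le_powr_bound:
  fixes x \<tau> :: real
  assumes "x > 0" "\<tau> > 0"
  shows "1 / x \<le> 1 / \<tau> + sqrt \<tau> * x powr (-3/2)"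
proof (cases "x \<ge> \<tau>")
  case True
  then have "1 / x \<le> 1 / \<tau>" using assms by (simp add: frac_le)
  also have "\<dots> \<le> 1 / \<tau> + sqrt \<tau> * x powr (-3/2)" using assms by simp
  finally show ?thesis .
next
  case False
  have "1 / x = x powr (1/2) * x powr (-3/2)"
  proof -
    have "x powr (1/2) * x powr (-3/2) = x powr (1/2 + -3/2)" by (simp only: powr_add)
    also have "\<dots> = 1 / x" using assms by (simp add: powr_minus_divide)
    finally show ?thesis by simp
  qed
  also have "\<dots> \<le> sqrt \<tau> * x powr (-3/2)"
    using False assms by (intro mult_right_mono) (auto simp: powr_half_sqrt)
  also have "\<dots> \<le> 1 / \<tau> + sqrt \<tau> * x powr (-3/2)" using assms by simp
  finally show ?thesis .
qed

text \<open>Lets \<open>W\<close> serve also as integrable majorant for the logarithmic poles of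
  \<open>V\<close>. The power comes from ln y \<le> y - 1 at y = x powr (-3/2); at x = 0 both
  \<open>ln\<close> and \<open>powr\<close> have the value 0.\<close>

lemma abs_ln_le_powr:
  fixes x :: real
  assumes "x \<ge> 0"
  shows "\<bar>ln x\<bar> \<le> x + x powr (-3/2)"
proof (cases "x = 0")
  case False
  then have x: "x > 0" using assms by simp
  have 1: "ln x \<le> x" using ln_le_minus_one[OF x] by simp
  have "ln (x powr (-3/2)) \<le> x powr (-3/2) - 1" using x by (intro ln_le_minus_one) auto
  then have 2: "-3/2 * ln x \<le> x powr (-3/2)" using x by (simp add: ln_powr)
  have 3: "x powr (-3/2) \<ge> 0" by simp
  show ?thesis using 1 2 3 x by linarith
qed auto

lemma ennreal_integral_le_nn_integral:
  fixes g :: "'a \<Rightarrow> real"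
  assumes "integrable M g"
  shows "ennreal (\<integral>x. g x \<partial>M) \<le> (\<integral>\<^sup>+x. ennreal (g x) \<partial>M)"
proof -
  have i: "integrable M (\<lambda>x. max 0 (g x))" using assms by auto
  have "ennreal (\<integral>x. g x \<partial>M) \<le> ennreal (\<integral>x. max 0 (g x) \<partial>M)"
    by (intro ennreal_leI integral_mono assms i) auto
  also have "\<dots> = (\<integral>\<^sup>+x. ennreal (max 0 (g x)) \<partial>M)"
    by (rule nn_integral_eq_integral[symmetric]) (use i in auto)
  also have "\<dots> = (\<integral>\<^sup>+x. ennreal (g x) \<partial>M)"
    by (intro nn_integral_cong) (simp add: max_def ennreal_neg)
  finally show ?thesis .
qed

text \<open>The data produced by \<open>zero_factorization\<close>. The radii leave room: derivative
  bounds hold on radius 5, while the points to be used lie in \<open>ball 0 4\<close>, so that moves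
  shorter than 1 stay where the bounds hold.\<close>

locale factored_function =
  fixes \<phi> h :: "complex \<Rightarrow> complex" and a :: "nat \<Rightarrow> complex" and n :: nat and C :: complex and L :: real
  assumes \<phi>_hol: "\<phi> holomorphic_on UNIV" and norm_\<phi>_0: "norm (\<phi> 0) = 1"
    and L1: "L \<ge> 1" and n_le: "real n \<le> 2 * L"
    and a_lt: "j < n \<Longrightarrow> norm (a j) < 8" and C0: "C \<noteq> 0"
    and h_hol: "h holomorphic_on ball 0 8" and h_0: "h 0 = 0"
    and \<phi>_eq: "z \<in> ball 0 8 \<Longrightarrow> \<phi> z = C * (\<Prod>j<n. z - a j) * exp (h z)"
    and h_bound: "z \<in> ball 0 6 \<Longrightarrow> norm (h z) \<le> 12 * L"
    and h'_bound: "z \<in> ball 0 5 \<Longrightarrow> norm (deriv h z) \<le> 13 * L"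
    and h''_bound: "z \<in> ball 0 5 \<Longrightarrow> norm (deriv (deriv h) z) \<le> 26 * L"
begin

definition V :: "complex \<Rightarrow> real" where "V z = ln (norm (\<phi> z))"

text \<open>On \<open>ball 0 8\<close> off the zeros this is the logarithmic derivative of
  \<open>\<phi>\<close>. The cut-off makes it Borel measurable on the whole plane, and at a zero the
  division \<open>1 / 0\<close> contributes 0.\<close>

definition G :: "complex \<Rightarrow> complex" where
  "G z = (\<Sum>j<n. 1 / (z - a j)) + (if z \<in> ball 0 8 then deriv h z else 0)"

definition W :: "complex \<Rightarrow> real" where "W z = (\<Sum>j<n. norm (z - a j) powr (-3/2))"

lemma zeros: "z \<in> ball 0 8 \<Longrightarrow> \<phi> z = 0 \<longleftrightarrow> z \<in> a ` {..<n}"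
  using C0 by (auto simp: \<phi>_eq)

lemma borel_ball [measurable]: "ball (c::complex) r \<in> sets borel"
  by simp

lemma \<phi>_cont: "continuous_on S \<phi>"
  using \<phi>_hol holomorphic_on_imp_continuous_on continuous_on_subset by blast

lemma \<phi>_borel [measurable]: "\<phi> \<in> borel_measurable borel"
  by (intro borel_measurable_continuous_onI \<phi>_cont)

lemma V_borel [measurable]: "V \<in> borel_measurable borel"
  unfolding V_def[abs_def] by measurable

lemma W_borel [measurable]: "W \<in> borel_measurable borel"
  unfolding W_def[abs_def] by measurable

lemma h_hol': "deriv h holomorphic_on ball 0 8"
  by (intro holomorphic_deriv h_hol) auto

lemma G_borel [measurable]: "G \<in> borel_measurable borel"
proof -
  have "(\<lambda>z. if z \<in> ball 0 8 then deriv h z else 0) \<in> borel_measurable borel"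
    by (intro borel_measurable_continuous_on_if holomorphic_on_imp_continuous_on h_hol') auto
  then show ?thesis unfolding G_def[abs_def] by measurable
qed

lemma \<phi>_deriv:
  assumes z: "z \<in> ball 0 8" and nz: "\<phi> z \<noteq> 0"
  shows "(\<phi> has_field_derivative G z * \<phi> z) (at z)"
proof -
  have za: "z - a j \<noteq> 0" if "j < n" for j using zeros[OF z] nz that by auto
  have P: "((\<lambda>z. \<Prod>j<m. z - a j) has_field_derivative (\<Sum>j<m. 1 / (z - a j)) * (\<Prod>j<m. z - a j)) (at z)"
    if "m \<le> n" for m
    using that
  proof (induction m)
    case (Suc m)
    then show ?case using za[of m]
      by (auto intro!: derivative_eq_intros simp: field_simps)
  qed simp
  have "(h has_field_derivative deriv h z) (at z)"
    using h_hol z by (simp add: holomorphic_derivI)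
  then have "((\<lambda>z. C * (\<Prod>j<n. z - a j) * exp (h z)) has_field_derivative G z * \<phi> z) (at z)"
    using P[OF order.refl] z
    by (auto intro!: derivative_eq_intros simp: \<phi>_eq G_def algebra_simps)
  then show ?thesis
    by (rule DERIV_cong_ev[THEN iffD1, rotated -1])
       (use z in \<open>auto simp: \<phi>_eq eventually_nhds_x_imp_x intro: eventually_mono[OF eventually_nhds_in_open[of "ball 0 8"]]\<close>)
qed

lemma V_eq:
  assumes z: "z \<in> ball 0 8" and nz: "\<phi> z \<noteq> 0"
  shows "V z = ln (norm C) + (\<Sum>j<n. ln (norm (z - a j))) + Re (h z)"
proof -
  have za: "z - a j \<noteq> 0" if "j < n" for j using zeros[OF z] nz that by auto
  define p where "p = (\<Prod>j<n. norm (z - a j))"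
  have "norm (\<phi> z) = norm C * p * exp (Re (h z))"
    unfolding p_def by (simp add: \<phi>_eq[OF z] norm_mult prod_norm)
  moreover have "p > 0" unfolding p_def using za by (intro prod_pos) auto
  moreover have "ln p = (\<Sum>j<n. ln (norm (z - a j)))"
    unfolding p_def by (rule ln_prod) (use za in auto)
  ultimately show ?thesis
    unfolding V_def using C0 by (simp add: ln_mult)
qed

lemma AE_nonzero: "AE z in lborel. z \<in> ball 0 8 \<longrightarrow> \<phi> z \<noteq> 0"
proof -
  have "a ` {..<n} \<in> null_sets lborel" by (rule finite_imp_null_set_lborel) auto
  then show ?thesis by (rule AE_not_in[THEN eventually_mono]) (auto simp: zeros)
qed

lemma nn_integral_W: "(\<integral>\<^sup>+z. ennreal (W z) * indicator (ball 0 4) z \<partial>lborel) \<le> ennreal (512 * L)"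
proof -
  \<comment> \<open>As |a j| < 8, the disc of radius 12 about \<open>a j\<close> covers
    \<open>ball 0 4\<close>; 64 * sqrt 12 \<le> 64 * 4 = 256.\<close>
  have term_le: "(\<integral>\<^sup>+z. ennreal (norm (z - a j) powr (-3/2)) * indicator (ball 0 4) z \<partial>lborel) \<le> ennreal 256"
    if "j < n" for j
  proof -
    have "(\<integral>\<^sup>+z. ennreal (norm (z - a j) powr (-3/2)) * indicator (ball 0 4) z \<partial>lborel) \<le>
      (\<integral>\<^sup>+z. ennreal (norm (z - a j) powr (-3/2)) * indicator (ball (a j) 12) z \<partial>lborel)"
    proof (intro nn_integral_mono mult_left_mono)
      fix z
      have "norm (a j - z) < 12" if "norm z < 4"
        using norm_triangle_ineq4[of "a j" z] a_lt[OF \<open>j < n\<close>] that by linarith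
      then show "(indicator (ball 0 4) z :: ennreal) \<le> indicator (ball (a j) 12) z"
        by (auto simp: indicator_def dist_norm)
    qed auto
    also have "\<dots> \<le> ennreal (64 * sqrt 12)" by (rule nn_integral_norm_powr_le) auto
    also have "\<dots> \<le> ennreal 256"
      by (rule ennreal_leI) (use real_sqrt_le_mono[of 12 16] in auto)
    finally show ?thesis .
  qed
  have "(\<integral>\<^sup>+z. ennreal (W z) * indicator (ball 0 4) z \<partial>lborel) =
      (\<Sum>j<n. \<integral>\<^sup>+z. ennreal (norm (z - a j) powr (-3/2)) * indicator (ball 0 4) z \<partial>lborel)"
    unfolding W_def by (subst nn_integral_sum[symmetric]) (auto simp: sum_distrib_right simp flip: sum_ennreal)
  also have "\<dots> \<le> (\<Sum>j<n. ennreal 256)" by (rule sum_mono) (use term_le in auto)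
  also have "\<dots> = ennreal (256 * real n)" by (simp add: ennreal_mult ennreal_of_nat_eq_real_of_nat mult.commute)
  also have "\<dots> \<le> ennreal (512 * L)" using n_le by (intro ennreal_leI) auto
  finally show ?thesis .
qed

lemma integrable_V: "integrable lborel (\<lambda>z. indicator (ball 0 1) z * V z)"
proof (rule integrableI_bounded)
  \<comment> \<open>9 bounds |z - a j| for |z| < 1 and |a j| < 8, and \<open>12 * L\<close> bounds
    the real part of \<open>h\<close>; the logarithmic singularities go into
    \<open>W\<close>.\<close>
  define K where "K = \<bar>ln (norm C)\<bar> + 9 * real n + 12 * L"
  have K0: "K \<ge> 0" using L1 by (simp add: K_def)
  have "(\<integral>\<^sup>+z. ennreal (norm (indicator (ball 0 1) z * V z)) \<partial>lborel) \<le>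
      (\<integral>\<^sup>+z. ennreal K * indicator (ball 0 1) z + ennreal (W z) * indicator (ball 0 4) z \<partial>lborel)"
  proof (rule nn_integral_mono_AE, use AE_nonzero in eventually_elim)
    case (elim z)
    show ?case
    proof (cases "z \<in> ball 0 1")
      case True
      then have z: "z \<in> ball 0 8" "z \<in> ball 0 4" "z \<in> ball 0 6" "norm z < 1" by auto
      have "\<bar>V z\<bar> \<le> \<bar>ln (norm C)\<bar> + \<bar>\<Sum>j<n. ln (norm (z - a j))\<bar> + \<bar>Re (h z)\<bar>"
        using V_eq[OF z(1)] elim z by linarith
      also have "\<bar>Re (h z)\<bar> \<le> 12 * L" using h_bound[OF z(3)] abs_Re_le_cmod[of "h z"] by linarith
      also have "\<bar>\<Sum>j<n. ln (norm (z - a j))\<bar> \<le> (\<Sum>j<n. 9 + norm (z - a j) powr (-3/2))"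
      proof (rule order.trans[OF sum_abs], rule sum_mono)
        fix j assume "j \<in> {..<n}"
        then have "norm (z - a j) \<le> 9" using norm_triangle_ineq4[of z "a j"] a_lt[of j] z by auto
        then show "\<bar>ln (norm (z - a j))\<bar> \<le> 9 + norm (z - a j) powr (-3/2)"
          using abs_ln_le_powr[of "norm (z - a j)"] by simp
      qed
      finally have "\<bar>V z\<bar> \<le> K + W z" by (simp add: K_def W_def sum.distrib)
      moreover have "W z \<ge> 0" by (auto simp: W_def intro: sum_nonneg)
      ultimately show ?thesis using z K0 True by (simp flip: ennreal_plus)
    qed auto
  qed
  also have "\<dots> = ennreal K * emeasure lborel (ball 0 1 :: complex set) +
      (\<integral>\<^sup>+z. ennreal (W z) * indicator (ball 0 4) z \<partial>lborel)"
    by (subst nn_integral_add) (auto simp: nn_integral_cmult)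
  also have "\<dots> < \<infinity>"
    using nn_integral_W by (auto simp: emeasure_ball ennreal_mult_less_top order.strict_trans1)
  finally show "(\<integral>\<^sup>+z. ennreal (norm (indicator (ball 0 1) z * V z)) \<partial>lborel) < \<infinity>" .
qed auto

text \<open>Subharmonicity of ln |\<phi>| together with \<open>V 0 = 0\<close>, in explicit form:
  Jensen's formula on each circle not passing through a zero. Zeros inside the circle only raise its
  mean.\<close>

lemma integral_V_nonneg: "(\<integral>z. indicator (ball 0 1) z * V z \<partial>lborel) \<ge> 0"
proof (rule integral_ball_nonneg_of_circle_mean[OF V_borel integrable_V])
  have "(\<Union>j<n. sphere 0 (norm (a j))) \<in> null_sets lebesgue"
    by (intro null_sets_UN') (auto simp flip: negligible_iff_null_sets intro: negligible_sphere)
  then have "AE z in lebesgue. z \<notin> (\<Union>j<n. sphere 0 (norm (a j)))" by (rule AE_not_in)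
  then have "AE z in lborel. z \<notin> (\<Union>j<n. sphere 0 (norm (a j)))" by (simp add: AE_completion_iff)
  then show "AE z in lborel. z \<in> ball 0 1 \<longrightarrow> continuous_on {0..1} (\<lambda>t. V (cis (2 * pi * t) * z)) \<and>
      0 \<le> integral {0..1} (\<lambda>t. V (cis (2 * pi * t) * z))"
  proof eventually_elim
    case (elim z)
    show ?case
    proof
    assume zb: "z \<in> ball 0 1"
    then have za: "norm z \<noteq> norm (a j)" if "j < n" for j using that elim by force
    have z: "cis s * z \<in> ball 0 8" for s using zb by (simp add: norm_mult)
    have nz: "\<phi> (cis s * z) \<noteq> 0" for s
    proof
      assume "\<phi> (cis s * z) = 0"
      then obtain j where "j < n" "cis s * z = a j" using zeros[OF z] by auto
      then show False using za[of j] by (metis norm_mult norm_cis mult_1)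
    qed
    have V: "V (cis s * z) = ln (norm C) + (\<Sum>j<n. ln (norm (cis s * z - a j))) + Re (h (cis s * z))" for s
      by (rule V_eq[OF z nz])
    have "\<phi> 0 \<noteq> 0" using norm_\<phi>_0 by auto
    then have V0: "ln (norm C) + (\<Sum>j<n. ln (norm (a j))) = 0"
      using V_eq[of 0] norm_\<phi>_0 by (simp add: h_0 V_def)
    have a0: "a j \<noteq> 0" if "j < n" for j using \<open>\<phi> 0 \<noteq> 0\<close> zeros[of 0] that by auto
    have hm: "((\<lambda>t. Re (h (cis (2 * pi * t) * z))) has_integral 0) {0..1}"
    proof -
      have sub: "w * z \<in> ball 0 8" if "w \<in> ball 0 8" for w
      proof -
        have "norm w * norm z \<le> 8 * norm z" using that by (intro mult_right_mono) auto
        then show ?thesis using zb by (simp add: norm_mult)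
      qed
      have "(\<lambda>w. h (w * z)) holomorphic_on ball 0 8"
        by (intro holomorphic_on_compose_gen[OF _ h_hol, unfolded o_def] holomorphic_intros) (use sub in auto)
      from harmonic_circle_mean[OF this] show ?thesis by (simp add: h_0)
    qed
    have "((\<lambda>t. V (cis (2 * pi * t) * z)) has_integral
        (ln (norm C) + (\<Sum>j<n. ln (max (norm z) (norm (a j)))) + 0)) {0..1}"
      unfolding V
      by (intro has_integral_add has_integral_sum ln_norm_circle_mean hm finite_lessThan)
         (use has_integral_const_real[of "ln (norm C)" 0 1] za in auto)
    then have "integral {0..1} (\<lambda>t. V (cis (2 * pi * t) * z)) =
        ln (norm C) + (\<Sum>j<n. ln (max (norm z) (norm (a j))))" by (simp add: integral_unique)
    also have "\<dots> \<ge> ln (norm C) + (\<Sum>j<n. ln (norm (a j)))"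
    proof (intro add_left_mono sum_mono)
      fix j assume "j \<in> {..<n}"
      then have "norm (a j) > 0" using a0 by auto
      then show "ln (norm (a j)) \<le> ln (max (norm z) (norm (a j)))"
        by (subst ln_le_cancel_iff) (auto simp: less_max_iff_disj)
    qed
    finally have "0 \<le> integral {0..1} (\<lambda>t. V (cis (2 * pi * t) * z))" using V0 by simp
    moreover have "continuous_on {0..1} (\<lambda>t. V (cis (2 * pi * t) * z))"
      unfolding V_def
      by (intro continuous_intros continuous_on_compose2[OF \<phi>_cont[of UNIV]]) (use nz in auto)
    ultimately show "continuous_on {0..1} (\<lambda>t. V (cis (2 * pi * t) * z)) \<and>
      0 \<le> integral {0..1} (\<lambda>t. V (cis (2 * pi * t) * z))" by simp
    qed
  qed
qed

end

section \<open>Lower bound for the integral of the logarithmic derivative\<close>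

context factored_function
begin

text \<open>For fixed \<open>p\<close> the exceptional \<open>z\<close> lie on finitely many
  segments, the translates by the zeros of the segment from 0 to \<open>- p\<close>. Off them ln
  |\<phi>| is smooth along the whole path from \<open>z\<close> to \<open>z + p\<close>.\<close>

lemma AE_segment_nonzero:
  fixes p :: complex
  assumes "norm p \<le> 3"
  shows "AE z in lborel. z \<in> ball 0 1 \<longrightarrow> (\<forall>x\<in>{0..1}. \<phi> (z + of_real x * p) \<noteq> 0)"
proof -
  have null: "(\<lambda>x. a j - of_real x * p) ` {0..1} \<in> null_sets lebesgue" for j
  proof -
    have eq: "(\<lambda>x. a j - of_real x * p) ` {0..1} = closed_segment (a j) (a j - p)"
      by (auto simp: closed_segment_image_interval scaleR_conv_of_real algebra_simps)
    have "negligible (closed_segment (a j) (a j - p))"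
      by (simp add: negligible_convex_interior interior_closed_segment_ge2)
    then show ?thesis unfolding eq by (simp add: negligible_iff_null_sets)
  qed
  have "(\<Union>j<n. (\<lambda>x. a j - of_real x * p) ` {0..1}) \<in> null_sets lebesgue"
    by (intro null_sets_UN' null) auto
  then have "AE z in lborel. z \<notin> (\<Union>j<n. (\<lambda>x. a j - of_real x * p) ` {0..1})"
    by (auto dest!: AE_not_in simp: AE_completion_iff)
  then show ?thesis
  proof eventually_elim
    case (elim z)
    show ?case
    proof (intro impI ballI notI)
      fix x :: real assume z: "z \<in> ball 0 1" and x: "x \<in> {0..1}" and 0: "\<phi> (z + of_real x * p) = 0"
      have "norm (of_real x * p) \<le> 1 * 3"
        unfolding norm_mult by (rule mult_mono) (use x assms in auto)
      then have "z + of_real x * p \<in> ball 0 8"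
        using norm_triangle_ineq[of z "of_real x * p"] z by simp
      then obtain j where "j < n" "z + of_real x * p = a j" using 0 zeros by auto
      then have "z = a j - of_real x * p" by (simp add: algebra_simps)
      then show False using elim \<open>j < n\<close> x by blast
    qed
  qed
qed

text \<open>The fundamental theorem of calculus along the segment; the 3 is the bound on |p|. A
  nonnegative integral on the right allows the order of integration to be changed later by
  measurability alone.\<close>

lemma V_diff_le:
  fixes p :: complex
  assumes p: "norm p \<le> 3" and z: "z \<in> ball 0 1" and nz: "\<And>x. x \<in> {0..1} \<Longrightarrow> \<phi> (z + of_real x * p) \<noteq> 0"
  shows "ennreal (V z - V (z + p)) \<le> (\<integral>\<^sup>+x. ennreal (3 * norm (G (z + of_real x * p))) * indicator {0..1} x \<partial>lborel)"
proof -
  have b8: "z + of_real x * p \<in> ball 0 8" if "x \<in> {0..1}" for x :: real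
  proof -
    have "norm (of_real x * p) \<le> 1 * 3"
      unfolding norm_mult by (rule mult_mono) (use that p in auto)
    then show ?thesis using norm_triangle_ineq[of z "of_real x * p"] z by simp
  qed
  have der: "((\<lambda>x. V (z + of_real x * p)) has_real_derivative Re (G (z + of_real x * p) * p)) (at x within {0..1})"
    if x: "x \<in> {0..1}" for x
  proof -
    have "((\<lambda>x. z + of_real x * p) has_vector_derivative p) (at x within {0..1})"
      by (auto intro!: derivative_eq_intros)
    then have "((\<lambda>x. \<phi> (z + of_real x * p)) has_vector_derivative
        (p * (G (z + of_real x * p) * \<phi> (z + of_real x * p)))) (at x within {0..1})"
      using field_vector_diff_chain_within[where g=\<phi> and f="\<lambda>x. z + of_real x * p"]
        has_field_derivative_at_within[OF \<phi>_deriv[OF b8[OF x] nz[OF x]]] by (auto simp: o_def)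
    from has_real_derivative_ln_norm[OF this nz[OF x]] show ?thesis
      using nz[OF x] by (simp add: V_def mult_ac)
  qed
  have Gcont: "continuous_on {0..1} (\<lambda>x. G (z + of_real x * p))"
  proof -
    have "continuous_on {0..1} (\<lambda>x. (\<Sum>j<n. 1 / (z + of_real x * p - a j)) + deriv h (z + of_real x * p))"
    proof (intro continuous_on_add continuous_on_sum)
      fix j assume j: "j \<in> {..<n}"
      have "z + of_real x * p - a j \<noteq> 0" if "x \<in> {0..1}" for x
        using nz[OF that] zeros[OF b8[OF that]] j by auto
      then show "continuous_on {0..1} (\<lambda>x. 1 / (z + of_real x * p - a j))"
        by (intro continuous_intros) auto
    next
      show "continuous_on {0..1} (\<lambda>x. deriv h (z + of_real x * p))"
        by (rule continuous_on_compose2[OF holomorphic_on_imp_continuous_on[OF h_hol']])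
           (use b8 in \<open>auto intro!: continuous_intros\<close>)
    qed
    then show ?thesis by (rule continuous_on_eq) (use b8 in \<open>auto simp: G_def\<close>)
  qed
  have "((\<lambda>x. Re (G (z + of_real x * p) * p)) has_integral (V (z + of_real 1 * p) - V (z + of_real 0 * p))) {0..1}"
    by (rule fundamental_theorem_of_calculus[where f="\<lambda>x. V (z + of_real x * p)"])
       (use der in \<open>auto simp: has_real_derivative_iff_has_vector_derivative\<close>)
  then have 1: "((\<lambda>x. - Re (G (z + of_real x * p) * p)) has_integral (V z - V (z + p))) {0..1}"
    using has_integral_neg[of "\<lambda>x. Re (G (z + of_real x * p) * p)" "V (z + p) - V z" "{0..1}"] by simp
  have 2: "(\<lambda>x. 3 * norm (G (z + of_real x * p))) integrable_on {0..1}"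
    by (intro integrable_continuous_real continuous_intros Gcont)
  have "V z - V (z + p) \<le> integral {0..1} (\<lambda>x. 3 * norm (G (z + of_real x * p)))"
  proof (rule has_integral_le[OF 1 integrable_integral[OF 2]])
    fix x :: real assume "x \<in> {0..1}"
    have "- Re (G (z + of_real x * p) * p) \<le> norm (G (z + of_real x * p)) * norm p"
      using abs_Re_le_cmod[of "G (z + of_real x * p) * p"] by (simp add: norm_mult)
    also have "\<dots> \<le> norm (G (z + of_real x * p)) * 3" using p by (intro mult_left_mono) auto
    finally show "- Re (G (z + of_real x * p) * p) \<le> 3 * norm (G (z + of_real x * p))" by simp
  qed
  then have "ennreal (V z - V (z + p)) \<le> ennreal (integral {0..1} (\<lambda>x. 3 * norm (G (z + of_real x * p))))"
    by (rule ennreal_leI)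
  also have "\<dots> = (\<integral>\<^sup>+x. ennreal (3 * norm (G (z + of_real x * p))) * indicator {0..1} x \<partial>lborel)"
    by (rule nn_integral_has_integral_lebesgue'[symmetric]) (use integrable_integral[OF 2] in auto)
  finally show ?thesis .
qed

text \<open>Since \<open>V\<close> has nonnegative mean over the unit disc but is very negative on its translate
  by \<open>p\<close>, its gradient has a large mean.\<close>

lemma nn_integral_G:
  assumes p: "norm p \<le> 3" and c: "c > 0"
    and small: "\<And>z. z \<in> ball p 1 \<Longrightarrow> norm (\<phi> z) \<le> exp (- c * L)"
  shows "ennreal (c * L) \<le> (\<integral>\<^sup>+z. ennreal (norm (G z)) * indicator (ball 0 4) z \<partial>lborel)"
proof -
  define I where "I = (\<integral>\<^sup>+z. ennreal (norm (G z)) * indicator (ball 0 4) z \<partial>lborel)"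
  have cL: "c * L > 0" using c L1 by simp
  have ib: "integrable lborel (\<lambda>z. indicator (ball (0::complex) 1) z * (c * L))"
    by (auto simp: emeasure_ball intro!: integrable_real_indicator)
  have "(\<integral>z. indicator (ball 0 1) z * V z + indicator (ball (0::complex) 1) z * (c * L) \<partial>lborel) =
      (\<integral>z. indicator (ball 0 1) z * V z \<partial>lborel) + pi * (c * L)"
    by (subst Bochner_Integration.integral_add[OF integrable_V ib])
       (simp add: content_ball unit_ball_vol_2)
  \<comment> \<open>The area \<pi> of the unit disc exceeds 3, which pays for the factor 3 from the
    length of \<open>p\<close>.\<close>
  also have "\<dots> \<ge> 3 * (c * L)"
    using integral_V_nonneg cL pi_gt3 mult_strict_right_mono[OF pi_gt3 cL] by linarith
  finally have "ennreal (3 * (c * L)) \<le>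
      ennreal (\<integral>z. indicator (ball 0 1) z * V z + indicator (ball (0::complex) 1) z * (c * L) \<partial>lborel)"
    by (rule ennreal_leI)
  also have "\<dots> \<le> (\<integral>\<^sup>+z. ennreal (indicator (ball 0 1) z * V z + indicator (ball (0::complex) 1) z * (c * L)) \<partial>lborel)"
    by (rule ennreal_integral_le_nn_integral) (intro Bochner_Integration.integrable_add integrable_V ib)
  also have "\<dots> \<le> (\<integral>\<^sup>+z. (\<integral>\<^sup>+x. ennreal (3 * norm (G (z + of_real x * p))) * indicator {0..1} x \<partial>lborel) * indicator (ball 0 1) z \<partial>lborel)"
  proof (rule nn_integral_mono_AE, use AE_segment_nonzero[OF p] in eventually_elim)
    case (elim z)
    show ?case
    proof (cases "z \<in> ball 0 1")
      case True
      have nz: "\<phi> (z + of_real x * p) \<noteq> 0" if "x \<in> {0..1}" for x using elim True that by blast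
      have "z + p \<in> ball p 1" using True by (simp add: dist_norm)
      then have "norm (\<phi> (z + p)) \<le> exp (- c * L)" by (rule small)
      moreover have "norm (\<phi> (z + p)) > 0" using nz[of 1] by simp
      ultimately have "V (z + p) \<le> - c * L"
        unfolding V_def by (metis exp_gt_zero ln_exp ln_le_cancel_iff)
      then have "ennreal (V z + c * L) \<le> ennreal (V z - V (z + p))" by (intro ennreal_leI) auto
      also have "\<dots> \<le> (\<integral>\<^sup>+x. ennreal (3 * norm (G (z + of_real x * p))) * indicator {0..1} x \<partial>lborel)"
        by (rule V_diff_le[OF p True nz])
      finally show ?thesis using True by simp
    qed auto
  qed
  also have "\<dots> = (\<integral>\<^sup>+z. (\<integral>\<^sup>+x. ennreal (3 * norm (G (z + of_real x * p))) * indicator {0..1} x * indicator (ball 0 1) z \<partial>lborel) \<partial>lborel)"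
    by (intro nn_integral_cong nn_integral_multc[symmetric]) measurable
  also have "\<dots> = (\<integral>\<^sup>+x. (\<integral>\<^sup>+z. ennreal (3 * norm (G (z + of_real x * p))) * indicator {0..1} x * indicator (ball 0 1) z \<partial>lborel) \<partial>lborel)"
    by (rule lborel_pair.Fubini') measurable
  also have "\<dots> \<le> (\<integral>\<^sup>+x. 3 * I * indicator {0..1::real} x \<partial>lborel)"
  proof (rule nn_integral_mono)
    \<comment> \<open>With \<open>x\<close> fixed, the shift by \<open>x * p\<close> moves the unit
      disc within \<open>ball 0 4\<close>, so each slice is at most \<open>3 * I\<close>.\<close>
    fix x :: real
    show "(\<integral>\<^sup>+z. ennreal (3 * norm (G (z + of_real x * p))) * indicator {0..1} x * indicator (ball 0 1) z \<partial>lborel) \<le>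
        3 * I * indicator {0..1::real} x"
    proof (cases "x \<in> {0..1}")
      case True
      have "norm (of_real x * p) \<le> 1 * 3"
        unfolding norm_mult by (rule mult_mono) (use True p in auto)
      then have b: "z + of_real x * p \<in> ball 0 4" if "z \<in> ball 0 1" for z
        using norm_triangle_ineq[of z "of_real x * p"] that by simp
      have "(\<integral>\<^sup>+z. ennreal (3 * norm (G (z + of_real x * p))) * indicator {0..1} x * indicator (ball 0 1) z \<partial>lborel) \<le>
          (\<integral>\<^sup>+z. 3 * (ennreal (norm (G (z + of_real x * p))) * indicator (ball 0 4) (z + of_real x * p)) \<partial>lborel)"
        by (intro nn_integral_mono) (use True b in \<open>auto simp: indicator_def ennreal_mult\<close>)
      also have "\<dots> = (\<integral>\<^sup>+z. 3 * (ennreal (norm (G z)) * indicator (ball 0 4) z) \<partial>lborel)"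
        by (rule nn_integral_lborel_translate[where f="\<lambda>z. 3 * (ennreal (norm (G z)) * indicator (ball 0 4) z)"]) measurable
      also have "\<dots> = 3 * I"
        unfolding I_def by (rule nn_integral_cmult) measurable
      finally show ?thesis using True by simp
    qed auto
  qed
  also have "\<dots> = 3 * I" by (simp add: nn_integral_cmult)
  also have "ennreal (3 * (c * L)) = ennreal 3 * ennreal (c * L)"
    using cL by (subst ennreal_mult) auto
  finally have "ennreal 3 * ennreal (c * L) \<le> ennreal 3 * I" by simp
  then have "ennreal (c * L) \<le> I"
    by (subst (asm) ennreal_mult_le_mult_iff) auto
  then show ?thesis by (simp add: I_def)
qed

section \<open>Points where the logarithmic derivative is large and the zeros are far\<close>

lemma norm_G_le:
  assumes z: "z \<in> ball 0 4" "\<phi> z \<noteq> 0" and \<tau>: "\<tau> > 0"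
  shows "norm (G z) \<le> (2 / \<tau> + 13) * L + sqrt \<tau> * W z"
proof -
  have z8: "z \<in> ball 0 8" "z \<in> ball 0 5" using z by auto
  have za: "norm (z - a j) > 0" if "j < n" for j using zeros[OF z8(1)] z that by auto
  have "norm (G z) \<le> norm (\<Sum>j<n. 1 / (z - a j)) + norm (deriv h z)"
    unfolding G_def using z8 by (auto intro: order.trans[OF norm_triangle_ineq])
  also have "norm (\<Sum>j<n. 1 / (z - a j)) \<le> (\<Sum>j<n. norm (1 / (z - a j)))" by (rule norm_sum)
  also have "\<dots> \<le> (\<Sum>j<n. 1 / \<tau> + sqrt \<tau> * norm (z - a j) powr (-3/2))"
    by (rule sum_mono) (use za \<tau> inverse_le_powr_bound in \<open>auto simp: norm_divide\<close>)
  also have "\<dots> = real n / \<tau> + sqrt \<tau> * W z" by (simp add: W_def sum.distrib sum_distrib_left)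
  also have "real n / \<tau> \<le> 2 * L / \<tau>" using n_le \<tau> by (simp add: divide_right_mono)
  finally show ?thesis using h'_bound[OF z8(2)] by (simp add: algebra_simps)
qed

text \<open>The lower bound on |G| makes the argument turn fast; the bound on \<open>W\<close> keeps
  the zeros at distance at least (K L) powr (-2/3). The condition \<open>\<phi> z \<noteq> 0\<close>
  is stated separately because \<open>0 powr (-3/2)\<close> is 0, so that \<open>W\<close> does not
  blow up at the zeros themselves.\<close>

definition good :: "real \<Rightarrow> real \<Rightarrow> complex set" where
  "good \<gamma> K = {z \<in> ball 0 4. \<phi> z \<noteq> 0 \<and> \<gamma> * L \<le> norm (G z) \<and> W z \<le> K * L}"

lemma good_borel [measurable]: "good \<gamma> K \<in> sets borel"
proof -
  have "good \<gamma> K = ball 0 4 \<inter> {z\<in>space borel. \<phi> z \<noteq> 0 \<and> \<gamma> * L \<le> norm (G z) \<and> W z \<le> K * L}"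
    by (auto simp: good_def)
  also have "\<dots> \<in> sets borel" by measurable
  finally show ?thesis .
qed

text \<open>A budget for the integral of |G|, which is at least \<open>c * L\<close>. Points with
  small |G| contribute at most c L / 4, as the disc has area at most 64; points with large
  \<open>W\<close> contribute at most c L / 4, as there |G| is at most c / 2048 times
  \<open>W\<close>; so c L / 2 is left for the good set, where |G| \<le> M L. The choice of \<tau>
  and \<open>K\<close> makes both terms of \<open>norm_G_le\<close> at most c / 4096 times
  \<open>W\<close> when \<open>W z > K * L\<close>.\<close>

lemma emeasure_good:
  assumes p: "norm p \<le> 3" and c: "c > 0"
    and small: "\<And>z. z \<in> ball p 1 \<Longrightarrow> norm (\<phi> z) \<le> exp (- c * L)"
    and \<tau>: "\<tau> = (c / 4096)\<^sup>2" and K: "K = (2 / \<tau> + 13) * 4096 / c" and M: "M = 2 / \<tau> + 13 + sqrt \<tau> * K"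
  shows "ennreal (c / (2 * M)) \<le> emeasure lborel (good (c / 256) K)"
proof -
  have \<tau>0: "\<tau> > 0" and st: "sqrt \<tau> = c / 4096" using c by (auto simp: \<tau>)
  have K0: "K > 0" using c \<tau>0 by (auto simp: K intro!: divide_pos_pos add_pos_pos)
  have M0: "M > 0" using \<tau>0 K0 by (auto simp: M intro!: add_pos_nonneg)
  define E where "E = good (c / 256) K"
  define e where "e = emeasure lborel E"
  have "E \<subseteq> ball 0 4" by (auto simp: E_def good_def)
  then have "e \<le> emeasure lborel (ball (0::complex) 4)" unfolding e_def by (rule emeasure_mono) auto
  then have efin: "e < \<infinity>" by (auto simp: emeasure_ball order.strict_trans1)
  then obtain e' where e': "e = ennreal e'" "e' \<ge> 0" by (cases e) auto
  have "ennreal (c * L) \<le> (\<integral>\<^sup>+z. ennreal (norm (G z)) * indicator (ball 0 4) z \<partial>lborel)"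
    by (rule nn_integral_G[OF p c small])
  also have "\<dots> \<le> (\<integral>\<^sup>+z. ennreal (c / 256 * L) * indicator (ball 0 4) z + ennreal (M * L) * indicator E z +
      ennreal (c / 2048) * (ennreal (W z) * indicator (ball 0 4) z) \<partial>lborel)"
  proof (rule nn_integral_mono_AE, use AE_nonzero in eventually_elim)
    case (elim z)
    show ?case
    proof (cases "z \<in> ball 0 4")
      case True
      then have nz: "\<phi> z \<noteq> 0" using elim by auto
      have W0: "W z \<ge> 0" by (auto simp: W_def intro: sum_nonneg)
      have le: "norm (G z) \<le> (2 / \<tau> + 13) * L + sqrt \<tau> * W z"
        by (rule norm_G_le[OF True nz \<tau>0])
      have "norm (G z) \<le> c / 256 * L + M * L * indicator E z + c / 2048 * W z"
      proof -
        consider "norm (G z) < c / 256 * L" | "W z > K * L" | "z \<in> E"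
          using True nz by (force simp: E_def good_def)
        then show ?thesis
        proof cases
          case 1
          moreover have "0 \<le> M * L * indicator E z" "0 \<le> c / 2048 * W z" using M0 L1 W0 c by auto
          ultimately show ?thesis by linarith
        next
          case 2
          have "(2 / \<tau> + 13) * L = c / 4096 * (K * L)" using c by (simp add: K)
          also have "\<dots> \<le> c / 4096 * W z" using 2 c by (intro mult_left_mono) auto
          finally have "norm (G z) \<le> c / 2048 * W z" using le st by simp
          moreover have "0 \<le> M * L * indicator E z" "0 \<le> c / 256 * L" using M0 L1 c by auto
          ultimately show ?thesis by linarith
        next
          case 3
          have "sqrt \<tau> * W z \<le> sqrt \<tau> * (K * L)" using 3 \<tau>0 by (intro mult_left_mono) (auto simp: E_def good_def)
          then have "norm (G z) \<le> M * L" using le by (simp add: M algebra_simps)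
          moreover have "0 \<le> c / 256 * L" "0 \<le> c / 2048 * W z" using L1 W0 c by auto
          ultimately show ?thesis using 3 by simp
        qed
      qed
      then have "ennreal (norm (G z)) \<le> ennreal (c / 256 * L + M * L * indicator E z + c / 2048 * W z)"
        by (rule ennreal_leI)
      also have "\<dots> = ennreal (c / 256 * L) + ennreal (M * L) * indicator E z + ennreal (c / 2048) * ennreal (W z)"
        using c L1 M0 W0 by (auto simp: ennreal_plus ennreal_mult indicator_def simp del: times_divide_eq_left)
      finally show ?thesis using True by simp
    qed auto
  qed
  also have "\<dots> = ennreal (c / 256 * L) * emeasure lborel (ball (0::complex) 4) + ennreal (M * L) * e +
      ennreal (c / 2048) * (\<integral>\<^sup>+z. ennreal (W z) * indicator (ball 0 4) z \<partial>lborel)"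
    unfolding e_def E_def by (simp add: nn_integral_add nn_integral_cmult)
  also have "\<dots> \<le> ennreal (c / 256 * L) * ennreal 64 + ennreal (M * L) * e + ennreal (c / 2048) * ennreal (512 * L)"
  proof (intro add_mono mult_left_mono nn_integral_W order.refl)
    show "emeasure lborel (ball (0::complex) 4) \<le> ennreal 64"
    proof -
      have "ennreal (pi * 16) \<le> ennreal 64" by (rule ennreal_leI) (use pi_less_4 in simp)
      then show ?thesis by (simp add: emeasure_ball unit_ball_vol_2)
    qed
  qed auto
  also have "\<dots> = ennreal (c / 2 * L + M * L * e')"
  proof -
    have "ennreal (c / 256 * L) * ennreal 64 = ennreal (c / 4 * L)"
      using c L1 by (subst ennreal_mult[symmetric]) auto
    moreover have "ennreal (M * L) * e = ennreal (M * L * e')"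
      using M0 L1 e' by (subst ennreal_mult) auto
    moreover have "ennreal (c / 2048) * ennreal (512 * L) = ennreal (c / 4 * L)"
      using c L1 by (subst ennreal_mult[symmetric]) auto
    moreover have "ennreal (c / 4 * L) + ennreal (M * L * e') + ennreal (c / 4 * L) =
        ennreal (c / 4 * L + M * L * e' + c / 4 * L)"
      using c L1 M0 e' by (simp flip: ennreal_plus)
    ultimately show ?thesis by (simp add: algebra_simps)
  qed
  finally have "c * L \<le> c / 2 * L + M * L * e'"
    using c L1 M0 e' by (subst (asm) ennreal_le_iff) (auto intro!: add_nonneg_nonneg)
  then have "L * (c / 2) \<le> L * (M * e')" by (simp add: algebra_simps)
  then have "c / 2 \<le> M * e'" using L1 by simp
  then have "c / (2 * M) \<le> e'" using M0 by (simp add: field_simps)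
  then show ?thesis using e' by (auto simp: e_def E_def intro: ennreal_leI)
qed

end

section \<open>Equidistribution of the argument\<close>

lemma is_Arg_exp: "is_Arg (exp w) (Im w + 2 * pi * of_int k)"
proof -
  have "cis (Im w + 2 * pi * of_int k) = cis (Im w)"
    by (simp add: cis_multiple_2pi flip: cis_mult)
  then show ?thesis
    unfolding is_Arg_def norm_exp_eq_Re by (simp add: exp_eq_polar)
qed

lemma exp_in_sectorI:
  assumes "\<theta>1 < Im w + 2 * pi * of_int k" "Im w + 2 * pi * of_int k < \<theta>2"
  shows "exp w \<in> sector \<theta>1 \<theta>2"
  unfolding sector_def using assms is_Arg_exp[of w k] by auto

text \<open>The image of a horizontal strip under the exponential, hence open by the open mapping
  theorem; no branch of the argument enters.\<close>

lemma open_sector: "open (sector \<theta>1 \<theta>2)"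
proof -
  have "sector \<theta>1 \<theta>2 = exp ` {w. \<theta>1 < Im w \<and> Im w < \<theta>2}"
  proof (intro equalityI subsetI)
    fix w assume "w \<in> sector \<theta>1 \<theta>2"
    then obtain t where t: "w \<noteq> 0" "is_Arg w t" "\<theta>1 < t" "t < \<theta>2" by (auto simp: sector_def)
    have "exp (Complex (ln (norm w)) t) = of_real (norm w) * exp (\<i> * of_real t)"
      using t(1) by (simp add: exp_eq_polar)
    then have "w = exp (Complex (ln (norm w)) t)" using t(2) by (simp add: is_Arg_def)
    then show "w \<in> exp ` {w. \<theta>1 < Im w \<and> Im w < \<theta>2}" using t by force
  next
    fix w assume "w \<in> exp ` {w. \<theta>1 < Im w \<and> Im w < \<theta>2}"
    then show "w \<in> sector \<theta>1 \<theta>2"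
      using exp_in_sectorI[of \<theta>1 _ 0] by auto
  qed
  moreover have "open (exp ` {w::complex. \<theta>1 < Im w \<and> Im w < \<theta>2})"
  proof (rule open_mapping_thm[of exp UNIV])
    show "open {w. \<theta>1 < Im w \<and> Im w < \<theta>2}"
      by (intro open_Collect_conj open_Collect_less continuous_intros)
    show "\<not> (exp :: complex \<Rightarrow> complex) constant_on UNIV"
    proof
      assume "(exp :: complex \<Rightarrow> complex) constant_on UNIV"
      then obtain y where "\<And>x::complex. exp x = y" by (auto simp: constant_on_def)
      then have "exp (\<i> * pi) = exp (0::complex)" by metis
      then show False by simp
    qed
  qed (auto intro: holomorphic_intros)
  ultimately show ?thesis by simp
qed

text \<open>The angle gains at least 4 \<pi> in total: less than 2 \<pi> until it meets \<theta>1
  modulo 2 \<pi>, and at most 2 \<pi> more to cross the sector. Speed at most \<open>M\<close> makes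
  the crossing last at least (\<theta>2 - \<theta>1) / M.\<close>

lemma increasing_angle_visits_sector:
  fixes \<psi> \<psi>' :: "real \<Rightarrow> real"
  assumes der: "\<And>s. s \<in> {0..\<delta>} \<Longrightarrow> (\<psi> has_real_derivative \<psi>' s) (at s)"
    and lo: "\<And>s. s \<in> {0..\<delta>} \<Longrightarrow> m \<le> \<psi>' s" and hi: "\<And>s. s \<in> {0..\<delta>} \<Longrightarrow> \<psi>' s \<le> M"
    and m: "m > 0" and \<delta>: "m * \<delta> \<ge> 4 * pi" and \<alpha>: "\<theta>1 < \<theta>2" "\<theta>2 - \<theta>1 \<le> 2 * pi"
  obtains s1 s2 and k :: int where "0 \<le> s1" "s2 \<le> \<delta>" "(\<theta>2 - \<theta>1) / M \<le> s2 - s1"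
    "\<And>s. s1 < s \<Longrightarrow> s < s2 \<Longrightarrow> \<theta>1 < \<psi> s + 2 * pi * k \<and> \<psi> s + 2 * pi * k < \<theta>2"
proof -
  have \<delta>0: "\<delta> > 0" using m \<delta> pi_gt_zero by (metis less_le_trans mult_pos_pos zero_less_mult_pos zero_less_numeral)
  have M0: "M > 0" using lo[of 0] hi[of 0] m \<delta>0 by simp
  have mvt: "\<exists>x\<in>{0..\<delta>}. \<psi> t - \<psi> s = (t - s) * \<psi>' x" if "0 \<le> s" "s < t" "t \<le> \<delta>" for s t
  proof -
    have "(\<psi> has_real_derivative \<psi>' x) (at x)" if "s \<le> x" "x \<le> t" for x
      using der \<open>0 \<le> s\<close> \<open>t \<le> \<delta>\<close> that by auto
    then have "\<exists>x. s < x \<and> x < t \<and> \<psi> t - \<psi> s = (t - s) * \<psi>' x"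
      using MVT2[of s t \<psi> \<psi>'] \<open>s < t\<close> by blast
    then show ?thesis using that by (meson atLeastAtMost_iff less_imp_le order.trans)
  qed
  have inc: "\<psi> s < \<psi> t" if st: "0 \<le> s" "s < t" "t \<le> \<delta>" for s t
  proof -
    obtain x where "x \<in> {0..\<delta>}" "\<psi> t - \<psi> s = (t - s) * \<psi>' x" using mvt[OF st] by blast
    moreover have "(t - s) * \<psi>' x > 0" using lo[OF \<open>x \<in> {0..\<delta>}\<close>] m st by simp
    ultimately show ?thesis by simp
  qed
  have total: "\<psi> 0 + 4 * pi \<le> \<psi> \<delta>"
  proof -
    obtain x where x: "x \<in> {0..\<delta>}" "\<psi> \<delta> - \<psi> 0 = (\<delta> - 0) * \<psi>' x" using mvt[of 0 \<delta>] \<delta>0 by auto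
    have "m * \<delta> \<le> \<psi>' x * \<delta>" using lo[OF x(1)] \<delta>0 by simp
    then show ?thesis using x \<delta> by (simp add: mult.commute)
  qed
  \<comment> \<open>The least \<open>j\<close> for which \<theta>1 + 2 \<pi> j has not been passed
    at time 0; it reappears as \<open>- j\<close> since the conclusion adds the multiple of 2 \<pi>
    to \<open>\<psi>\<close>.\<close>
  define j where "j = \<lceil>(\<psi> 0 - \<theta>1) / (2 * pi)\<rceil>"
  have "(\<psi> 0 - \<theta>1) / (2 * pi) \<le> j" "j < (\<psi> 0 - \<theta>1) / (2 * pi) + 1"
    by (auto simp: j_def ceiling_correct) linarith+
  then have j: "\<psi> 0 \<le> \<theta>1 + 2 * pi * j" "\<theta>1 + 2 * pi * j < \<psi> 0 + 2 * pi"
    using pi_gt_zero by (simp_all add: field_simps)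
  have cont: "continuous_on {0..\<delta>} \<psi>"
    using der by (meson DERIV_isCont continuous_at_imp_continuous_on)
  have ivt: "\<exists>s\<in>{0..\<delta>}. \<psi> s = y" if "\<psi> 0 \<le> y" "y \<le> \<psi> \<delta>" for y
    using IVT'[of \<psi> 0 y \<delta>] that cont \<delta>0 by auto
  obtain s1 where s1: "s1 \<in> {0..\<delta>}" "\<psi> s1 = \<theta>1 + 2 * pi * j"
    using ivt[of "\<theta>1 + 2 * pi * j"] j total pi_gt_zero by auto
  obtain s2 where s2: "s2 \<in> {0..\<delta>}" "\<psi> s2 = \<theta>2 + 2 * pi * j"
    using ivt[of "\<theta>2 + 2 * pi * j"] j total \<alpha> by auto
  have "s1 < s2"
  proof (rule ccontr)
    assume "\<not> s1 < s2"
    then have "\<psi> s2 \<le> \<psi> s1" using inc[of s2 s1] s1 s2 by (cases "s1 = s2") auto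
    then show False using s1 s2 \<alpha> by simp
  qed
  obtain x where x: "x \<in> {0..\<delta>}" "\<psi> s2 - \<psi> s1 = (s2 - s1) * \<psi>' x"
    using mvt[of s1 s2] s1 s2 \<open>s1 < s2\<close> by auto
  show thesis
  proof (rule that[of s1 s2 "- j"])
    have "\<theta>2 - \<theta>1 \<le> (s2 - s1) * M"
      using x s1 s2 hi[OF x(1)] mult_left_mono[OF hi[OF x(1)], of "s2 - s1"] \<open>s1 < s2\<close> by simp
    then show "(\<theta>2 - \<theta>1) / M \<le> s2 - s1" using M0 by (simp add: field_simps)
    show "\<theta>1 < \<psi> s + 2 * pi * of_int (- j) \<and> \<psi> s + 2 * pi * of_int (- j) < \<theta>2" if "s1 < s" "s < s2" for s
      using inc[of s1 s] inc[of s s2] that s1 s2 by auto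
  qed (use s1 s2 in auto)
qed

section \<open>Near-constancy of the logarithmic derivative around good points\<close>

context factored_function
begin

text \<open>With \<open>q ^ 3 = K * L\<close>, the bound on \<open>W\<close> gives |z - a j| \<ge> 1
  / q^2, while the displacement is at most A K / q^3; so each zero keeps at least half its distance.
  Each pole then varies by at most 2 \<delta> / |z - a j|^2, which is at most 2 \<delta> q |z - a j|
  powr (-3/2). Summed, this is O(q), against |G| \<ge> \<gamma> L of order q^3.\<close>

lemma good_nearby:
  fixes A K \<gamma> q :: real
  defines "q \<equiv> (K * L) powr (1/3)"
  assumes z: "z \<in> good \<gamma> K" and z': "norm (z' - z) \<le> A / L"
    and pos: "A > 0" "K > 0" "\<gamma> > 0" and AL: "A < L"
    and q: "1 \<le> q" "2 * A * K \<le> q" "4 * K * (2 * A * K + 26 * A) / \<gamma> \<le> q"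
  shows "z' \<in> ball 0 5" "\<phi> z' \<noteq> 0" "norm (G z' - G z) \<le> norm (G z) / 4"
proof -
  define \<delta> where "\<delta> = A / L"
  have L0: "L > 0" using L1 by simp
  have \<delta>: "\<delta> > 0" "\<delta> < 1" using pos AL L0 by (auto simp: \<delta>_def)
  have z4: "z \<in> ball 0 4" "\<phi> z \<noteq> 0" "\<gamma> * L \<le> norm (G z)" "W z \<le> K * L"
    using z by (auto simp: good_def)
  have ball5: "w \<in> ball 0 5" if "norm (w - z) \<le> \<delta>" for w
    using z4 that \<delta> norm_triangle_sub[of w z] by simp
  show z'5: "z' \<in> ball 0 5" using ball5 z' by (simp add: \<delta>_def)
  have q3: "q ^ 3 = K * L"
    using pos L0 by (simp add: q_def powr_powr flip: powr_numeral)
  have \<delta>q: "\<delta> = A * K / q ^ 3" using pos L0 by (simp add: q3 \<delta>_def)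
  have a: "z - a j \<noteq> 0" "\<delta> \<le> norm (z - a j) / 2"
    "1 / (norm (z - a j))\<^sup>2 \<le> q * norm (z - a j) powr (-3/2)" if j: "j < n" for j
  proof -
    show za: "z - a j \<noteq> 0" using zeros[of z] z4 j by auto
    define x where "x = norm (z - a j)"
    have x: "x > 0" using za by (simp add: x_def)
    have "x powr (-3/2) \<le> W z"
      unfolding W_def x_def by (rule member_le_sum) (use j in auto)
    then have "x powr (-3/2) \<le> K * L" using z4 by simp
    then have "(x powr (-3/2)) powr (1/3) \<le> (K * L) powr (1/3)" by (intro powr_mono2) auto
    then have xq: "x powr (-1/2) \<le> q" by (simp add: powr_powr q_def)
    have "1 / x = x powr (-1/2) * x powr (-1/2)"
    proof -
      have "x powr (-1/2) * x powr (-1/2) = x powr (-1/2 + -1/2)" by (simp only: powr_add)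
      then show ?thesis using x by (simp add: powr_minus_divide)
    qed
    also have "\<dots> \<le> q * q" using xq by (intro mult_mono) (use q in auto)
    finally have 1: "1 / x \<le> q\<^sup>2" by (simp add: power2_eq_square)
    have "\<delta> * q\<^sup>2 = A * K / q" using q by (simp add: \<delta>q power2_eq_square power3_eq_cube)
    also have "\<dots> \<le> 1 / 2" using q by (simp add: field_simps)
    finally have 2: "\<delta> * q\<^sup>2 \<le> 1 / 2" .
    have "\<delta> * (1 / x) \<le> 1 / 2" using mult_left_mono[OF 1, of \<delta>] 2 \<delta> by linarith
    then show "\<delta> \<le> norm (z - a j) / 2" using x by (simp add: x_def field_simps)
    have "1 / x\<^sup>2 = x powr (-1/2) * x powr (-3/2)"
    proof -
      have "x powr (-1/2) * x powr (-3/2) = x powr (-1/2 + -3/2)" by (simp only: powr_add)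
      then show ?thesis using x by (simp add: powr_minus_divide)
    qed
    also have "\<dots> \<le> q * x powr (-3/2)" using xq by (intro mult_right_mono) auto
    finally show "1 / (norm (z - a j))\<^sup>2 \<le> q * norm (z - a j) powr (-3/2)" by (simp add: x_def)
  qed
  have half: "norm (z - a j) / 2 \<le> norm (z' - a j)" if j: "j < n" for j
    using norm_triangle_ineq2[of "z - a j" "z - z'"] z'[folded \<delta>_def] a(2)[OF j]
    by (simp add: norm_minus_commute)
  have nz: "z' - a j \<noteq> 0" if j: "j < n" for j
    using half[OF j] a(1)[OF j] by auto
  show "\<phi> z' \<noteq> 0" using zeros[of z'] z'5 nz by auto
  have dh: "norm (deriv h z' - deriv h z) \<le> 26 * L * norm (z' - z)"
  proof (rule field_differentiable_bound[where S="ball 0 5"])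
    show "(deriv h has_field_derivative deriv (deriv h) w) (at w within ball 0 5)" if "w \<in> ball 0 5" for w
      using holomorphic_derivI[OF h_hol', of w] that by auto
  qed (use h''_bound z'5 z4 in auto)
  have "norm (G z' - G z) = norm ((\<Sum>j<n. 1 / (z' - a j) - 1 / (z - a j)) + (deriv h z' - deriv h z))"
    using z4 z'5 by (simp add: G_def sum_subtractf algebra_simps)
  also have "\<dots> \<le> (\<Sum>j<n. norm (1 / (z' - a j) - 1 / (z - a j))) + 26 * L * norm (z' - z)"
    by (intro order.trans[OF norm_triangle_ineq] add_mono norm_sum dh)
  also have "\<dots> \<le> (\<Sum>j<n. 2 * \<delta> * q * norm (z - a j) powr (-3/2)) + 26 * L * \<delta>"
  proof (intro add_mono sum_mono mult_left_mono)
    fix j assume "j \<in> {..<n}"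
    then have j: "j < n" by simp
    have x: "norm (z - a j) > 0" using a(1)[OF j] by simp
    have "norm (1 / (z' - a j) - 1 / (z - a j)) = norm (z' - z) / (norm (z' - a j) * norm (z - a j))"
      using a(1)[OF j] nz[OF j] by (simp add: diff_frac_eq norm_divide norm_mult norm_minus_commute)
    also have "\<dots> \<le> \<delta> / (norm (z - a j) / 2 * norm (z - a j))"
      using half[OF j] x \<delta> z' by (intro frac_le mult_right_mono) (auto simp: \<delta>_def)
    also have "\<dots> = 2 * \<delta> * (1 / (norm (z - a j))\<^sup>2)" by (simp add: power2_eq_square)
    also have "\<dots> \<le> 2 * \<delta> * (q * norm (z - a j) powr (-3/2))"
      using a(3)[OF j] \<delta> by (intro mult_left_mono) auto
    finally show "norm (1 / (z' - a j) - 1 / (z - a j)) \<le> 2 * \<delta> * q * norm (z - a j) powr (-3/2)" by simp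
  qed (use z' L0 in \<open>auto simp: \<delta>_def\<close>)
  also have "\<dots> = 2 * \<delta> * q * W z + 26 * A"
    using L0 by (simp add: W_def sum_distrib_left \<delta>_def)
  also have "\<dots> \<le> 2 * \<delta> * q * (K * L) + 26 * A"
    using z4 \<delta> q by (intro add_right_mono mult_left_mono) auto
  also have "\<dots> = 2 * A * K * q + 26 * A" using L0 by (simp add: \<delta>_def)
  also have "\<dots> \<le> (2 * A * K + 26 * A) * q"
    using q pos by (simp add: algebra_simps)
  also have "\<dots> \<le> \<gamma> * L / 4"
  proof -
    have "4 * K * (2 * A * K + 26 * A) \<le> \<gamma> * q"
      using q(3) pos by (simp add: pos_divide_le_eq mult.commute)
    also have "\<dots> \<le> \<gamma> * q\<^sup>2" using q pos by (simp add: power2_eq_square)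
    finally have "4 * K * (2 * A * K + 26 * A) * q \<le> \<gamma> * q\<^sup>2 * q" using q by (intro mult_right_mono) auto
    also have "\<dots> = \<gamma> * (K * L)" by (simp add: power2_eq_square power3_eq_cube flip: q3)
    finally have "4 * K * ((2 * A * K + 26 * A) * q) \<le> 4 * K * (\<gamma> * L / 4)" by (simp add: algebra_simps)
    then show ?thesis using pos by simp
  qed
  also have "\<dots> \<le> norm (G z) / 4" using z4 by simp
  finally show "norm (G z' - G z) \<le> norm (G z) / 4" .
qed

end

text \<open>The direction must not depend on the point when translates of one segment are averaged.
  Four fixed directions suffice, at the cost of a factor 2.\<close>

lemma exists_direction:
  fixes w :: complex
  obtains e where "e \<in> {1, \<i>, -1, -\<i>}" "norm w / 2 \<le> Im (w * e)"
proof -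
  have "norm w \<le> \<bar>Re w\<bar> + \<bar>Im w\<bar>" by (rule cmod_le)
  then consider "norm w / 2 \<le> \<bar>Re w\<bar>" | "norm w / 2 \<le> \<bar>Im w\<bar>" by linarith
  then show thesis
    using that[of 1] that[of \<i>] that[of "-1"] that[of "-\<i>"]
    by cases (auto simp: abs_if split: if_splits)
qed

section \<open>Area of the preimage of a sector\<close>

context factored_function
begin

definition preimage :: "real \<Rightarrow> real \<Rightarrow> complex set" where
  "preimage \<theta>1 \<theta>2 = \<phi> -` sector \<theta>1 \<theta>2 \<inter> ball 0 5"

lemma preimage_borel [measurable]: "preimage \<theta>1 \<theta>2 \<in> sets borel"
proof -
  have "open (\<phi> -` sector \<theta>1 \<theta>2)" by (intro open_vimage open_sector \<phi>_cont)
  then show ?thesis unfolding preimage_def by auto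
qed

text \<open>Near \<open>z\<close> a holomorphic logarithm of \<open>\<phi>\<close> has derivative
  \<open>G\<close>, so along \<open>e\<close> the argument advances with speed between |G z| / 4 and
  5 |G z| / 4. Over the length A / (2 L) it gains at least A \<gamma> / 8 \<ge> 16 \<ge> 4
  \<pi>.\<close>

lemma segment_in_preimage:
  fixes A K M \<gamma> q :: real
  defines "q \<equiv> (K * L) powr (1/3)"
  assumes z: "z \<in> good \<gamma> K" and e: "norm e = 1" "norm (G z) / 2 \<le> Im (G z * e)"
    and GM: "norm (G z) \<le> M * L"
    and pos: "A > 0" "K > 0" "\<gamma> > 0" and AL: "A < L" and A\<gamma>: "A * \<gamma> \<ge> 128"
    and q: "1 \<le> q" "2 * A * K \<le> q" "4 * K * (2 * A * K + 26 * A) / \<gamma> \<le> q"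
    and \<alpha>: "\<theta>1 < \<theta>2" "\<theta>2 - \<theta>1 \<le> 2 * pi"
  shows "ennreal ((\<theta>2 - \<theta>1) / (2 * M * L)) \<le>
    (\<integral>\<^sup>+s. indicator {0..A / (2 * L)} s * indicator (preimage \<theta>1 \<theta>2) (z + of_real s * e) \<partial>lborel)"
proof -
  \<comment> \<open>Half of the radius \<open>A / L\<close>, so that the closed segment lies in the
    open disc \<open>B\<close>.\<close>
  define \<delta> where "\<delta> = A / (2 * L)"
  have L0: "L > 0" using L1 by simp
  have AL0: "A / L > 0" using pos L0 by simp
  have near: "w \<in> ball 0 5" "\<phi> w \<noteq> 0" "norm (G w - G z) \<le> norm (G z) / 4" if "norm (w - z) \<le> A / L" for w
    using good_nearby[OF z that pos AL] q by (auto simp: q_def)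
  have Gz: "\<gamma> * L \<le> norm (G z)" using z by (simp add: good_def)
  have G0: "norm (G z) > 0" using Gz pos L0 by (meson less_le_trans mult_pos_pos)
  define B where "B = ball z (A / L)"
  have B: "w \<in> B \<Longrightarrow> norm (w - z) \<le> A / L" for w by (simp add: B_def dist_norm norm_minus_commute)
  obtain g where g: "g holomorphic_on B" "\<And>w. w \<in> B \<Longrightarrow> exp (g w) = \<phi> w"
    using holomorphic_logarithm_exists[of B \<phi> z] near(2)[OF B] AL0 \<phi>_hol
    by (metis B_def centre_in_ball convex_ball holomorphic_on_subset open_ball subset_UNIV)
  have dg: "(g has_field_derivative G w) (at w)" if w: "w \<in> B" for w
  proof -
    have d: "(g has_field_derivative deriv g w) (at w)"
      using g(1) w by (simp add: holomorphic_derivI B_def)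
    then have "((\<lambda>w. exp (g w)) has_field_derivative exp (g w) * deriv g w) (at w)"
      by (auto intro!: derivative_eq_intros)
    then have 1: "(\<phi> has_field_derivative \<phi> w * deriv g w) (at w)"
      using has_field_derivative_transform_within_open[of "\<lambda>w. exp (g w)" _ w B \<phi>] g(2) w by (auto simp: B_def)
    have "w \<in> ball 0 8" using near(1)[OF B[OF w]] by auto
    from DERIV_unique[OF 1 \<phi>_deriv[OF this near(2)[OF B[OF w]]]] have "deriv g w = G w"
      using near(2)[OF B[OF w]] by simp
    then show ?thesis using d by simp
  qed
  have segB: "z + of_real s * e \<in> B" if "s \<in> {0..\<delta>}" for s
  proof -
    have "s \<le> A / (2 * L)" "A / (2 * L) < A / L" using that pos L0 by (auto simp: \<delta>_def field_simps)
    then show ?thesis using that e by (simp add: B_def dist_norm norm_mult)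
  qed
  define \<psi> where "\<psi> s = Im (g (z + of_real s * e))" for s
  have d\<psi>: "(\<psi> has_real_derivative Im (G (z + of_real s * e) * e)) (at s)" if "s \<in> {0..\<delta>}" for s
  proof -
    have "((\<lambda>s. z + of_real s * e) has_vector_derivative e) (at s)"
      by (auto intro!: derivative_eq_intros)
    then have "((\<lambda>s. g (z + of_real s * e)) has_vector_derivative (e * G (z + of_real s * e))) (at s)"
      using field_vector_diff_chain_at[of "\<lambda>s. z + of_real s * e" e s g] dg[OF segB[OF that]] by (auto simp: o_def)
    from bounded_linear.has_vector_derivative[OF bounded_linear_Im this]
    show ?thesis by (simp add: \<psi>_def[abs_def] has_real_derivative_iff_has_vector_derivative mult.commute)
  qed
  have dev: "\<bar>Im (G w * e) - Im (G z * e)\<bar> \<le> norm (G z) / 4" if "w \<in> B" for w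
  proof -
    have "\<bar>Im ((G w - G z) * e)\<bar> \<le> norm ((G w - G z) * e)" by (rule abs_Im_le_cmod)
    also have "\<dots> \<le> norm (G z) / 4" using near(3)[OF B[OF that]] e by (simp add: norm_mult)
    finally show ?thesis by (simp add: algebra_simps)
  qed
  have up: "Im (G z * e) \<le> norm (G z)" using abs_Im_le_cmod[of "G z * e"] e by (simp add: norm_mult)
  have long: "4 * pi \<le> norm (G z) / 4 * \<delta>"
  proof -
    have "4 * pi \<le> 16" using pi_less_4 by simp
    also have "\<dots> \<le> \<gamma> * L / 4 * \<delta>" using A\<gamma> L0 by (simp add: \<delta>_def field_simps)
    also have "\<dots> \<le> norm (G z) / 4 * \<delta>" using Gz pos L0 by (intro mult_right_mono) (auto simp: \<delta>_def)
    finally show ?thesis .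
  qed
  obtain s1 s2 and k :: int where s: "0 \<le> s1" "s2 \<le> \<delta>" "(\<theta>2 - \<theta>1) / (5 / 4 * norm (G z)) \<le> s2 - s1"
    and sk: "\<And>s. s1 < s \<Longrightarrow> s < s2 \<Longrightarrow> \<theta>1 < \<psi> s + 2 * pi * k \<and> \<psi> s + 2 * pi * k < \<theta>2"
  proof (rule increasing_angle_visits_sector[of \<delta> \<psi> "\<lambda>s. Im (G (z + of_real s * e) * e)" "norm (G z) / 4" "5 / 4 * norm (G z)" \<theta>1 \<theta>2])
    show "norm (G z) / 4 \<le> Im (G (z + of_real s * e) * e)" "Im (G (z + of_real s * e) * e) \<le> 5 / 4 * norm (G z)"
      if "s \<in> {0..\<delta>}" for s
      using dev[OF segB[OF that]] e(2) up by linarith+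
  qed (use d\<psi> G0 long \<alpha> in auto)
  have inP: "z + of_real s * e \<in> preimage \<theta>1 \<theta>2" if "s1 < s" "s < s2" for s
  proof -
    have b: "z + of_real s * e \<in> B" using that s by (intro segB) auto
    have "exp (g (z + of_real s * e)) \<in> sector \<theta>1 \<theta>2"
      using sk[OF that] by (intro exp_in_sectorI[of _ _ k]) (auto simp: \<psi>_def)
    then show ?thesis using g(2)[OF b] near(1)[OF B[OF b]] by (simp add: preimage_def)
  qed
  have "(\<theta>2 - \<theta>1) / (2 * M * L) \<le> (\<theta>2 - \<theta>1) / (5 / 4 * norm (G z))"
  proof (rule frac_le)
    have "5 / 4 * norm (G z) \<le> 5 / 4 * (M * L)" using GM by simp
    also have "\<dots> \<le> 2 * M * L"
    proof -
      have "0 \<le> M * L" using GM G0 by linarith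
      then show ?thesis by (simp add: mult.commute)
    qed
    finally show "5 / 4 * norm (G z) \<le> 2 * M * L" .
  qed (use G0 \<alpha> in auto)
  then have "ennreal ((\<theta>2 - \<theta>1) / (2 * M * L)) \<le> ennreal (s2 - s1)"
    by (rule ennreal_leI[OF order.trans[OF _ s(3)]])
  also have "\<dots> = emeasure lborel {s1<..<s2}"
  proof -
    have "(\<theta>2 - \<theta>1) / (5 / 4 * norm (G z)) > 0" using \<alpha> G0 by auto
    then have "s1 \<le> s2" using s(3) by linarith
    then show ?thesis by simp
  qed
  also have "\<dots> = (\<integral>\<^sup>+s. indicator {s1<..<s2} s \<partial>lborel)" by simp
  also have "\<dots> \<le> (\<integral>\<^sup>+s. indicator {0..\<delta>} s * indicator (preimage \<theta>1 \<theta>2) (z + of_real s * e) \<partial>lborel)"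
  proof (rule nn_integral_mono)
    fix s :: real
    show "indicator {s1<..<s2} s \<le>
        (indicator {0..\<delta>} s * indicator (preimage \<theta>1 \<theta>2) (z + of_real s * e) :: ennreal)"
    proof (cases "s \<in> {s1<..<s2}")
      case True
      then show ?thesis using inP[of s] s(1,2) by simp
    qed simp
  qed
  finally show ?thesis by (simp add: \<delta>_def)
qed

text \<open>Averaging over translates of a fixed segment replaces a covering argument.\<close>

lemma emeasure_preimage_ge:
  fixes A K M \<gamma> q :: real
  defines "q \<equiv> (K * L) powr (1/3)"
  assumes GM: "\<And>z. z \<in> good \<gamma> K \<Longrightarrow> norm (G z) \<le> M * L"
    and pos: "A > 0" "K > 0" "\<gamma> > 0" "M > 0" and AL: "A < L" and A\<gamma>: "A * \<gamma> \<ge> 128"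
    and q: "1 \<le> q" "2 * A * K \<le> q" "4 * K * (2 * A * K + 26 * A) / \<gamma> \<le> q"
    and \<alpha>: "\<theta>1 < \<theta>2" "\<theta>2 - \<theta>1 \<le> 2 * pi"
  shows "ennreal (\<theta>2 - \<theta>1) * emeasure lborel (good \<gamma> K) \<le> ennreal (4 * M * A) * emeasure lborel (preimage \<theta>1 \<theta>2)"
proof -
  define P where "P = preimage \<theta>1 \<theta>2"
  have [measurable]: "P \<in> sets borel" by (simp add: P_def)
  define E where "E e = good \<gamma> K \<inter> {z \<in> space borel. norm (G z) / 2 \<le> Im (G z * e)}" for e
  have [measurable]: "E e \<in> sets borel" for e unfolding E_def by measurable
  have L0: "L > 0" using L1 by simp
  define \<delta> where "\<delta> = A / (2 * L)"
  have \<delta>0: "\<delta> > 0" using pos L0 by (simp add: \<delta>_def)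
  have part: "ennreal (\<theta>2 - \<theta>1) * emeasure lborel (E e) \<le> ennreal (M * A) * emeasure lborel P" if e: "norm e = 1" for e
  proof -
    have "ennreal ((\<theta>2 - \<theta>1) / (2 * M * L)) * emeasure lborel (E e) =
        (\<integral>\<^sup>+z. ennreal ((\<theta>2 - \<theta>1) / (2 * M * L)) * indicator (E e) z \<partial>lborel)"
      by (simp add: nn_integral_cmult)
    also have "\<dots> \<le> (\<integral>\<^sup>+z. (\<integral>\<^sup>+s. indicator {0..\<delta>} s * indicator P (z + of_real s * e) \<partial>lborel) \<partial>lborel)"
    proof (rule nn_integral_mono)
      fix z
      show "ennreal ((\<theta>2 - \<theta>1) / (2 * M * L)) * indicator (E e) z \<le>
          (\<integral>\<^sup>+s. indicator {0..\<delta>} s * indicator P (z + of_real s * e) \<partial>lborel)"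
      proof (cases "z \<in> E e")
        case True
        then have z: "z \<in> good \<gamma> K" "norm (G z) / 2 \<le> Im (G z * e)" by (auto simp: E_def)
        show ?thesis
          using segment_in_preimage[OF z(1) e z(2) GM[OF z(1)] pos(1-3) AL A\<gamma> _ _ _ \<alpha>] q True
          by (simp add: P_def \<delta>_def q_def)
      qed auto
    qed
    also have "\<dots> = (\<integral>\<^sup>+s. (\<integral>\<^sup>+z. indicator {0..\<delta>} s * indicator P (z + of_real s * e) \<partial>lborel) \<partial>lborel)"
      by (rule lborel_pair.Fubini') measurable
    also have "\<dots> = (\<integral>\<^sup>+s. indicator {0..\<delta>} s * emeasure lborel P \<partial>lborel)"
    proof (rule nn_integral_cong)
      fix s :: real
      have "(\<integral>\<^sup>+z. indicator P (z + of_real s * e) \<partial>lborel) = (\<integral>\<^sup>+z. indicator P z \<partial>lborel)"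
        by (rule nn_integral_lborel_translate) measurable
      then show "(\<integral>\<^sup>+z. indicator {0..\<delta>} s * indicator P (z + of_real s * e) \<partial>lborel) = indicator {0..\<delta>} s * emeasure lborel P"
        by (simp add: nn_integral_cmult)
    qed
    also have "\<dots> = ennreal \<delta> * emeasure lborel P"
      using \<delta>0 by (simp add: nn_integral_multc)
    \<comment> \<open>The time spent in the sector and the length of the segment are both
      proportional to 1 / L, so \<open>L\<close> cancels.\<close>
    finally have "ennreal (2 * M * L) * (ennreal ((\<theta>2 - \<theta>1) / (2 * M * L)) * emeasure lborel (E e)) \<le>
        ennreal (2 * M * L) * (ennreal \<delta> * emeasure lborel P)"
      by (rule mult_left_mono) auto
    moreover have "ennreal (2 * M * L) * ennreal ((\<theta>2 - \<theta>1) / (2 * M * L)) = ennreal (\<theta>2 - \<theta>1)"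
      using pos L0 \<alpha> by (subst ennreal_mult[symmetric]) auto
    moreover have "ennreal (2 * M * L) * ennreal \<delta> = ennreal (M * A)"
      using pos L0 by (subst ennreal_mult[symmetric]) (auto simp: \<delta>_def)
    ultimately show ?thesis by (simp flip: mult.assoc)
  qed
  have "good \<gamma> K \<subseteq> E 1 \<union> (E \<i> \<union> (E (-1) \<union> E (-\<i>)))"
  proof
    fix z assume z: "z \<in> good \<gamma> K"
    obtain e where e: "e \<in> {1, \<i>, -1, -\<i>}" "norm (G z) / 2 \<le> Im (G z * e)" by (rule exists_direction)
    then have "z \<in> E e" using z by (simp add: E_def)
    then show "z \<in> E 1 \<union> (E \<i> \<union> (E (-1) \<union> E (-\<i>)))"
      using e(1) by blast
  qed
  then have "emeasure lborel (good \<gamma> K) \<le> emeasure lborel (E 1 \<union> (E \<i> \<union> (E (-1) \<union> E (-\<i>))))"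
    by (rule emeasure_mono) simp
  also have "\<dots> \<le> emeasure lborel (E 1) + (emeasure lborel (E \<i>) + (emeasure lborel (E (-1)) + emeasure lborel (E (-\<i>))))"
  proof -
    have sub: "emeasure lborel (X \<union> Y) \<le> emeasure lborel X + y"
      if "X \<in> sets borel" "Y \<in> sets borel" "emeasure lborel Y \<le> y" for X Y :: "complex set" and y
      using emeasure_subadditive[of X lborel Y] that by (simp add: add_left_mono order.trans)
    show ?thesis by (intro sub sets.Un order.refl) auto
  qed
  finally have "ennreal (\<theta>2 - \<theta>1) * emeasure lborel (good \<gamma> K) \<le>
      ennreal (\<theta>2 - \<theta>1) * (emeasure lborel (E 1) + (emeasure lborel (E \<i>) + (emeasure lborel (E (-1)) + emeasure lborel (E (-\<i>)))))"
    by (rule mult_left_mono) auto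
  also have "\<dots> \<le> ennreal (M * A) * emeasure lborel P + (ennreal (M * A) * emeasure lborel P +
      (ennreal (M * A) * emeasure lborel P + ennreal (M * A) * emeasure lborel P))"
    unfolding distrib_left by (intro add_mono part) auto
  also have "\<dots> = (ennreal (M * A) + (ennreal (M * A) + (ennreal (M * A) + ennreal (M * A)))) * emeasure lborel P"
    by (simp only: distrib_right)
  also have "ennreal (M * A) + (ennreal (M * A) + (ennreal (M * A) + ennreal (M * A))) = ennreal (4 * M * A)"
    using pos by (simp flip: ennreal_plus)
  finally show ?thesis by (simp add: P_def)
qed

end

text \<open>All constants are functions of \<open>c\<close>, hence the same for every function, disc
  and sector. \<open>A\<close> is such that A \<gamma> = 128, enough for two full turns;
  \<open>L0\<close> exceeds \<open>A\<close> and makes (K L) powr (1/3) at least \<open>Q\<close>,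
  which collects the lower bounds asked of \<open>q\<close>.\<close>

lemma local_estimate:
  fixes c :: real
  assumes c: "c > 0"
  obtains \<kappa> L0 :: real where "\<kappa> > 0" "L0 > 0"
    "\<And>\<phi> L p \<theta>1 \<theta>2. \<phi> holomorphic_on UNIV \<Longrightarrow> norm (\<phi> 0) = 1 \<Longrightarrow> L0 \<le> L \<Longrightarrow>
      (\<And>z. norm z \<le> 24 \<Longrightarrow> norm (\<phi> z) \<le> exp L) \<Longrightarrow> norm p \<le> 3 \<Longrightarrow>
      (\<And>z. z \<in> ball p 1 \<Longrightarrow> norm (\<phi> z) \<le> exp (- c * L)) \<Longrightarrow> \<theta>1 < \<theta>2 \<Longrightarrow> \<theta>2 - \<theta>1 \<le> 2 * pi \<Longrightarrow>
      ennreal (\<kappa> * (\<theta>2 - \<theta>1)) \<le> emeasure lborel (\<phi> -` sector \<theta>1 \<theta>2 \<inter> ball 0 5)"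
proof -
  define \<tau> where "\<tau> = (c / 4096)\<^sup>2"
  define K where "K = (2 / \<tau> + 13) * 4096 / c"
  define M where "M = 2 / \<tau> + 13 + sqrt \<tau> * K"
  define \<gamma> where "\<gamma> = c / 256"
  define A where "A = 128 / \<gamma>"
  have \<tau>0: "\<tau> > 0" using c by (auto simp: \<tau>_def)
  have K0: "K > 0" using c \<tau>0 by (auto simp: K_def intro!: divide_pos_pos add_pos_pos)
  have M0: "M > 0" using \<tau>0 K0 by (auto simp: M_def intro!: add_pos_nonneg)
  have \<gamma>0: "\<gamma> > 0" using c by (simp add: \<gamma>_def)
  have A0: "A > 0" using \<gamma>0 by (simp add: A_def)
  define Q where "Q = 1 + 2 * A * K + 4 * K * (2 * A * K + 26 * A) / \<gamma>"
  have Q0: "4 * K * (2 * A * K + 26 * A) / \<gamma> \<ge> 0" "2 * A * K \<ge> 0" using K0 A0 \<gamma>0 by auto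
  have Q1: "Q \<ge> 1" using Q0 by (simp add: Q_def)
  define L0 where "L0 = 1 + A + Q ^ 3 / K"
  have "0 \<le> Q ^ 3 / K" using Q1 K0 by auto
  then have L0: "1 \<le> L0" "A < L0" "Q ^ 3 / K \<le> L0" using A0 by (auto simp: L0_def)
  show thesis
  \<comment> \<open>The area c / (2 M) of the good set, divided by the factor 4 M A of
    \<open>emeasure_preimage_ge\<close>.\<close>
  proof (rule that[of "c / (8 * M\<^sup>2 * A)" L0])
    fix \<phi> :: "complex \<Rightarrow> complex" and L p \<theta>1 \<theta>2
    assume hol: "\<phi> holomorphic_on UNIV" and n0: "norm (\<phi> 0) = 1" and L: "L0 \<le> L"
      and bd: "\<And>z. norm z \<le> 24 \<Longrightarrow> norm (\<phi> z) \<le> exp L" and p: "norm p \<le> 3"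
      and small: "\<And>z. z \<in> ball p 1 \<Longrightarrow> norm (\<phi> z) \<le> exp (- c * L)"
      and \<alpha>: "\<theta>1 < \<theta>2" "\<theta>2 - \<theta>1 \<le> 2 * pi"
    have L1: "L \<ge> 1" using L L0 by simp
    then have Lpos: "L > 0" by simp
    from zero_factorization[OF hol n0 Lpos bd]
    obtain n a h C where "factored_function \<phi> h a n C L"
      unfolding factored_function_def using hol n0 L1 by metis
    then interpret factored_function \<phi> h a n C L .
    have "Q ^ 3 / K \<le> L" using L0 L by simp
    then have "Q ^ 3 \<le> K * L" using K0 by (simp add: pos_divide_le_eq mult.commute)
    then have "(Q ^ 3) powr (1/3) \<le> (K * L) powr (1/3)" by (intro powr_mono2) (use Q1 in auto)
    then have "Q \<le> (K * L) powr (1/3)" using Q1 by (simp add: powr_powr flip: powr_numeral)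
    then have q: "1 \<le> (K * L) powr (1/3)" "2 * A * K \<le> (K * L) powr (1/3)"
      "4 * K * (2 * A * K + 26 * A) / \<gamma> \<le> (K * L) powr (1/3)"
      using Q0 by (auto simp: Q_def)
    have GM: "norm (G z) \<le> M * L" if "z \<in> good \<gamma> K" for z
    proof -
      have z: "z \<in> ball 0 4" "\<phi> z \<noteq> 0" "W z \<le> K * L" using that by (auto simp: good_def)
      have "norm (G z) \<le> (2 / \<tau> + 13) * L + sqrt \<tau> * W z" by (rule norm_G_le[OF z(1,2) \<tau>0])
      also have "\<dots> \<le> (2 / \<tau> + 13) * L + sqrt \<tau> * (K * L)"
        using z \<tau>0 by (intro add_left_mono mult_left_mono) auto
      finally show ?thesis by (simp add: M_def algebra_simps)
    qed
    have AL: "A < L" "A * \<gamma> \<ge> 128" using L0 L \<gamma>0 by (auto simp: A_def)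
    have "ennreal (\<theta>2 - \<theta>1) * ennreal (c / (2 * M)) \<le> ennreal (\<theta>2 - \<theta>1) * emeasure lborel (good \<gamma> K)"
      unfolding \<gamma>_def by (intro mult_left_mono emeasure_good[OF p c small \<tau>_def K_def M_def]) auto
    also have "\<dots> \<le> ennreal (4 * M * A) * emeasure lborel (preimage \<theta>1 \<theta>2)"
      by (rule emeasure_preimage_ge[OF GM A0 K0 \<gamma>0 M0 AL q \<alpha>])
    finally have "ennreal (1 / (4 * M * A)) * (ennreal (\<theta>2 - \<theta>1) * ennreal (c / (2 * M))) \<le>
        ennreal (1 / (4 * M * A)) * (ennreal (4 * M * A) * emeasure lborel (preimage \<theta>1 \<theta>2))"
      by (rule mult_left_mono) auto
    moreover have "ennreal (1 / (4 * M * A)) * (ennreal (\<theta>2 - \<theta>1) * ennreal (c / (2 * M))) =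
        ennreal (c / (8 * M\<^sup>2 * A) * (\<theta>2 - \<theta>1))"
    proof -
      have "ennreal (1 / (4 * M * A)) * (ennreal (\<theta>2 - \<theta>1) * ennreal (c / (2 * M))) =
          ennreal (1 / (4 * M * A) * ((\<theta>2 - \<theta>1) * (c / (2 * M))))"
        using \<alpha> c M0 A0 by (simp only: ennreal_mult[symmetric] divide_nonneg_nonneg mult_nonneg_nonneg
          less_imp_le diff_ge_0_iff_ge zero_le_numeral zero_le_one)
      also have "1 / (4 * M * A) * ((\<theta>2 - \<theta>1) * (c / (2 * M))) = c / (8 * M\<^sup>2 * A) * (\<theta>2 - \<theta>1)"
        by (simp add: power2_eq_square field_simps)
      finally show ?thesis .
    qed
    moreover have "ennreal (1 / (4 * M * A)) * (ennreal (4 * M * A) * emeasure lborel (preimage \<theta>1 \<theta>2)) =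
        emeasure lborel (preimage \<theta>1 \<theta>2)"
    proof -
      have "ennreal (1 / (4 * M * A)) * ennreal (4 * M * A) = 1"
        using M0 A0 by (subst ennreal_mult[symmetric]) auto
      then show ?thesis by (simp flip: mult.assoc)
    qed
    ultimately show "ennreal (c / (8 * M\<^sup>2 * A) * (\<theta>2 - \<theta>1)) \<le> emeasure lborel (\<phi> -` sector \<theta>1 \<theta>2 \<inter> ball 0 5)"
      by (simp add: preimage_def)
  qed (use c M0 A0 L0 in auto)
qed

section \<open>Growth of the maximum modulus\<close>

text \<open>Dividing \<open>f\<close> by its value at the centre of a disc rotates the image. This
  leads back from the rotated sector, which has the same opening, to the given one.\<close>

lemma mult_in_sector:
  assumes "w \<in> sector (\<theta>1 - t) (\<theta>2 - t)" "is_Arg v t" "v \<noteq> 0"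
  shows "w * v \<in> sector \<theta>1 \<theta>2"
proof -
  obtain u where u: "w \<noteq> 0" "is_Arg w u" "\<theta>1 - t < u" "u < \<theta>2 - t"
    using assms(1) by (auto simp: sector_def)
  have "w * v = (of_real (norm w) * exp (\<i> * of_real u)) * (of_real (norm v) * exp (\<i> * of_real t))"
    using u(2) assms(2) unfolding is_Arg_def by metis
  also have "\<dots> = of_real (norm (w * v)) * exp (\<i> * of_real (u + t))"
    by (simp add: norm_mult exp_add algebra_simps)
  finally have "is_Arg (w * v) (u + t)" by (simp only: is_Arg_def)
  then show ?thesis unfolding sector_def using u assms(3) by (auto intro!: exI[of _ "u + t"])
qed

lemma norm_le_max_modulus:
  assumes f: "f holomorphic_on UNIV" and z: "norm z \<le> r"
  shows "norm (f z) \<le> max_modulus r f"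
  unfolding max_modulus_def
proof (rule cSUP_upper)
  have "continuous_on (cball 0 r) f"
    using f holomorphic_on_imp_continuous_on continuous_on_subset by blast
  then have "compact ((\<lambda>z. norm (f z)) ` cball 0 r)"
    by (intro compact_continuous_image continuous_on_norm) auto
  then show "bdd_above ((\<lambda>z. norm (f z)) ` cball 0 r)"
    by (intro bounded_imp_bdd_above compact_imp_bounded)
qed (use z in auto)

lemma max_modulus_attained:
  assumes f: "f holomorphic_on UNIV" and r: "r > 0"
  obtains z where "norm z = r" "norm (f z) = max_modulus r f"
proof -
  have cont: "continuous_on S f" for S
    using f holomorphic_on_imp_continuous_on continuous_on_subset by blast
  obtain z where z: "z \<in> sphere 0 r" "\<And>w. w \<in> sphere 0 r \<Longrightarrow> norm (f w) \<le> norm (f z)"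
  proof -
    have "\<exists>z\<in>sphere 0 r. \<forall>w\<in>sphere 0 r. norm (f w) \<le> norm (f z)"
      by (rule continuous_attains_sup) (use r in \<open>auto intro!: continuous_on_norm cont\<close>)
    then show ?thesis using that by blast
  qed
  have "norm (f w) \<le> norm (f z)" if "w \<in> cball 0 r" for w
  proof (rule maximum_modulus_frontier[where f=f and S="cball 0 r"])
    show "f holomorphic_on interior (cball 0 r)" using f by (rule holomorphic_on_subset) auto
  qed (use that r z cont in auto)
  then have "max_modulus r f \<le> norm (f z)"
    unfolding max_modulus_def by (intro cSUP_least) (use r in auto)
  moreover have "norm (f z) \<le> max_modulus r f"
    by (rule norm_le_max_modulus[OF f]) (use z in auto)
  ultimately show thesis using that[of z] z by auto
qed

lemma max_modulus_mono:
  assumes f: "f holomorphic_on UNIV" and "0 < r" "r \<le> s"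
  shows "max_modulus r f \<le> max_modulus s f"
proof -
  obtain z where "norm z = r" "norm (f z) = max_modulus r f"
    using max_modulus_attained[OF f \<open>0 < r\<close>] .
  then show ?thesis using norm_le_max_modulus[OF f, of z s] assms by simp
qed

lemma max_modulus_pos:
  assumes f: "f holomorphic_on UNIV" and nc: "\<not> f constant_on UNIV" and r: "r > 0"
  shows "max_modulus r f > 0"
proof (rule ccontr)
  assume "\<not> max_modulus r f > 0"
  then have 0: "f z = 0" if "z \<in> ball 0 r" for z
  proof -
    have "norm (f z) \<le> max_modulus r f" by (rule norm_le_max_modulus[OF f]) (use that in auto)
    then have "norm (f z) \<le> 0" using \<open>\<not> max_modulus r f > 0\<close> by linarith
    then show ?thesis by simp
  qed
  have "f z = 0" for z
    by (rule analytic_continuation_open[of "ball 0 r" UNIV f "\<lambda>_. 0"]) (use 0 r f in auto)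
  then show False using nc by (auto simp: constant_on_def)
qed

lemma max_modulus_unbounded:
  assumes f: "f holomorphic_on UNIV" and nc: "\<not> f constant_on UNIV"
  obtains r0 where "r0 > 0" "\<And>r. r \<ge> r0 \<Longrightarrow> max_modulus r f \<ge> b"
proof -
  have "\<not> bounded (range f)" using Liouville_theorem[OF f] nc by (auto simp: constant_on_def)
  then have "\<not> (\<forall>w\<in>range f. norm w \<le> b)" unfolding bounded_iff by blast
  then obtain z where z: "norm (f z) > b" by (auto simp: not_le)
  show thesis
  proof (rule that[of "norm z + 1"])
    show "b \<le> max_modulus r f" if "norm z + 1 \<le> r" for r
      using norm_le_max_modulus[OF f, of z r] z that by auto
  qed (simp add: add_nonneg_pos)
qed

text \<open>In the variable x = ln r, powers of r become linear and the three circles theorem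
  becomes convexity.\<close>

definition log_max_modulus :: "(complex \<Rightarrow> complex) \<Rightarrow> real \<Rightarrow> real" where
  "log_max_modulus f x = ln (max_modulus (exp x) f)"

lemma log_max_modulus_mono:
  assumes "f holomorphic_on UNIV" "\<not> f constant_on UNIV" "x \<le> y"
  shows "log_max_modulus f x \<le> log_max_modulus f y"
  unfolding log_max_modulus_def
  by (subst ln_le_cancel_iff) (use assms max_modulus_mono max_modulus_pos in auto)

lemma exp_log_max_modulus:
  assumes "f holomorphic_on UNIV" "\<not> f constant_on UNIV"
  shows "exp (log_max_modulus f x) = max_modulus (exp x) f"
  unfolding log_max_modulus_def using max_modulus_pos[OF assms] by simp

text \<open>Hadamard's three circles theorem at equally spaced radii: apply the maximum principle to
  \<open>f ^ q / z ^ p\<close>, where \<open>p / q\<close> separates the two slopes.\<close>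

lemma log_max_modulus_convex:
  assumes f: "f holomorphic_on UNIV" and nc: "\<not> f constant_on UNIV" and h: "h > 0"
  shows "log_max_modulus f x - log_max_modulus f (x - h) \<le> log_max_modulus f (x + h) - log_max_modulus f x"
proof (rule ccontr)
  let ?B = "log_max_modulus f"
  assume "\<not> ?thesis"
  then have "(?B (x + h) - ?B x) / h < (?B x - ?B (x - h)) / h"
    using h by (intro divide_strict_right_mono) auto
  \<comment> \<open>A rational separator makes \<open>f z ^ q / z ^ p\<close> single-valued, and
    monotonicity makes it positive, so that \<open>p\<close> can be a natural number. Were convexity
    to fail, the modulus of this function would be larger somewhere on the middle circle than on
    both boundary circles.\<close>
  then obtain y where y: "y \<in> \<rat>" "(?B (x + h) - ?B x) / h < y" "y < (?B x - ?B (x - h)) / h"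
    using Rats_dense_in_real by blast
  have "0 \<le> (?B (x + h) - ?B x) / h"
    using log_max_modulus_mono[OF f nc, of x "x + h"] h by simp
  then have "y > 0" using y(2) by linarith
  then obtain p q :: nat where pq: "q \<noteq> 0" "y = real p / real q"
    using Rats_abs_nat_div_natE[OF y(1)] by (metis abs_of_pos)
  have slopes: "real q * (?B (x + h) - ?B x) < real p * h" "real p * h < real q * (?B x - ?B (x - h))"
    using y(2,3) pq h by (simp_all add: field_simps)
  define g where "g z = f z ^ q / z ^ p" for z
  define m where "m = max (exp (real q * ?B (x - h) - real p * (x - h))) (exp (real q * ?B (x + h) - real p * (x + h)))"
  define S where "S = cball (0::complex) (exp (x + h)) - ball 0 (exp (x - h))"
  have S0: "0 \<notin> S" by (simp add: S_def)
  have Sclosed: "closed S" unfolding S_def by (intro closed_Diff) auto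
  have gS: "g holomorphic_on S"
    unfolding g_def[abs_def] by (intro holomorphic_intros holomorphic_on_subset[OF f]) (use S0 in auto)
  have norm_g: "norm (g z) \<le> exp (real q * ?B y - real p * y)" if "norm z = exp y" for z y
  proof -
    have "norm (f z) \<le> exp (?B y)"
      using norm_le_max_modulus[OF f, of z "exp y"] that exp_log_max_modulus[OF f nc] by simp
    then have "norm (f z) ^ q \<le> exp (?B y) ^ q" by (intro power_mono) auto
    then have "norm (g z) \<le> exp (?B y) ^ q / exp y ^ p"
      using that by (simp add: g_def norm_divide norm_power divide_right_mono)
    then show ?thesis by (simp add: exp_diff exp_of_nat_mult)
  qed
  obtain z where z: "norm z = exp x" "norm (f z) = max_modulus (exp x) f"
    using max_modulus_attained[OF f, of "exp x"] by auto
  have "norm (g z) = exp (real q * ?B x - real p * x)"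
    using z exp_log_max_modulus[OF f nc, of x]
    by (simp add: g_def norm_divide norm_power exp_diff exp_of_nat_mult)
  moreover have "norm (g z) \<le> m"
  proof (rule maximum_modulus_frontier[where f=g and S=S])
    show "g holomorphic_on interior S" using gS interior_subset by (rule holomorphic_on_subset)
    show "continuous_on (closure S) g"
      using gS Sclosed by (simp add: holomorphic_on_imp_continuous_on)
    show "bounded S" unfolding S_def by (rule bounded_subset[OF bounded_cball]) auto
    show "z \<in> S" using z h by (simp add: S_def)
    show "norm (g w) \<le> m" if w: "w \<in> frontier S" for w
    proof -
      have wS: "w \<in> S" "w \<notin> interior S" using w Sclosed by (auto simp: frontier_def)
      have "ball 0 (exp (x + h)) - cball 0 (exp (x - h)) \<subseteq> interior S"
        by (rule interior_maximal) (auto simp: S_def intro!: open_Diff)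
      then have "norm w = exp (x - h) \<or> norm w = exp (x + h)" using wS by (force simp: S_def)
      then show ?thesis using norm_g[of w "x - h"] norm_g[of w "x + h"] by (auto simp: m_def)
    qed
  qed
  ultimately have "exp (real q * ?B x - real p * x) \<le> m" by simp
  then have "real q * ?B x - real p * x \<le> real q * ?B (x - h) - real p * (x - h) \<or>
      real q * ?B x - real p * x \<le> real q * ?B (x + h) - real p * (x + h)"
    by (auto simp: m_def le_max_iff_disj)
  then show False using slopes by (auto simp: algebra_simps)
qed

section \<open>Consequences of finite and of positive order\<close>

lemma log_max_modulus_le_of_order:
  assumes "entire_order f = ereal \<rho>" "f holomorphic_on UNIV" "\<not> f constant_on UNIV"
  obtains X where "\<And>x. x \<ge> X \<Longrightarrow> log_max_modulus f x \<le> exp ((\<rho> + 1) * x)"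
proof -
  have "Limsup at_top (\<lambda>r::real. ereal (ln (ln (max_modulus r f)) / ln r)) < ereal (\<rho> + 1)"
    using assms(1) by (simp add: entire_order_def)
  then have "eventually (\<lambda>r. ereal (ln (ln (max_modulus r f)) / ln r) < ereal (\<rho> + 1)) at_top"
    by (rule Limsup_lessD)
  then obtain R where R: "\<And>r. r \<ge> R \<Longrightarrow> ln (ln (max_modulus r f)) / ln r < \<rho> + 1"
    by (auto simp: eventually_at_top_linorder)
  show thesis
  proof (rule that[of "max 1 R"])
    fix x assume x: "max 1 R \<le> x"
    then have "R \<le> exp x" using exp_ge_add_one_self[of x] by linarith
    from R[OF this] have "ln (log_max_modulus f x) < (\<rho> + 1) * x"
      using x by (simp add: log_max_modulus_def field_simps)
    then show "log_max_modulus f x \<le> exp ((\<rho> + 1) * x)"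
    \<comment> \<open>At nonpositive arguments \<open>ln\<close> carries no information, but then
      the claim is trivial.\<close>
    proof (cases "log_max_modulus f x > 0")
      case True
      then have "log_max_modulus f x = exp (ln (log_max_modulus f x))" by simp
      also have "\<dots> \<le> exp ((\<rho> + 1) * x)" using \<open>ln (log_max_modulus f x) < (\<rho> + 1) * x\<close> by simp
      finally show ?thesis .
    next
      case False
      then show ?thesis using exp_gt_zero[of "(\<rho> + 1) * x"] by linarith
    qed
  qed
qed

text \<open>Growth at most linear in ln r would force order 0; here it is enough to contradict the
  order by the bound \<rho> / 2. This is what makes slopes, and with them \<open>L\<close>,
  arbitrarily large.\<close>

lemma log_max_modulus_not_linear:
  assumes ord: "entire_order f = ereal \<rho>" and \<rho>: "\<rho> > 0"
    and f: "f holomorphic_on UNIV" and nc: "\<not> f constant_on UNIV"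
    and a: "a > 0" and b: "b > 0"
  shows "\<exists>x>0. log_max_modulus f x > a + b * x"
proof (rule ccontr)
  assume "\<not> ?thesis"
  then have lin: "log_max_modulus f x \<le> a + b * x" if "x > 0" for x
    using that by (meson not_le)
  obtain r0 where r0: "r0 > 0" "\<And>r. r \<ge> r0 \<Longrightarrow> max_modulus r f \<ge> exp 1"
    using max_modulus_unbounded[OF f nc] by blast
  \<comment> \<open>From this \<open>X\<close> on, (a + b) x \<le> (\<rho> x / 2)^2 / 2, which the
    quadratic Taylor bound puts below exp (\<rho> x / 2).\<close>
  define X where "X = max 1 (8 * (a + b) / \<rho>\<^sup>2)"
  have "ereal (ln (ln (max_modulus r f)) / ln r) \<le> ereal (\<rho> / 2)" if r: "r \<ge> max r0 (exp X)" for r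
  proof -
    define x where "x = ln r"
    have "exp X \<le> r" using r by simp
    moreover have rpos: "r > 0" using r r0 by simp
    ultimately have xX: "X \<le> x" unfolding x_def by (metis exp_gt_zero ln_exp ln_le_cancel_iff)
    then have x: "x \<ge> 1" "8 * (a + b) / \<rho>\<^sup>2 \<le> x" by (auto simp: X_def)
    have rx: "exp x = r" using rpos by (simp add: x_def)
    have "exp 1 \<le> max_modulus r f" using r0 r by simp
    moreover have "0 < max_modulus r f" using \<open>exp 1 \<le> max_modulus r f\<close> exp_gt_zero[of 1] by linarith
    ultimately have "ln (exp 1) \<le> ln (max_modulus r f)" by (subst ln_le_cancel_iff) auto
    then have pos: "log_max_modulus f x \<ge> 1" by (simp add: log_max_modulus_def rx)
    have "log_max_modulus f x \<le> a + b * x" using lin x by simp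
    also have "\<dots> \<le> (a + b) * x" using x a by (simp add: algebra_simps)
    also have "\<dots> \<le> (\<rho>\<^sup>2 / 8 * x) * x"
    proof (rule mult_right_mono)
      show "a + b \<le> \<rho>\<^sup>2 / 8 * x" using x(2) \<rho> by (simp add: field_simps)
    qed (use x in auto)
    also have "\<dots> = (\<rho> / 2 * x)\<^sup>2 / 2" by (simp add: power2_eq_square)
    also have "\<dots> \<le> exp (\<rho> / 2 * x)"
    proof -
      have "0 \<le> \<rho> / 2 * x" using x \<rho> by simp
      from exp_lower_Taylor_quadratic[OF this] this show ?thesis by linarith
    qed
    finally have "ln (log_max_modulus f x) \<le> ln (exp (\<rho> / 2 * x))"
      using pos by (subst ln_le_cancel_iff) auto
    then have "ln (log_max_modulus f x) / x \<le> \<rho> / 2" using x by (simp add: field_simps)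
    moreover have "log_max_modulus f x = ln (max_modulus r f)" by (simp add: log_max_modulus_def rx)
    ultimately show ?thesis by (simp flip: x_def)
  qed
  then have "entire_order f \<le> ereal (\<rho> / 2)"
    unfolding entire_order_def
    by (intro Limsup_bounded) (auto simp: eventually_at_top_linorder intro!: exI[of _ "max r0 (exp X)"])
  then show False using ord \<rho> by simp
qed

section \<open>Regular scales\<close>

text \<open>The product \<open>e k * e (k - 1)\<close> gains a factor \<open>exp 8\<close> at each \<open>k\<close> that is not counted,
  so its a priori bound \<open>exp (2 * k)\<close> limits their number.\<close>

lemma many_indices_of_regular_growth:
  fixes e :: "nat \<Rightarrow> real"
  assumes mono: "mono e" and one: "\<And>k. k \<ge> k0 \<Longrightarrow> e k \<ge> 1"
    and growth: "\<And>k. k \<ge> k0 \<Longrightarrow> e k \<le> exp (real k)" and n: "n \<ge> 1"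
  shows "\<exists>b\<ge>N. n \<le> 2 * card {k \<in> {n * b..<n * (b + 1)}. e (k + 1) \<le> exp 8 * e (k - 1)}"
proof (rule ccontr)
  assume contra: "\<not> ?thesis"
  define P where "P k = e k * e (k - 1)" for k
  define bad where "bad i j = {k \<in> {i..<i + j}. \<not> e (k + 1) \<le> exp 8 * e (k - 1)}" for i j
  \<comment> \<open>One more than \<open>k0\<close> because \<open>P\<close> also looks at the
    preceding index; since \<open>n \<ge> 1\<close>, blocks from \<open>b0\<close> on start late
    enough.\<close>
  define b0 where "b0 = max N (k0 + 1)"
  have step: "exp (8 * real (card (bad i j))) * P i \<le> P (i + j)" if i: "i \<ge> k0 + 1" for i j
  proof (induction j)
    case 0
    then show ?case by (simp add: bad_def)
  next
    case (Suc j)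
    have pos: "e (i + j) \<ge> 1" "e (i + j - 1) \<ge> 1" using i by (auto intro: one)
    have "e (i + j - 1) \<le> e (i + j + 1)" by (rule monoD[OF mono]) auto
    show ?case
    proof (cases "e (i + j + 1) \<le> exp 8 * e (i + j - 1)")
      case True
      then have "bad i (Suc j) = bad i j" by (auto simp: bad_def less_Suc_eq)
      moreover have "P (i + j) \<le> P (i + Suc j)"
        using \<open>e (i + j - 1) \<le> e (i + j + 1)\<close> pos by (simp add: P_def mult.commute mult_left_mono)
      ultimately show ?thesis using Suc.IH by simp
    next
      case False
      then have "bad i (Suc j) = insert (i + j) (bad i j)" by (auto simp: bad_def less_Suc_eq)
      then have "card (bad i (Suc j)) = Suc (card (bad i j))" by (simp add: bad_def)
      then have "exp (8 * real (card (bad i (Suc j)))) * P i = exp 8 * (exp (8 * real (card (bad i j))) * P i)"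
        by (simp add: exp_add distrib_left)
      also have "\<dots> \<le> exp 8 * P (i + j)" using Suc.IH by simp
      also have "\<dots> = e (i + j) * (exp 8 * e (i + j - 1))" by (simp add: P_def)
      also have "\<dots> \<le> e (i + j) * e (i + j + 1)" using False pos by (intro mult_left_mono) auto
      also have "\<dots> = P (i + Suc j)" by (simp add: P_def mult.commute)
      finally show ?thesis .
    qed
  qed
  \<comment> \<open>At least half of the block is not counted, so it multiplies \<open>P\<close> by
    at least exp (8 n / 2).\<close>
  have block: "exp (4 * real n) * P (n * b) \<le> P (n * (b + 1))" if b: "b \<ge> b0" for b
  proof -
    define good where "good = {k \<in> {n * b..<n * (b + 1)}. e (k + 1) \<le> exp 8 * e (k - 1)}"
    have "good \<union> bad (n * b) n = {n * b..<n * (b + 1)}" "good \<inter> bad (n * b) n = {}"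
      by (auto simp: good_def bad_def)
    then have "card good + card (bad (n * b) n) = n"
      using card_Un_disjoint[of good "bad (n * b) n"] by (simp add: good_def bad_def)
    moreover have "\<not> n \<le> 2 * card good" using contra b unfolding good_def b0_def by auto
    ultimately have "n \<le> 2 * card (bad (n * b) n)" by linarith
    then have "4 * real n \<le> 8 * real (card (bad (n * b) n))" by linarith
    moreover have nb: "n * b \<ge> k0 + 1"
    proof -
      have "k0 + 1 \<le> 1 * b" using b by (simp add: b0_def)
      also have "\<dots> \<le> n * b" using n by (intro mult_right_mono) auto
      finally show ?thesis .
    qed
    moreover have "P (n * b) \<ge> 0"
    proof -
      have "e (n * b) \<ge> 1" "e (n * b - 1) \<ge> 1" using nb by (auto intro: one)
      then show ?thesis by (simp add: P_def)
    qed
    ultimately have "exp (4 * real n) * P (n * b) \<le> exp (8 * real (card (bad (n * b) n))) * P (n * b)"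
      by (intro mult_right_mono) auto
    also have "\<dots> \<le> P (n * b + n)" by (rule step[OF nb])
    finally show ?thesis by (simp add: algebra_simps)
  qed
  have b0n: "k0 + 1 \<le> n * b" if "b0 \<le> b" for b
  proof -
    have "k0 + 1 \<le> 1 * b" using that by (simp add: b0_def)
    also have "\<dots> \<le> n * b" using n by (intro mult_right_mono) auto
    finally show ?thesis .
  qed
  have lower: "exp (4 * real n * real j) \<le> P (n * (b0 + j))" for j
  proof (induction j)
    case 0
    have "1 * 1 \<le> e (n * b0) * e (n * b0 - 1)"
      by (intro mult_mono one) (use b0n[of b0] one[of "n * b0"] in auto)
    then show ?case by (simp add: P_def)
  next
    case (Suc j)
    have "exp (4 * real n * real (Suc j)) = exp (4 * real n) * exp (4 * real n * real j)"
      by (simp add: exp_add distrib_left)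
    also have "\<dots> \<le> exp (4 * real n) * P (n * (b0 + j))" using Suc by simp
    also have "\<dots> \<le> P (n * (b0 + Suc j))" using block[of "b0 + j"] by simp
    finally show ?case .
  qed
  \<comment> \<open>At this block the rate 4, counted from \<open>b0\<close>, has overtaken the a
    priori rate 2, counted from 0: 4 (b0 + 1) > 2 (2 b0 + 1).\<close>
  define b where "b = b0 + (b0 + 1)"
  have "exp (4 * real n * real (b0 + 1)) \<le> P (n * b)" using lower[of "b0 + 1"] by (simp add: b_def)
  also have "P (n * b) \<le> exp (real (n * b)) * exp (real (n * b))"
  proof -
    have nb: "k0 + 1 \<le> n * b" by (rule b0n) (simp add: b_def)
    have "e (n * b - 1) \<le> e (n * b)" by (rule monoD[OF mono]) simp
    moreover have "e (n * b) \<le> exp (real (n * b))" using nb by (intro growth) simp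
    ultimately have "e (n * b - 1) \<le> exp (real (n * b))" "e (n * b) \<le> exp (real (n * b))" by linarith+
    moreover have "e (n * b - 1) \<ge> 1" using nb by (intro one) simp
    ultimately show ?thesis unfolding P_def by (intro mult_mono) auto
  qed
  also have "\<dots> = exp (2 * real n * real b)" by (simp flip: exp_add)
  finally have "4 * real n * real (b0 + 1) \<le> 2 * real n * real b" by simp
  then have "real n * (4 * real (b0 + 1)) \<le> real n * (2 * real b)" by (simp add: algebra_simps)
  then have "4 * real (b0 + 1) \<le> 2 * real b" using n by simp
  then show False by (simp add: b_def)
qed

text \<open>The local estimate for f (s \<zeta> + z) / f z with s = h |z|. Relative moduli 1 + 24 h
  and 1 - 2 h are compared with the exponentials through 1 + x \<le> exp x; h \<le> 1 / 3 keeps 1 -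
  3 h nonnegative.\<close>

lemma scale_estimate:
  fixes c :: real
  assumes c: "c > 0"
  obtains \<kappa> L0 :: real where "\<kappa> > 0" "L0 > 0"
    "\<And>f L z h \<theta>1 \<theta>2. f holomorphic_on UNIV \<Longrightarrow> f z \<noteq> 0 \<Longrightarrow> z \<noteq> 0 \<Longrightarrow> 0 < h \<Longrightarrow> h \<le> 1 / 3 \<Longrightarrow> L0 \<le> L \<Longrightarrow>
      max_modulus (norm z * exp (24 * h)) f \<le> exp L * norm (f z) \<Longrightarrow>
      max_modulus (norm z * exp (- h)) f \<le> exp (- c * L) * norm (f z) \<Longrightarrow>
      \<theta>1 < \<theta>2 \<Longrightarrow> \<theta>2 - \<theta>1 \<le> 2 * pi \<Longrightarrow>
      ennreal (\<kappa> * (\<theta>2 - \<theta>1) * (h * norm z)\<^sup>2) \<le> emeasure lebesgue (f -` sector \<theta>1 \<theta>2 \<inter> ball z (5 * (h * norm z)))"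
proof -
  obtain \<kappa> L0 where \<kappa>: "\<kappa> > 0" "L0 > 0" and est:
    "\<And>\<phi> L p \<theta>1 \<theta>2. \<phi> holomorphic_on UNIV \<Longrightarrow> norm (\<phi> 0) = 1 \<Longrightarrow> L0 \<le> L \<Longrightarrow>
      (\<And>z. norm z \<le> 24 \<Longrightarrow> norm (\<phi> z) \<le> exp L) \<Longrightarrow> norm p \<le> 3 \<Longrightarrow>
      (\<And>z. z \<in> ball p 1 \<Longrightarrow> norm (\<phi> z) \<le> exp (- c * L)) \<Longrightarrow> \<theta>1 < \<theta>2 \<Longrightarrow> \<theta>2 - \<theta>1 \<le> 2 * pi \<Longrightarrow>
      ennreal (\<kappa> * (\<theta>2 - \<theta>1)) \<le> emeasure lborel (\<phi> -` sector \<theta>1 \<theta>2 \<inter> ball 0 5)"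
    using local_estimate[OF c] by blast
  show thesis
  proof (rule that[of \<kappa> L0])
    fix f :: "complex \<Rightarrow> complex" and L z h \<theta>1 \<theta>2
    assume f: "f holomorphic_on UNIV" and fz: "f z \<noteq> 0" and z: "z \<noteq> 0" and h: "0 < h" "h \<le> 1 / 3" and L: "L0 \<le> L"
      and up: "max_modulus (norm z * exp (24 * h)) f \<le> exp L * norm (f z)"
      and lo: "max_modulus (norm z * exp (- h)) f \<le> exp (- c * L) * norm (f z)"
      and \<alpha>: "\<theta>1 < \<theta>2" "\<theta>2 - \<theta>1 \<le> 2 * pi"
    define s where "s = h * norm z"
    have s: "s > 0" using h z by (simp add: s_def)
    define \<phi> where "\<phi> \<zeta> = f (of_real s * \<zeta> + z) / f z" for \<zeta>
    have "(f \<circ> (\<lambda>\<zeta>. of_real s * \<zeta> + z)) holomorphic_on UNIV"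
      by (rule holomorphic_on_compose_gen[OF _ f]) (auto intro: holomorphic_intros)
    then have \<phi>: "\<phi> holomorphic_on UNIV"
      unfolding \<phi>_def[abs_def] o_def by (rule holomorphic_on_divide) (use fz in auto)
    define \<beta> where "\<beta> = Arg (f z)"
    have arg: "is_Arg (f z) \<beta>" by (simp add: \<beta>_def is_Arg_Arg fz)
    \<comment> \<open>Three units straight towards the origin: the unit disc about \<open>p\<close>
      corresponds to points of modulus at most |z| (1 - 2 h).\<close>
    define p where "p = - (3 * z / of_real (norm z))"
    have sp: "of_real s * p + z = of_real (1 - 3 * h) * z"
      using z by (simp add: s_def p_def algebra_simps)
    have "ennreal (\<kappa> * ((\<theta>2 - \<beta>) - (\<theta>1 - \<beta>))) \<le> emeasure lborel (\<phi> -` sector (\<theta>1 - \<beta>) (\<theta>2 - \<beta>) \<inter> ball 0 5)"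
    proof (rule est[OF \<phi> _ L])
      show "norm (\<phi> 0) = 1" using fz by (simp add: \<phi>_def)
      show "norm p \<le> 3" using z by (simp add: p_def norm_divide norm_mult)
      show "norm (\<phi> \<zeta>) \<le> exp L" if "norm \<zeta> \<le> 24" for \<zeta>
      proof -
        have "norm (of_real s * \<zeta> + z) \<le> s * norm \<zeta> + norm z"
          using norm_triangle_ineq[of "of_real s * \<zeta>" z] s by (simp add: norm_mult)
        also have "\<dots> \<le> s * 24 + norm z" using that s by simp
        also have "\<dots> = norm z * (1 + 24 * h)" by (simp add: s_def algebra_simps)
        also have "\<dots> \<le> norm z * exp (24 * h)" by (intro mult_left_mono exp_ge_add_one_self) auto
        finally have "norm (f (of_real s * \<zeta> + z)) \<le> max_modulus (norm z * exp (24 * h)) f"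
          by (rule norm_le_max_modulus[OF f])
        then show ?thesis using up fz by (simp add: \<phi>_def norm_divide field_simps)
      qed
      show "norm (\<phi> \<zeta>) \<le> exp (- c * L)" if "\<zeta> \<in> ball p 1" for \<zeta>
      proof -
        have "norm (\<zeta> - p) \<le> 1" using that by (simp add: dist_norm norm_minus_commute)
        have "of_real s * \<zeta> + z = of_real s * (\<zeta> - p) + of_real (1 - 3 * h) * z"
          unfolding sp[symmetric] by (simp add: algebra_simps)
        then have "norm (of_real s * \<zeta> + z) \<le> norm (of_real s * (\<zeta> - p)) + norm (of_real (1 - 3 * h) * z)"
          by (metis norm_triangle_ineq)
        also have "\<dots> = s * norm (\<zeta> - p) + (1 - 3 * h) * norm z"
          unfolding norm_mult norm_of_real using s h by simp
        also have "\<dots> \<le> s * 1 + (1 - 3 * h) * norm z"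
          using \<open>norm (\<zeta> - p) \<le> 1\<close> s by (intro add_right_mono mult_left_mono) auto
        also have "\<dots> = norm z * (1 - 2 * h)" by (simp add: s_def algebra_simps)
        also have "\<dots> \<le> norm z * exp (- h)"
          using exp_ge_add_one_self[of "- h"] h by (intro mult_left_mono) auto
        finally have "norm (f (of_real s * \<zeta> + z)) \<le> max_modulus (norm z * exp (- h)) f"
          by (rule norm_le_max_modulus[OF f])
        then show ?thesis using lo fz by (simp add: \<phi>_def norm_divide field_simps)
      qed
    qed (use \<alpha> in auto)
    also have "\<dots> = emeasure lebesgue (\<phi> -` sector (\<theta>1 - \<beta>) (\<theta>2 - \<beta>) \<inter> ball 0 5)"
    proof -
      have "continuous_on UNIV \<phi>" using \<phi> by (rule holomorphic_on_imp_continuous_on)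
      then have "open (\<phi> -` sector (\<theta>1 - \<beta>) (\<theta>2 - \<beta>))" by (intro open_vimage open_sector)
      then show ?thesis by (subst emeasure_completion) auto
    qed
    finally have "ennreal (s\<^sup>2) * ennreal (\<kappa> * (\<theta>2 - \<theta>1)) \<le>
        ennreal (s\<^sup>2) * emeasure lebesgue (\<phi> -` sector (\<theta>1 - \<beta>) (\<theta>2 - \<beta>) \<inter> ball 0 5)"
      by (intro mult_left_mono) auto
    also have "\<dots> = emeasure lebesgue ((\<lambda>\<zeta>. s *\<^sub>R \<zeta> + z) ` (\<phi> -` sector (\<theta>1 - \<beta>) (\<theta>2 - \<beta>) \<inter> ball 0 5))"
      using s by (simp add: emeasure_lebesgue_affine ennreal_power)
    also have "\<dots> \<le> emeasure lebesgue (f -` sector \<theta>1 \<theta>2 \<inter> ball z (5 * s))"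
    proof (rule emeasure_mono)
      show "(\<lambda>\<zeta>. s *\<^sub>R \<zeta> + z) ` (\<phi> -` sector (\<theta>1 - \<beta>) (\<theta>2 - \<beta>) \<inter> ball 0 5) \<subseteq> f -` sector \<theta>1 \<theta>2 \<inter> ball z (5 * s)"
      proof (rule image_subsetI)
        fix \<zeta> assume a: "\<zeta> \<in> \<phi> -` sector (\<theta>1 - \<beta>) (\<theta>2 - \<beta>) \<inter> ball 0 5"
        have "\<phi> \<zeta> * f z \<in> sector \<theta>1 \<theta>2" using mult_in_sector[OF _ arg fz] a by simp
        then have "f (s *\<^sub>R \<zeta> + z) \<in> sector \<theta>1 \<theta>2" using fz by (simp add: \<phi>_def scaleR_conv_of_real)
        moreover have "dist z (s *\<^sub>R \<zeta> + z) = s * norm \<zeta>" using s by (simp add: dist_norm)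
        ultimately show "s *\<^sub>R \<zeta> + z \<in> f -` sector \<theta>1 \<theta>2 \<inter> ball z (5 * s)" using a s by simp
      qed
      have "open (f -` sector \<theta>1 \<theta>2)"
        by (intro open_vimage open_sector holomorphic_on_imp_continuous_on f)
      then show "f -` sector \<theta>1 \<theta>2 \<inter> ball z (5 * s) \<in> sets lebesgue" by auto
    qed
    finally show "ennreal (\<kappa> * (\<theta>2 - \<theta>1) * (h * norm z)\<^sup>2) \<le>
        emeasure lebesgue (f -` sector \<theta>1 \<theta>2 \<inter> ball z (5 * (h * norm z)))"
      using s \<kappa> \<alpha> by (simp add: s_def mult_ac flip: ennreal_mult)
  qed (use \<kappa> in auto)
qed

section \<open>Disjoint discs and their total relative area\<close>

lemma exp_minus_ge_third: "exp (- 1 :: real) \<ge> 1 / 3"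
  using exp_le by (simp add: exp_minus field_simps)

text \<open>The discs have relative radius 5 h and the annuli logarithmic half-width 20 h, so discs
  with different indices cannot meet. The spacing 40 also exceeds the 24 of
  \<open>scale_estimate\<close>, so that the outer radius needed there stays below the next
  centre.\<close>

lemma ball_subset_annulus:
  fixes z :: complex
  assumes z: "norm z = exp (40 * real k * h)" and h: "0 < h" "h \<le> 1 / 100"
    and w: "w \<in> ball z (5 * (h * norm z))"
  shows "exp ((40 * real k - 20) * h) < norm w" "norm w < exp ((40 * real k + 20) * h)"
proof -
  have d: "norm (w - z) < 5 * (h * norm z)" using w by (simp add: dist_norm norm_minus_commute)
  have zp: "norm z > 0" using z by simp
  have "norm w < norm z + 5 * (h * norm z)" using norm_triangle_sub[of w z] d by linarith
  also have "\<dots> = norm z * (1 + 5 * h)" by (simp add: algebra_simps)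
  also have "\<dots> \<le> norm z * exp (20 * h)"
  proof (rule mult_left_mono)
    show "1 + 5 * h \<le> exp (20 * h)" using exp_ge_add_one_self[of "20 * h"] h by linarith
  qed simp
  also have "\<dots> = exp ((40 * real k + 20) * h)" by (simp add: z algebra_simps flip: exp_add)
  finally show "norm w < exp ((40 * real k + 20) * h)" .
  have "exp (20 * h) * (1 - 5 * h) \<ge> 1"
  proof -
    have "1 \<le> 1 + (15 * h - 100 * (h * h))"
    proof -
      have "100 * (h * h) \<le> 15 * h" using h mult_right_mono[OF h(2), of "100 * h"] by linarith
      then show ?thesis by simp
    qed
    also have "\<dots> = (1 + 20 * h) * (1 - 5 * h)" by (simp add: algebra_simps)
    also have "\<dots> \<le> exp (20 * h) * (1 - 5 * h)" using h by (intro mult_right_mono exp_ge_add_one_self) auto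
    finally show ?thesis .
  qed
  then have "exp (- (20 * h)) \<le> 1 - 5 * h" by (simp add: exp_minus field_simps)
  then have "norm z * exp (- (20 * h)) \<le> norm z * (1 - 5 * h)" using zp by simp
  also have "\<dots> = norm z - 5 * (h * norm z)" by (simp add: algebra_simps)
  also have "\<dots> < norm w" using norm_triangle_sub[of z w] d by (simp add: norm_minus_commute)
  finally have "norm z * exp (- (20 * h)) < norm w" .
  then show "exp ((40 * real k - 20) * h) < norm w"
    by (simp add: z algebra_simps flip: exp_add)
qed

lemma disjoint_annulus_balls:
  fixes z :: "nat \<Rightarrow> complex"
  assumes z: "\<And>k. norm (z k) = exp (40 * real k * h)" and h: "0 < h" "h \<le> 1 / 100"
  shows "disjoint_family (\<lambda>k. ball (z k) (5 * (h * norm (z k))))"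
proof -
  have *: "ball (z j) (5 * (h * norm (z j))) \<inter> ball (z k) (5 * (h * norm (z k))) = {}" if "j < k" for j k
  proof (rule ccontr)
    assume "\<not> ?thesis"
    then obtain w where "w \<in> ball (z j) (5 * (h * norm (z j)))" "w \<in> ball (z k) (5 * (h * norm (z k)))" by auto
    then have "exp ((40 * real k - 20) * h) < exp ((40 * real j + 20) * h)"
      using ball_subset_annulus(1)[OF z h, of w k] ball_subset_annulus(2)[OF z h, of w j] by linarith
    then have "40 * real k - 20 < 40 * real j + 20" using h by simp
    moreover have "real j + 1 \<le> real k" using that by linarith
    ultimately show False by linarith
  qed
  show ?thesis unfolding disjoint_family_on_def
  proof (intro ballI impI)
    fix j k :: nat assume "j \<noteq> k"
    then consider "j < k" | "k < j" by linarith
    then show "ball (z j) (5 * (h * norm (z j))) \<inter> ball (z k) (5 * (h * norm (z k))) = {}"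
      using *[of j k] *[of k j] by cases (auto simp: Int_commute)
  qed
qed

text \<open>The block spans a factor exp (40 h n) \<le> exp 1 \<le> 3 of radii, so every centre has
  modulus at least r / 3; this is the source of the 9.\<close>

lemma relative_area_ge:
  assumes h: "0 < h" "h \<le> 1 / 100" and f: "f holomorphic_on UNIV"
    and z: "\<And>k. norm (z k) = exp (40 * real k * h)"
    and I: "finite I" "\<And>k. k \<in> I \<Longrightarrow> m \<le> k \<and> k < m + n" and hn: "40 * h * real n \<le> 1"
    and \<kappa>: "\<kappa> \<ge> 0"
    and area: "\<And>k. k \<in> I \<Longrightarrow> ennreal (\<kappa> * (h * norm (z k))\<^sup>2) \<le>
      emeasure lebesgue (f -` sector \<theta>1 \<theta>2 \<inter> ball (z k) (5 * (h * norm (z k))))"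
  shows "real (card I) * \<kappa> * h\<^sup>2 / (9 * pi) \<le> relative_area (exp (40 * h * real (m + n))) (sector \<theta>1 \<theta>2) f"
proof -
  define r where "r = exp (40 * h * real (m + n))"
  define T where "T k = f -` sector \<theta>1 \<theta>2 \<inter> ball (z k) (5 * (h * norm (z k)))" for k
  have op: "open (f -` sector \<theta>1 \<theta>2)"
    by (intro open_vimage open_sector holomorphic_on_imp_continuous_on f)
  have meas: "T k \<in> sets lebesgue" for k unfolding T_def using op by auto
  have sub: "T k \<subseteq> f -` sector \<theta>1 \<theta>2 \<inter> ball 0 r" if "k \<in> I" for k
  proof
    fix w assume w: "w \<in> T k"
    then have "norm w < exp ((40 * real k + 20) * h)"
      using ball_subset_annulus(2)[OF z h] by (auto simp: T_def)
    also have "\<dots> \<le> r"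
    proof -
      have "real k + 1 \<le> real (m + n)" using I(2)[OF that] by linarith
      then have "(40 * real k + 20) * h \<le> (40 * real (m + n)) * h" using h by (intro mult_right_mono) auto
      then show ?thesis by (simp add: r_def mult_ac)
    qed
    finally show "w \<in> f -` sector \<theta>1 \<theta>2 \<inter> ball 0 r" using w by (simp add: T_def)
  qed
  have zr: "(r / 3)\<^sup>2 \<le> (norm (z k))\<^sup>2" if "k \<in> I" for k
  proof (rule power_mono)
    have "r / 3 \<le> r * exp (- 1)" using exp_minus_ge_third by (simp add: r_def)
    also have "\<dots> = exp (40 * h * real m + (40 * h * real n - 1))"
      by (simp add: r_def algebra_simps flip: exp_add)
    also have "\<dots> \<le> exp (40 * real k * h)"
    proof -
      have "real m \<le> real k" using I(2)[OF that] by simp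
      then have "40 * h * real m \<le> 40 * h * real k" using h by (intro mult_left_mono) auto
      then show ?thesis using hn by (simp add: mult_ac)
    qed
    finally show "r / 3 \<le> norm (z k)" by (simp add: z)
  qed (simp add: r_def)
  have "ennreal (real (card I) * (\<kappa> * (h\<^sup>2 * (r / 3)\<^sup>2))) = (\<Sum>k\<in>I. ennreal (\<kappa> * (h\<^sup>2 * (r / 3)\<^sup>2)))"
    using \<kappa> by (simp add: ennreal_mult ennreal_of_nat_eq_real_of_nat)
  also have "\<dots> \<le> (\<Sum>k\<in>I. emeasure lebesgue (T k))"
  proof (rule sum_mono)
    fix k assume k: "k \<in> I"
    have "\<kappa> * (h\<^sup>2 * (r / 3)\<^sup>2) \<le> \<kappa> * (h * norm (z k))\<^sup>2"
      unfolding power_mult_distrib[of h] using zr[OF k] \<kappa> by (intro mult_left_mono) auto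
    then show "ennreal (\<kappa> * (h\<^sup>2 * (r / 3)\<^sup>2)) \<le> emeasure lebesgue (T k)"
      using area[OF k] unfolding T_def by (meson ennreal_leI order.trans)
  qed
  also have "\<dots> = emeasure lebesgue (\<Union>k\<in>I. T k)"
  proof (rule sum_emeasure)
    show "disjoint_family_on T I"
      using disjoint_annulus_balls[of z h, OF z h] by (fastforce simp: disjoint_family_on_def T_def)
  qed (use meas I in auto)
  also have "\<dots> \<le> emeasure lebesgue (f -` sector \<theta>1 \<theta>2 \<inter> ball 0 r)"
    by (rule emeasure_mono) (use sub op in auto)
  also have "\<dots> = ennreal (measure lebesgue (f -` sector \<theta>1 \<theta>2 \<inter> ball 0 r))"
  proof (rule emeasure_eq_ennreal_measure)
    have "emeasure lebesgue (f -` sector \<theta>1 \<theta>2 \<inter> ball 0 r) \<le> emeasure lebesgue (ball (0::complex) r)"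
      by (rule emeasure_mono) auto
    also have "\<dots> < \<infinity>" by (subst emeasure_completion) (auto simp: emeasure_ball r_def)
    finally show "emeasure lebesgue (f -` sector \<theta>1 \<theta>2 \<inter> ball 0 r) \<noteq> top" by simp
  qed
  finally have *: "real (card I) * (\<kappa> * (h\<^sup>2 * (r / 3)\<^sup>2)) \<le> measure lebesgue (f -` sector \<theta>1 \<theta>2 \<inter> ball 0 r)"
    by (simp add: ennreal_le_iff)
  have ball: "measure lebesgue (ball (0::complex) r) = pi * r\<^sup>2"
    by (simp add: content_ball unit_ball_vol_2 r_def)
  have "real (card I) * \<kappa> * h\<^sup>2 / (9 * pi) = real (card I) * (\<kappa> * (h\<^sup>2 * (r / 3)\<^sup>2)) / (pi * r\<^sup>2)"
    by (simp add: field_simps r_def)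
  also have "\<dots> \<le> relative_area r (sector \<theta>1 \<theta>2) f"
    unfolding relative_area_def ball by (rule divide_right_mono[OF *]) simp
  finally show ?thesis by (simp add: r_def)
qed

lemma asymp_equiv_inverse_shift:
  fixes C :: real
  assumes "C \<noteq> 0"
  shows "(\<lambda>x. C / (x + 1)) \<sim>[at_top] (\<lambda>x. C * inverse x)"
proof (rule asymp_equivI')
  have "((\<lambda>x::real. 1 - inverse (1 + x)) \<longlongrightarrow> 1 - 0) at_top"
    by (intro tendsto_diff tendsto_const tendsto_inverse_0_at_top
          filterlim_tendsto_add_at_top[OF tendsto_const filterlim_ident])
  then have "((\<lambda>x::real. 1 - inverse (1 + x)) \<longlongrightarrow> 1) at_top" by simp
  moreover have "eventually (\<lambda>x. 1 - inverse (1 + x) = C / (x + 1) / (C * inverse x)) at_top"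
    using eventually_gt_at_top[of 0]
  proof eventually_elim
    case (elim x)
    have "C / (x + 1) / (C * inverse x) = x / (x + 1)" using assms by (simp add: divide_inverse)
    also have "\<dots> = 1 - inverse (1 + x)" using elim by (simp add: field_simps)
    finally show ?case by simp
  qed
  ultimately show "((\<lambda>x. C / (x + 1) / (C * inverse x)) \<longlongrightarrow> 1) at_top"
    by (rule Lim_transform_eventually)
qed

text \<open>\<open>d\<close> is the increment of ln M over one step \<open>h\<close>, nondecreasing
  by convexity, and \<open>e\<close> samples it every 40 steps. At a counted index, 40 steps forward
  raise ln M by at most 40 e (k + 1) = L k, while one step backward lowers it by at least e (k - 1)
  \<ge> exp (-8) e (k + 1); hence the ratio 1 / (40 exp 8).\<close>

lemma regular_scales:
  fixes f :: "complex \<Rightarrow> complex" and \<rho> L0 h :: real and n :: nat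
  assumes f: "f holomorphic_on UNIV" and nc: "\<not> f constant_on UNIV"
    and \<rho>: "\<rho> > 0" and ord: "entire_order f = ereal \<rho>"
    and h: "h = 1 / (100 * (\<rho> + 1))" and n: "n \<ge> 1"
  defines "lm \<equiv> log_max_modulus f"
  shows "\<exists>b\<ge>N. \<exists>I L. I \<subseteq> {n * b..<n * (b + 1)} \<and> n \<le> 2 * card I \<and>
    (\<forall>k\<in>I. L0 \<le> L k \<and> lm ((40 * real k + 24) * h) \<le> lm (40 * real k * h) + L k \<and>
      lm ((40 * real k - 1) * h) \<le> lm (40 * real k * h) - L k / (40 * exp 8))"
proof -
  have h0: "h > 0" using h \<rho> by simp
  have hh: "(\<rho> + 1) * h = 1 / 100" using h \<rho> by (simp add: field_simps)
  have lm_mono: "lm x \<le> lm y" if "x \<le> y" for x y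
    unfolding lm_def by (rule log_max_modulus_mono[OF f nc that])
  define d where "d i = lm (real (Suc i) * h) - lm (real i * h)" for i
  have "mono d"
  proof (rule incseq_SucI)
    fix i
    have "real (Suc i) * h - h = real i * h" "real (Suc i) * h + h = real (Suc (Suc i)) * h"
      by (simp_all add: algebra_simps)
    then show "d i \<le> d (Suc i)"
      using log_max_modulus_convex[OF f nc h0, of "real (Suc i) * h"] by (simp add: d_def lm_def)
  qed
  have sum_up: "lm (real (i + j) * h) \<le> lm (real i * h) + real j * d (i + j)" for i j
  proof (induction j)
    case (Suc j)
    have "d (i + j) \<le> d (i + Suc j)" by (rule monoD[OF \<open>mono d\<close>]) simp
    then have "real j * d (i + j) \<le> real j * d (i + Suc j)" by (rule mult_left_mono) simp
    moreover have "lm (real (i + Suc j) * h) = lm (real (i + j) * h) + d (i + j)" by (simp add: d_def)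
    ultimately have "lm (real (i + Suc j) * h) \<le> lm (real i * h) + (real j * d (i + Suc j) + d (i + Suc j))"
      using Suc \<open>d (i + j) \<le> d (i + Suc j)\<close> by linarith
    then show ?case by (simp add: algebra_simps)
  qed simp
  \<comment> \<open>Increments bounded by \<open>D\<close> would make \<open>lm\<close> grow at most
    linearly.\<close>
  have "\<exists>i. d i > D" if D: "D \<ge> 0" for D
  proof (rule ccontr)
    assume "\<nexists>i. d i > D"
    then have le: "d i \<le> D" for i by (meson not_le)
    obtain x where x: "x > 0" "lm x > (\<bar>lm 0\<bar> + D + 1) + (D / h + 1) * x"
      using log_max_modulus_not_linear[OF ord \<rho> f nc, of "\<bar>lm 0\<bar> + D + 1" "D / h + 1"] D h0
      by (auto simp: lm_def add_nonneg_pos)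
    define i where "i = nat \<lceil>x / h\<rceil>"
    have xi: "x / h \<le> real i" "real i \<le> x / h + 1"
    proof -
      have "0 \<le> x / h" using x h0 by simp
      then have "real i = of_int \<lceil>x / h\<rceil>" by (simp add: i_def)
      then show "x / h \<le> real i" "real i \<le> x / h + 1" using ceiling_correct[of "x / h"] by linarith+
    qed
    have "lm x \<le> lm (real i * h)" using xi h0 by (intro lm_mono) (simp add: field_simps)
    also have "\<dots> \<le> lm 0 + real i * d i" using sum_up[of 0 i] by simp
    also have "\<dots> \<le> lm 0 + (x / h + 1) * D"
    proof -
      have "real i * d i \<le> real i * D" using le by (intro mult_left_mono) auto
      also have "\<dots> \<le> (x / h + 1) * D" using xi D by (intro mult_right_mono) auto
      finally show ?thesis by simp
    qed
    also have "\<dots> \<le> (\<bar>lm 0\<bar> + D + 1) + (D / h + 1) * x" using x by (simp add: algebra_simps)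
    finally show False using x by linarith
  qed
  then obtain i0 where i0: "d i0 > max 1 L0" by (meson max.cobounded1 order.trans zero_le_one)
  obtain r0 where r0: "r0 > 0" "\<And>r. r \<ge> r0 \<Longrightarrow> max_modulus r f \<ge> 1"
    using max_modulus_unbounded[OF f nc] by blast
  obtain X where X: "\<And>x. x \<ge> X \<Longrightarrow> lm x \<le> exp ((\<rho> + 1) * x)"
    using log_max_modulus_le_of_order[OF ord f nc] unfolding lm_def by blast
  \<comment> \<open>From \<open>k0\<close> on, \<open>e\<close> exceeds 1 and \<open>L0\<close>, the
    maximum modulus at exp (40 k h) is at least 1 and the order bound applies; k \<ge> 1 allows (40
    k + 1) / 100 \<le> k.\<close>
  define k0 where "k0 = max (max 1 i0) (nat \<lceil>(\<bar>X\<bar> + r0) / (40 * h)\<rceil>)"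
  define e where "e k = d (40 * k)" for k
  have e_mono: "mono e"
    unfolding e_def by (intro monoI monoD[OF \<open>mono d\<close>]) simp
  have e_ge: "e k \<ge> 1" "e k \<ge> L0" if "k \<ge> k0" for k
  proof -
    have "d i0 \<le> e k" unfolding e_def by (rule monoD[OF \<open>mono d\<close>]) (use that in \<open>simp add: k0_def\<close>)
    then show "e k \<ge> 1" "e k \<ge> L0" using i0 by auto
  qed
  have growth: "e k \<le> exp (real k)" if k: "k \<ge> k0" for k
  proof -
    have k1: "k \<ge> 1" using k by (simp add: k0_def)
    have "(\<bar>X\<bar> + r0) / (40 * h) \<le> real k"
      using k unfolding k0_def by (metis le_nat_iff max.bounded_iff nat_ceiling_le_eq nat_le_iff of_nat_le_iff order.trans real_nat_ceiling_ge)
    then have big: "\<bar>X\<bar> + r0 \<le> real (40 * k) * h" using h0 by (simp add: field_simps)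
    then have "r0 \<le> real (40 * k) * h" "X \<le> real (40 * k) * h" using r0 by linarith+
    have "r0 \<le> exp (real (40 * k) * h)"
      using exp_ge_add_one_self[of "real (40 * k) * h"] \<open>r0 \<le> real (40 * k) * h\<close> by linarith
    then have "lm (real (40 * k) * h) \<ge> 0"
      unfolding lm_def log_max_modulus_def by (intro ln_ge_zero r0(2))
    then have "e k \<le> lm (real (Suc (40 * k)) * h)" by (simp add: e_def d_def)
    also have "\<dots> \<le> exp ((\<rho> + 1) * (real (Suc (40 * k)) * h))"
      using \<open>X \<le> real (40 * k) * h\<close> h0 by (intro X) (simp add: algebra_simps)
    \<comment> \<open>The purpose of the choice of \<open>h\<close>: the exponent grows by 40 / 100
      < 1 per index, uniformly in \<rho>.\<close>
    also have "(\<rho> + 1) * (real (Suc (40 * k)) * h) = real (Suc (40 * k)) * ((\<rho> + 1) * h)" by simp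
    also have "\<dots> = real (Suc (40 * k)) / 100" unfolding hh by simp
    also have "exp \<dots> \<le> exp (real k)" using k1 by simp
    finally show ?thesis .
  qed
  obtain b where b: "b \<ge> max N (k0 + 1)"
    and card: "n \<le> 2 * card {k \<in> {n * b..<n * (b + 1)}. e (k + 1) \<le> exp 8 * e (k - 1)}"
    using many_indices_of_regular_growth[of e k0 n "max N (k0 + 1)", OF e_mono e_ge(1) growth n]
    by blast
  define I where "I = {k \<in> {n * b..<n * (b + 1)}. e (k + 1) \<le> exp 8 * e (k - 1)}"
  define L where "L k = 40 * e (k + 1)" for k
  have "L0 \<le> L k \<and> lm ((40 * real k + 24) * h) \<le> lm (40 * real k * h) + L k \<and>
      lm ((40 * real k - 1) * h) \<le> lm (40 * real k * h) - L k / (40 * exp 8)" if k: "k \<in> I" for k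
  proof -
    have "k0 + 1 \<le> 1 * b" using b by simp
    also have "\<dots> \<le> n * b" using n by (intro mult_right_mono) auto
    also have "\<dots> \<le> k" using k by (simp add: I_def)
    finally have kk: "k0 + 1 \<le> k" .
    have "L0 \<le> L k" using e_ge[of "k + 1"] kk by (simp add: L_def)
    moreover have "lm ((40 * real k + 24) * h) \<le> lm (40 * real k * h) + L k"
    proof -
      have "lm ((40 * real k + 24) * h) \<le> lm (real (40 * k + 40) * h)"
        using h0 by (intro lm_mono mult_right_mono) auto
      also have "\<dots> \<le> lm (real (40 * k) * h) + real 40 * d (40 * k + 40)" by (rule sum_up)
      also have "d (40 * k + 40) = e (k + 1)" by (simp add: e_def algebra_simps)
      finally show ?thesis by (simp add: L_def)
    qed
    moreover have "lm ((40 * real k - 1) * h) \<le> lm (40 * real k * h) - L k / (40 * exp 8)"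
    proof -
      have "Suc (40 * k - 1) = 40 * k" "real (40 * k - 1) = 40 * real k - 1" using kk by auto
      then have "d (40 * k - 1) = lm (40 * real k * h) - lm ((40 * real k - 1) * h)"
        by (simp add: d_def)
      moreover have "e (k - 1) \<le> d (40 * k - 1)"
        unfolding e_def by (rule monoD[OF \<open>mono d\<close>]) (use kk in simp)
      moreover have "L k / (40 * exp 8) \<le> e (k - 1)"
        using k by (simp add: L_def I_def field_simps)
      ultimately show ?thesis by linarith
    qed
    ultimately show ?thesis by simp
  qed
  moreover have "I \<subseteq> {n * b..<n * (b + 1)}" by (auto simp: I_def)
  moreover have "n \<le> 2 * card I" using card by (simp add: I_def)
  ultimately show ?thesis using b by (intro exI[of _ b] conjI exI[of _ I] exI[of _ L]) auto
qed

theorem theorem1p1: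
  shows "\<exists>\<kappa> :: real \<Rightarrow> real.
    (\<forall>\<rho>>0. \<kappa> \<rho> > 0) \<and>
    (\<exists>C>0. \<kappa> \<sim>[at_top] (\<lambda>\<rho>. C * inverse \<rho>)) \<and>
    (\<forall>(f :: complex \<Rightarrow> complex) (\<rho> :: real).
       f holomorphic_on UNIV \<longrightarrow> \<not> f constant_on UNIV \<longrightarrow>
       \<rho> > 0 \<longrightarrow> entire_order f = ereal \<rho> \<longrightarrow>
       (\<forall>R. \<exists>r>R. \<forall>\<theta>1 \<theta>2.
          0 < \<theta>2 - \<theta>1 \<longrightarrow> \<theta>2 - \<theta>1 \<le> 2 * pi \<longrightarrow>
          relative_area r (sector \<theta>1 \<theta>2) f \<ge> (\<theta>2 - \<theta>1) * \<kappa> \<rho> / (2 * pi)))"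
proof -
  obtain \<kappa>0 L0 where \<kappa>0: "\<kappa>0 > 0" and scale:
    "\<And>f L z h \<theta>1 \<theta>2. f holomorphic_on UNIV \<Longrightarrow> f z \<noteq> 0 \<Longrightarrow> z \<noteq> 0 \<Longrightarrow> 0 < h \<Longrightarrow> h \<le> 1 / 3 \<Longrightarrow> L0 \<le> L \<Longrightarrow>
      max_modulus (norm z * exp (24 * h)) f \<le> exp L * norm (f z) \<Longrightarrow>
      max_modulus (norm z * exp (- h)) f \<le> exp (- (1 / (40 * exp 8)) * L) * norm (f z) \<Longrightarrow>
      \<theta>1 < \<theta>2 \<Longrightarrow> \<theta>2 - \<theta>1 \<le> 2 * pi \<Longrightarrow>
      ennreal (\<kappa>0 * (\<theta>2 - \<theta>1) * (h * norm z)\<^sup>2) \<le> emeasure lebesgue (f -` sector \<theta>1 \<theta>2 \<inter> ball z (5 * (h * norm z)))"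
  proof (rule scale_estimate[of "1 / (40 * exp 8)"], goal_cases)
    case (2 \<kappa> L0)
    show ?case by (rule 2(1)[OF 2(2) 2(4)])
  qed simp
  \<comment> \<open>At least (\<rho> + 1) / 2 discs, each adding at least \<kappa>0 \<alpha> h^2 /
    (9 \<pi>) for opening \<alpha>, with h^2 = 1 / (10000 (\<rho> + 1)^2), give \<kappa>0 \<alpha> /
    (180000 \<pi> (\<rho> + 1)), which is \<alpha> C / (2 \<pi> (\<rho> + 1)).\<close>
  define C where "C = \<kappa>0 / 90000"
  have C: "C > 0" using \<kappa>0 by (simp add: C_def)
  show ?thesis
  proof (intro exI[of _ "\<lambda>\<rho>. C / (\<rho> + 1)"] conjI allI impI)
    show "C / (\<rho> + 1) > 0" if "\<rho> > 0" for \<rho> using C that by simp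
    show "\<exists>C'>0. (\<lambda>\<rho>. C / (\<rho> + 1)) \<sim>[at_top] (\<lambda>\<rho>. C' * inverse \<rho>)"
      using asymp_equiv_inverse_shift[of C] C by auto
    fix f :: "complex \<Rightarrow> complex" and \<rho> R :: real
    assume f: "f holomorphic_on UNIV" and nc: "\<not> f constant_on UNIV"
      and \<rho>: "\<rho> > 0" and ord: "entire_order f = ereal \<rho>"
    define h where "h = 1 / (100 * (\<rho> + 1))"
    \<comment> \<open>With \<open>n\<close> within a factor 2 of \<rho> + 1, a block has logarithmic
      length 40 h n between 2 / 5 and 4 / 5: long enough for \<open>r\<close> to exceed
      \<open>R\<close> at a block chosen from \<open>R\<close> alone, short enough for the bound 1
      in \<open>relative_area_ge\<close>.\<close>
    define n where "n = nat \<lceil>\<rho> + 1\<rceil>"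
    have n: "\<rho> + 1 \<le> real n" "real n \<le> 2 * (\<rho> + 1)" "n \<ge> 1"
    proof -
      have "real n = of_int \<lceil>\<rho> + 1\<rceil>" using \<rho> by (simp add: n_def)
      moreover have "\<rho> + 1 \<le> of_int \<lceil>\<rho> + 1\<rceil>" "of_int \<lceil>\<rho> + 1\<rceil> < \<rho> + 1 + 1"
        using ceiling_correct[of "\<rho> + 1"] by simp_all
      ultimately have "\<rho> + 1 \<le> real n \<and> real n < \<rho> + 1 + 1" by simp
      then show "\<rho> + 1 \<le> real n" "real n \<le> 2 * (\<rho> + 1)" using \<rho> by simp_all
      then show "n \<ge> 1" using \<rho> by linarith
    qed
    have h: "0 < h" "h \<le> 1 / 100" using \<rho> by (auto simp: h_def field_simps)
    have hn: "1 / 100 \<le> h * real n" "h * real n \<le> 1 / 50"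
      using n \<rho> by (auto simp: h_def field_simps)
    define lm where "lm = log_max_modulus f"
    \<comment> \<open>Block, indices and centres are fixed before any sector appears, hence a common
      \<open>r\<close>. The threshold 3 |R| suffices because \<open>r\<close> exceeds 40 h n (b + 1)
      \<ge> 2 (b + 1) / 5.\<close>
    obtain b I L where b: "b \<ge> nat \<lceil>3 * \<bar>R\<bar>\<rceil>" and I: "I \<subseteq> {n * b..<n * (b + 1)}" "n \<le> 2 * card I"
      and L: "\<And>k. k \<in> I \<Longrightarrow> L0 \<le> L k \<and> lm ((40 * real k + 24) * h) \<le> lm (40 * real k * h) + L k \<and>
        lm ((40 * real k - 1) * h) \<le> lm (40 * real k * h) - L k / (40 * exp 8)"
      using regular_scales[OF f nc \<rho> ord h_def n(3), of "nat \<lceil>3 * \<bar>R\<bar>\<rceil>" L0] unfolding lm_def by blast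
    have "\<exists>z. norm z = exp (40 * real k * h) \<and> norm (f z) = max_modulus (exp (40 * real k * h)) f" for k
      using max_modulus_attained[OF f, of "exp (40 * real k * h)"] by auto
    then obtain z where z: "\<And>k. norm (z k) = exp (40 * real k * h)"
      and fz: "\<And>k. norm (f (z k)) = exp (lm (40 * real k * h))"
      unfolding lm_def exp_log_max_modulus[OF f nc] by metis
    define r where "r = exp (40 * h * real (n * b + n))"
    have "R < r"
    proof -
      have "3 * \<bar>R\<bar> \<le> real b" using b by linarith
      then have "\<bar>R\<bar> \<le> 40 * (1 / 100) * (real b + 1)" by (simp add: field_simps)
      also have "\<dots> \<le> 40 * (h * real n) * (real b + 1)" using hn by (intro mult_right_mono) auto
      also have "\<dots> = 40 * h * real (n * b + n)" by (simp add: algebra_simps)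
      also have "\<dots> < r" unfolding r_def using exp_ge_add_one_self[of "40 * h * real (n * b + n)"] by linarith
      finally show ?thesis by linarith
    qed
    moreover have "(\<theta>2 - \<theta>1) * (C / (\<rho> + 1)) / (2 * pi) \<le> relative_area r (sector \<theta>1 \<theta>2) f"
      if \<alpha>: "0 < \<theta>2 - \<theta>1" "\<theta>2 - \<theta>1 \<le> 2 * pi" for \<theta>1 \<theta>2
    proof -
      have area: "ennreal (\<kappa>0 * (\<theta>2 - \<theta>1) * (h * norm (z k))\<^sup>2) \<le>
          emeasure lebesgue (f -` sector \<theta>1 \<theta>2 \<inter> ball (z k) (5 * (h * norm (z k))))" if k: "k \<in> I" for k
      proof (rule scale[OF f, where L="L k"])
        show "f (z k) \<noteq> 0" using fz[of k] by auto
        show "z k \<noteq> 0" using z[of k] by auto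
        have "norm (z k) * exp (24 * h) = exp ((40 * real k + 24) * h)"
          by (simp add: z algebra_simps flip: exp_add)
        then show "max_modulus (norm (z k) * exp (24 * h)) f \<le> exp (L k) * norm (f (z k))"
          using L[OF k] by (simp add: fz lm_def add.commute flip: exp_add exp_log_max_modulus[OF f nc])
        have "norm (z k) * exp (- h) = exp ((40 * real k - 1) * h)"
          by (simp add: z algebra_simps flip: exp_add)
        then show "max_modulus (norm (z k) * exp (- h)) f \<le> exp (- (1 / (40 * exp 8)) * L k) * norm (f (z k))"
          using L[OF k] by (simp add: fz lm_def add.commute flip: exp_add exp_log_max_modulus[OF f nc])
      qed (use h L[OF k] \<alpha> in auto)
      have "(\<theta>2 - \<theta>1) * (C / (\<rho> + 1)) / (2 * pi) = (\<rho> + 1) / 2 * (\<kappa>0 * (\<theta>2 - \<theta>1)) * h\<^sup>2 / (9 * pi)"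
        using \<rho> by (simp add: C_def h_def power2_eq_square divide_simps) (simp add: algebra_simps)
      also have "\<dots> \<le> real (card I) * (\<kappa>0 * (\<theta>2 - \<theta>1)) * h\<^sup>2 / (9 * pi)"
      proof -
        have "real n \<le> 2 * real (card I)" using I(2) by linarith
        then have "\<rho> + 1 \<le> 2 * real (card I)" using n(1) by (rule order.trans[rotated])
        then have "(\<rho> + 1) / 2 \<le> real (card I)" by (simp add: field_simps)
        then show ?thesis using \<kappa>0 \<alpha> by (intro divide_right_mono mult_right_mono) auto
      qed
      also have "\<dots> \<le> relative_area (exp (40 * h * real (n * b + n))) (sector \<theta>1 \<theta>2) f"
      proof (rule relative_area_ge[OF h f z _ _ _ _ area])
        show "finite I" using I(1) by (rule finite_subset) simp
        show "n * b \<le> k \<and> k < n * b + n" if "k \<in> I" for k using I(1) that by auto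
      qed (use hn \<kappa>0 \<alpha> in auto)
      finally show ?thesis by (simp add: r_def)
    qed
    ultimately show "\<exists>r>R. \<forall>\<theta>1 \<theta>2. 0 < \<theta>2 - \<theta>1 \<longrightarrow> \<theta>2 - \<theta>1 \<le> 2 * pi \<longrightarrow>
        (\<theta>2 - \<theta>1) * (C / (\<rho> + 1)) / (2 * pi) \<le> relative_area r (sector \<theta>1 \<theta>2) f"
      by blast
  qed
qed

end
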